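(* The Teichmüller space $\mathcal{T}$ of a right hexagon is homeomorphic to an open ball of dimension three, and it can be compactified as a closed ball of dimension three by the space $\mathcal{PMF}$ of projective measured foliations of the hexagon, which is the boundary two-sphere. That is: with $\mathcal{T}$ identified with $\pi\circ l_*(\mathcal{T})$ and $\mathcal{PMF}$ identified with $\pi\circ i_*(\mathcal{MF})$, the subspace $$\overline{\mathcal{T}}=\pi\circ l_*(\mathcal{T})\cup\pi\circ i_*(\mathcal{MF})$$ of the projective space $\mathrm{P}\mathbb{R}^6$ is homeomorphic to a closed $3$-dimensional ball, by a homeomorphism taking $\mathcal{T}$ onto the open ball and $\mathcal{PMF}$ onto the boundary $2$-sphere.
   Context: The sides of the hexagon $H$ are denoted, in cyclic order, $a,C,b,A,c,B$ (so $a$ is opposite to $A$, $b$ to $B$, $c$ to $C$). Teichmüller space. A right hexagon is a hexagon equipped with a hyperbolic metric such that all the edges are geodesic and all angles are right. $\mathcal{T}$ is the set of right hexagons with sides labelled, in cyclic order, $a,C,b,A,c,B$, up to label-preserving isometry. For $h\in\mathcal{T}$ and a side $s$, $l_h(s)$ is the length of $s$. Let $l_*:\mathcal{T}\to\mathbb{R}^6_{>0}$, $l_*(h)=(l_h(a),l_h(b),l_h(c),l_h(A),l_h(B),l_h(C))$; this is an embedding (this gives the topology of $\mathcal{T}$). Measured foliations. An arc in $H$ is the homeomorphic image of a closed interval whose interior is in the interior of $H$ and whose endpoints are on $\partial H$. Homotopies are relative to the boundary in the sense that each boundary edge is fixed setwise. A measured foliation of $H$ is a foliation with isolated singularities having 3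 separatrices (there are zero or one singularities), such that no leaf is homotopic to a point (in particular no leaf joins two adjacent edges), equipped with an invariant transverse measure. A measured foliation may also be represented by a partial foliation, supported on a subsurface of $H$; collapsing the non-foliated regions gives a measured foliation well defined up to equivalence. Foliations are considered up to homotopy, and $\mathcal{MF}$ is the set of equivalence classes. Equivalently, an element of $\mathcal{MF}$ is a nonempty finite family of pairwise disjoint, pairwise non-homotopic arcs each joining two non-adjacent edges of $H$ (up to homotopy), each with a positive weight: the weighted arcs record the homotopy classes of the bands of parallel nonsingular leaves and their transverse widths. The geometric intersection number $i(F,\delta)$ of $F$ with an arc $\delta$ is the infimum of the transverse $F$-measures of arcs homotopic to $\delta$. For a side $s$, $i(F,s)$ denotes the intersection number with the arc parallel to $s$, joining the two sides adjacent to $s$. Let $i_*:\mathcal{MF}\to\mathbb{R}^6_{\geq0}$, $i_*(F)=(i(F,a),i(F,b),i(F,c),i(F,A),i(F,B),i(F,C))$; this is an embedding (this gives the topology of $\mathcal{MF}$). $\mathbb{R}_{>0}$ acts on $\mathcal{MF}$ by scaling the transverse measure, and $\mathcal{PMF}=\mathcal{MF}/\mathbb{R}_{>0}$. $\pi:\mathbb{R}^6\setminus\{0\}\to\mathrm{P}\mathbb{R}^6$ is the projection. *)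

theory Defs
  imports "HOL-Analysis.Analysis"
begin

section \<open>Sides of the hexagon\<close>

datatype side = Side_a | Side_C | Side_b | Side_A | Side_c | Side_B

primrec next_side :: "side \<Rightarrow> side" where
  "next_side Side_a = Side_C"
| "next_side Side_C = Side_b"
| "next_side Side_b = Side_A"
| "next_side Side_A = Side_c"
| "next_side Side_c = Side_B"
| "next_side Side_B = Side_a"

primrec prev_side :: "side \<Rightarrow> side" where
  "prev_side Side_a = Side_B"
| "prev_side Side_C = Side_a"
| "prev_side Side_b = Side_C"
| "prev_side Side_A = Side_b"
| "prev_side Side_c = Side_A"
| "prev_side Side_B = Side_c"

lemma UNIV_side: "(UNIV :: side set) = {Side_a, Side_C, Side_b, Side_A, Side_c, Side_B}"
  using side.exhaust by auto

text \<open>The instance below makes \<open>real ^ side\<close> available: it is the space \<open>\<real>\<^sup>6\<close> with its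
  coordinates named by the sides.\<close>

instance side :: finite
  by standard (simp add: UNIV_side)

definition nonadjacent :: "side \<Rightarrow> side \<Rightarrow> bool" where
  "nonadjacent i j \<longleftrightarrow> i \<noteq> j \<and> j \<noteq> next_side i \<and> i \<noteq> next_side j"


section \<open>Quotient topologies and the projective space\<close>

definition quotient_topology :: "'a topology \<Rightarrow> ('a \<Rightarrow> 'b) \<Rightarrow> 'b topology" where
  "quotient_topology X q =
     topology (\<lambda>U. U \<subseteq> q ` topspace X \<and> openin X {x \<in> topspace X. q x \<in> U})"

lemma openin_quotient_topology:
  "openin (quotient_topology X q) U \<longleftrightarrow>
     U \<subseteq> q ` topspace X \<and> openin X {x \<in> topspace X. q x \<in> U}"
proof -
  have "istopology (\<lambda>U. U \<subseteq> q ` topspace X \<and> openin X {x \<in> topspace X. q x \<in> U})"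
    unfolding istopology_def
  proof (intro conjI allI impI; (elim conjE)?)
    fix S T
    assume "openin X {x \<in> topspace X. q x \<in> S}" "openin X {x \<in> topspace X. q x \<in> T}"
    then have "openin X ({x \<in> topspace X. q x \<in> S} \<inter> {x \<in> topspace X. q x \<in> T})"
      by (rule openin_Int)
    moreover have "{x \<in> topspace X. q x \<in> S} \<inter> {x \<in> topspace X. q x \<in> T}
        = {x \<in> topspace X. q x \<in> S \<inter> T}"
      by auto
    ultimately show "openin X {x \<in> topspace X. q x \<in> S \<inter> T}"
      by simp
  next
    fix K
    assume K: "\<forall>S\<in>K. S \<subseteq> q ` topspace X \<and> openin X {x \<in> topspace X. q x \<in> S}"
    have "openin X (\<Union>S\<in>K. {x \<in> topspace X. q x \<in> S})"
      using K by blast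
    moreover have "(\<Union>S\<in>K. {x \<in> topspace X. q x \<in> S}) = {x \<in> topspace X. q x \<in> \<Union>K}"
      by auto
    ultimately show "openin X {x \<in> topspace X. q x \<in> \<Union>K}"
      by simp
  qed auto
  then show ?thesis
    by (simp add: quotient_topology_def)
qed

lemma topspace_quotient_topology: "topspace (quotient_topology X q) = q ` topspace X"
proof -
  have *: "{x \<in> topspace X. q x \<in> q ` topspace X} = topspace X"
    by auto
  have "openin (quotient_topology X q) (q ` topspace X)"
    unfolding openin_quotient_topology * by simp
  then show ?thesis
    by (metis openin_quotient_topology openin_subset openin_topspace subset_antisym)
qed

text \<open>A point of the projective space is a line through the origin.\<close>

definition proj :: "real ^ side \<Rightarrow> (real ^ side) set" where
  "proj x = span {x}"

definition projective_space :: "(real ^ side) set topology" where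
  "projective_space = quotient_topology (top_of_set (- {0})) proj"


section \<open>Right hexagons and their Teichmueller space\<close>

text \<open>The hyperbolic plane is the upper sheet of the hyperboloid in Minkowski space.\<close>

definition mink :: "real ^ 3 \<Rightarrow> real ^ 3 \<Rightarrow> real" where
  "mink x y = x $ 1 * y $ 1 + x $ 2 * y $ 2 - x $ 3 * y $ 3"

definition hyp_plane :: "(real ^ 3) set" where
  "hyp_plane = {x. mink x x = -1 \<and> x $ 3 > 0}"

definition hyp_dist :: "real ^ 3 \<Rightarrow> real ^ 3 \<Rightarrow> real" where
  "hyp_dist x y = arcosh (- mink x y)"

definition hyp_segment :: "real ^ 3 \<Rightarrow> real ^ 3 \<Rightarrow> (real ^ 3) set" where
  "hyp_segment x y = {z \<in> hyp_plane. hyp_dist x z + hyp_dist z y = hyp_dist x y}"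

definition hyp_isometry :: "(real ^ 3 \<Rightarrow> real ^ 3) \<Rightarrow> bool" where
  "hyp_isometry \<phi> \<longleftrightarrow> bij_betw \<phi> hyp_plane hyp_plane \<and>
     (\<forall>x\<in>hyp_plane. \<forall>y\<in>hyp_plane. hyp_dist (\<phi> x) (\<phi> y) = hyp_dist x y)"

text \<open>The orthogonal projection of \<open>y\<close> to the tangent space at \<open>x\<close>; for distinct points of the
  plane it is a positive multiple of the initial velocity of the geodesic from \<open>x\<close> to \<open>y\<close>.
  The metric of the tangent spaces is the restriction of \<^const>\<open>mink\<close>.\<close>

definition tangent_toward :: "real ^ 3 \<Rightarrow> real ^ 3 \<Rightarrow> real ^ 3" where
  "tangent_toward x y = y + mink x y *\<^sub>R x"

definition right_angle :: "real ^ 3 \<Rightarrow> real ^ 3 \<Rightarrow> real ^ 3 \<Rightarrow> bool" where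
  "right_angle y x z \<longleftrightarrow> mink (tangent_toward x y) (tangent_toward x z) = 0"

text \<open>The geodesic through two distinct points \<open>x\<close>, \<open>y\<close> is the zero set of
  \<open>z \<mapsto> det (x, y, z)\<close>, whose sign tells its two sides apart.\<close>

definition strictly_same_side :: "real ^ 3 \<Rightarrow> real ^ 3 \<Rightarrow> (real ^ 3) set \<Rightarrow> bool" where
  "strictly_same_side x y Z \<longleftrightarrow>
     (\<forall>z\<in>Z. det (vector [x, y, z] :: real ^ 3 ^ 3) > 0) \<or>
     (\<forall>z\<in>Z. det (vector [x, y, z] :: real ^ 3 ^ 3) < 0)"

text \<open>A right hexagon is given by its corners; \<open>p s\<close> is the corner at which the side \<open>s\<close> follows
  the side \<open>prev_side s\<close>. As all interior angles are right, hence less than \<open>pi\<close>, the hexagon is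
  convex. Convexity is stated by the condition that the line carrying a side has the remaining
  corners strictly on one side: this makes the closed polygon simple, and makes the
  angle between two consecutive sides the interior one.\<close>

definition hex_side :: "(side \<Rightarrow> real ^ 3) \<Rightarrow> side \<Rightarrow> (real ^ 3) set" where
  "hex_side p s = hyp_segment (p s) (p (next_side s))"

definition right_hexagon :: "(side \<Rightarrow> real ^ 3) \<Rightarrow> bool" where
  "right_hexagon p \<longleftrightarrow>
     (\<forall>s. p s \<in> hyp_plane) \<and>
     (\<forall>s. strictly_same_side (p s) (p (next_side s)) (p ` (- {s, next_side s}))) \<and>
     (\<forall>s. right_angle (p (prev_side s)) (p s) (p (next_side s)))"

definition label_isometric :: "((side \<Rightarrow> real ^ 3) \<times> (side \<Rightarrow> real ^ 3)) set" where
  "label_isometric = {(p, q). right_hexagon p \<and> right_hexagon q \<and>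
     (\<exists>\<phi>. hyp_isometry \<phi> \<and> (\<forall>s. \<phi> ` hex_side p s = hex_side q s))}"

definition Teich :: "(side \<Rightarrow> real ^ 3) set set" where
  "Teich = Collect right_hexagon // label_isometric"

definition side_length :: "(side \<Rightarrow> real ^ 3) set \<Rightarrow> side \<Rightarrow> real" where
  "side_length h s = the_elem ((\<lambda>p. hyp_dist (p s) (p (next_side s))) ` h)"

definition l_star :: "(side \<Rightarrow> real ^ 3) set \<Rightarrow> real ^ side" where
  "l_star h = (\<chi> s. side_length h s)"

definition Teich_topology :: "(side \<Rightarrow> real ^ 3) set topology" where
  "Teich_topology = pullback_topology Teich l_star euclidean"


section \<open>Arcs in the topological hexagon\<close>

text \<open>Any convex hexagon serves as the topological hexagon. This one is affinely regular.\<close>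

primrec corner :: "side \<Rightarrow> complex" where
  "corner Side_a = Complex 1 0"
| "corner Side_C = Complex 1 1"
| "corner Side_b = Complex 0 1"
| "corner Side_A = Complex (- 1) 0"
| "corner Side_c = Complex (- 1) (- 1)"
| "corner Side_B = Complex 0 (- 1)"

definition hexagon :: "complex set" where
  "hexagon = convex hull (range corner)"

text \<open>Sides are taken without their end points, so that an arc ends on at most one side at each
  end.\<close>

definition edge :: "side \<Rightarrow> complex set" where
  "edge s = open_segment (corner s) (corner (next_side s))"

definition hexagon_arc :: "(real \<Rightarrow> complex) \<Rightarrow> bool" where
  "hexagon_arc \<gamma> \<longleftrightarrow> arc \<gamma> \<and> \<gamma> ` {0<..<1} \<subseteq> interior hexagon \<and>
     pathstart \<gamma> \<in> frontier hexagon \<and> pathfinish \<gamma> \<in> frontier hexagon"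

definition arc_joins :: "side \<Rightarrow> side \<Rightarrow> (real \<Rightarrow> complex) \<Rightarrow> bool" where
  "arc_joins i j \<gamma> \<longleftrightarrow> pathstart \<gamma> \<in> edge i \<and> pathfinish \<gamma> \<in> edge j"

text \<open>Arcs are unoriented, whence the second disjunct.\<close>

definition arcs_homotopic :: "(real \<Rightarrow> complex) \<Rightarrow> (real \<Rightarrow> complex) \<Rightarrow> bool" where
  "arcs_homotopic \<alpha> \<beta> \<longleftrightarrow> (\<exists>i j.
     homotopic_with_canon (arc_joins i j) {0..1} hexagon \<alpha> \<beta> \<or>
     homotopic_with_canon (arc_joins i j) {0..1} hexagon \<alpha> (reversepath \<beta>))"

text \<open>In an affinely regular hexagon, the segment joining the midpoints of the two sides adjacent
  to \<open>s\<close> is an arc parallel to \<open>s\<close>.\<close>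

definition parallel_arc :: "side \<Rightarrow> real \<Rightarrow> complex" where
  "parallel_arc s =
     linepath (midpoint (corner (prev_side s)) (corner s))
       (midpoint (corner (next_side s)) (corner (next_side (next_side s))))"


section \<open>Measured foliations\<close>

text \<open>A foliation is represented by a partial foliation, consisting of disjoint bands of parallel
  leaves, one band for each of the homotopy classes of leaves. A band \<open>(w, \<beta>)\<close> of width \<open>w\<close> is a
  foliated rectangle, embedded by \<open>\<beta>\<close> on \<open>{0..w} \<times> {0..1}\<close>; its leaves are the curves
  \<open>x \<mapsto> \<beta> (t, x)\<close> and its transverse measure is \<open>\<bar>dt\<bar>\<close>.\<close>

type_synonym band = "real \<times> (real \<times> real \<Rightarrow> complex)"

definition leaf :: "band \<Rightarrow> real \<Rightarrow> real \<Rightarrow> complex" where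
  "leaf b t = (\<lambda>x. snd b (t, x))"

definition band_support :: "band \<Rightarrow> complex set" where
  "band_support b = snd b ` ({0..fst b} \<times> {0..1})"

definition foliated_band :: "band \<Rightarrow> bool" where
  "foliated_band b \<longleftrightarrow> fst b > 0 \<and>
     continuous_on ({0..fst b} \<times> {0..1}) (snd b) \<and> inj_on (snd b) ({0..fst b} \<times> {0..1}) \<and>
     (\<exists>i j. nonadjacent i j \<and>
        (\<forall>t\<in>{0..fst b}. hexagon_arc (leaf b t) \<and> arc_joins i j (leaf b t)))"

definition measured_foliation :: "band set \<Rightarrow> bool" where
  "measured_foliation F \<longleftrightarrow> finite F \<and> F \<noteq> {} \<and> (\<forall>b\<in>F. foliated_band b) \<and>
     (\<forall>b\<in>F. \<forall>b'\<in>F. b \<noteq> b' \<longrightarrow>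
        band_support b \<inter> band_support b' = {} \<and> \<not> arcs_homotopic (leaf b 0) (leaf b' 0))"

text \<open>All leaves of a band are homotopic, so that comparing one leaf of each band suffices.\<close>

definition foliation_equiv :: "(band set \<times> band set) set" where
  "foliation_equiv = {(F, G). measured_foliation F \<and> measured_foliation G \<and>
     (\<exists>f. bij_betw f F G \<and>
        (\<forall>b\<in>F. fst (f b) = fst b \<and> arcs_homotopic (leaf b 0) (leaf (f b) 0)))}"

definition MF :: "band set set set" where
  "MF = Collect measured_foliation // foliation_equiv"

text \<open>The total variation of the transverse measure along an arc: in each band, the number of
  intersections with the leaves is integrated over the space of leaves.\<close>

definition transverse_measure :: "band set \<Rightarrow> (real \<Rightarrow> complex) \<Rightarrow> ennreal" where
  "transverse_measure F \<delta> = (\<Sum>b\<in>F. \<integral>\<^sup>+t\<in>{0..fst b}.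
     emeasure (count_space UNIV) (path_image \<delta> \<inter> path_image (leaf b t)) \<partial>lborel)"

text \<open>As foliations are considered up to homotopy, the infimum is over all
  representatives of the class as well as over the arcs homotopic to the given one.\<close>

definition intersection_number :: "band set set \<Rightarrow> (real \<Rightarrow> complex) \<Rightarrow> ennreal" where
  "intersection_number X \<delta> =
     (INF F\<in>X. INF \<delta>'\<in>{\<delta>'. hexagon_arc \<delta>' \<and> arcs_homotopic \<delta> \<delta>'}. transverse_measure F \<delta>')"

definition i_star :: "band set set \<Rightarrow> real ^ side" where
  "i_star X = (\<chi> s. enn2real (intersection_number X (parallel_arc s)))"

definition MF_topology :: "band set set topology" where
  "MF_topology = pullback_topology MF i_star euclidean"

definition scale_band :: "real \<Rightarrow> band \<Rightarrow> band" where
  "scale_band c b = (c * fst b, \<lambda>(t, x). snd b (t / c, x))"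

definition scaling_equiv :: "(band set set \<times> band set set) set" where
  "scaling_equiv = {(X, Y). X \<in> MF \<and> Y \<in> MF \<and>
     (\<exists>c>0. \<exists>F\<in>X. scale_band c ` F \<in> Y)}"

definition PMF :: "band set set set set" where
  "PMF = MF // scaling_equiv"

definition PMF_topology :: "band set set set topology" where
  "PMF_topology = quotient_topology MF_topology (\<lambda>X. scaling_equiv `` {X})"


section \<open>The maps to the projective space\<close>

definition PMF_to_proj :: "band set set set \<Rightarrow> (real ^ side) set" where
  "PMF_to_proj P = the_elem ((\<lambda>X. proj (i_star X)) ` P)"

definition Teich_closure :: "(real ^ side) set set" where
  "Teich_closure = (proj \<circ> l_star) ` Teich \<union> (proj \<circ> i_star) ` MF"

end

theory Submission
  imports Defs
begin

text \<open>
A right hexagon is determined by the lengths \<open>a\<close>, \<open>b\<close>, \<open>c\<close> of three pairwise non-adjacent sides,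
and these can be any positive numbers. In the hyperboloid model this is linear algebra: the outward
unit normals of the lines \<open>A\<close>, \<open>B\<close>, \<open>C\<close> have the Gram matrix with entries \<open>1\<close> and \<open>- cosh a\<close>,
\<open>- cosh b\<close>, \<open>- cosh c\<close>, and the corners are explicit combinations of these normals. Vectors with
such a Gram matrix exist (\<open>right_hexagon_exists\<close>) and are unique up to a Lorentz map
(\<open>right_hexagon_unique\<close>). The other three lengths follow from the law of cosines. With the
coordinates \<open>y\<^sub>1 = ln (sinh a)\<close>, \<open>y\<^sub>2 = ln (sinh b)\<close>, \<open>y\<^sub>3 = ln (sinh c)\<close> the Teichmueller space
becomes \<open>\<real>\<^sup>3\<close>, and the six lengths become the function \<open>teich_lengths\<close> of \<open>y\<close>.

A measured foliation is a weighting of the nine classes of arcs between non-adjacent sides whose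
support has no two crossing classes: arcs of crossing classes must intersect, by the Fashoda theorem
(\<open>crossing_arcs_intersect\<close>), and straight bands realise all other combinations. The same theorem bounds
intersection numbers from below, and straight chords attain the bound, so \<open>i_star\<close> adds up the weights
of the classes that end on each side. The fourteen maximal non-crossing families correspond to the
cones of a complete fan in \<open>\<real>\<^sup>3\<close>: there is a positively homogeneous, piecewise linear function
\<open>tropical_lengths\<close> that maps \<open>\<real>\<^sup>3 - {0}\<close> bijectively onto the image of \<open>i_star\<close>
(\<open>i_star_image_tropical\<close>).

The two descriptions fit together. Up to bounded factors, \<open>sinh\<close> and \<open>cosh\<close> in the law of cosines are
powers of \<open>e\<close> and a sum is a maximum; so \<open>teich_lengths\<close> and \<open>tropical_lengths\<close> differ by at most
\<open>ln 16\<close> in each coordinate (\<open>teich_lengths_near_tropical_lengths\<close>). Hence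
\<open>(1 - \<bar>y\<bar>) teich_lengths (y / (1 - \<bar>y\<bar>))\<close> extends continuously from the open unit ball to the closed
one, with the values of \<open>tropical_lengths\<close> on the sphere. Its composition with the projection to the
projective space is injective: no hexagon has lengths proportional to those of another one
(\<open>teich_lengths_not_proportional\<close>), proportional values of the homogeneous and injective
\<open>tropical_lengths\<close> come from the same ray, and a foliation has a vanishing coordinate while lengths are
positive. An injective continuous map from a compact space to a Hausdorff space is an embedding, and
all assertions are read off from this one embedding of the closed ball.
\<close>

section \<open>The hyperboloid model\<close>

definition det3 :: "real ^ 3 \<Rightarrow> real ^ 3 \<Rightarrow> real ^ 3 \<Rightarrow> real" where
  "det3 x y z = det (vector [x, y, z] :: real ^ 3 ^ 3)"

lemma det3_expand:
  "det3 x y z = x$1 * (y$2 * z$3 - y$3 * z$2) - x$2 * (y$1 * z$3 - y$3 * z$1)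
     + x$3 * (y$1 * z$2 - y$2 * z$1)"
  unfolding det3_def det_3 by (simp add: algebra_simps)

lemma mink_add_left: "mink (x + y) z = mink x z + mink y z"
  and mink_add_right: "mink z (x + y) = mink z x + mink z y"
  and mink_diff_left: "mink (x - y) z = mink x z - mink y z"
  and mink_diff_right: "mink z (x - y) = mink z x - mink z y"
  and mink_scale_left: "mink (c *\<^sub>R x) z = c * mink x z"
  and mink_scale_right: "mink z (c *\<^sub>R x) = c * mink z x"
  and mink_minus_left: "mink (- x) z = - mink x z"
  and mink_minus_right: "mink z (- x) = - mink z x"
  by (simp_all add: mink_def algebra_simps)

lemmas mink_linear = mink_add_left mink_add_right mink_diff_left mink_diff_right
  mink_scale_left mink_scale_right mink_minus_left mink_minus_right

lemma mink_commute: "mink x y = mink y x"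
  by (simp add: mink_def algebra_simps)

text \<open>The determinant of the Gram matrix is the square of the determinant of the vectors, times the
  determinant \<open>-1\<close> of the Minkowski form. The version with two different last vectors compares the
  orientations of two bases.\<close>

lemma gram_det:
  "det3 x y z * det3 x y w =
     - (mink x x * (mink y y * mink z w - mink y w * mink z y)
        - mink x y * (mink y x * mink z w - mink y w * mink z x)
        + mink x w * (mink y x * mink z y - mink y y * mink z x))"
  unfolding det3_expand mink_def by (simp add: algebra_simps)

lemma gram_det_square:
  "(det3 x y z)\<^sup>2 =
     - (mink x x * (mink y y * mink z z - (mink y z)\<^sup>2)
        - mink x y * (mink x y * mink z z - mink y z * mink x z)
        + mink x z * (mink x y * mink y z - mink y y * mink x z))"
  using gram_det[of x y z z] by (simp add: power2_eq_square mink_commute)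

lemma hyp_planeD: "x \<in> hyp_plane \<Longrightarrow> mink x x = -1" "x \<in> hyp_plane \<Longrightarrow> x $ 3 > 0"
  by (auto simp: hyp_plane_def)

text \<open>The reversed Cauchy-Schwarz inequality for timelike vectors.\<close>

lemma mink_hyp_plane_le:
  assumes "x \<in> hyp_plane" "y \<in> hyp_plane"
  shows "mink x y \<le> -1"
proof -
  let ?r = "x$1 * y$1 + x$2 * y$2"
  have x: "(x$3)\<^sup>2 = 1 + (x$1)\<^sup>2 + (x$2)\<^sup>2" and y: "(y$3)\<^sup>2 = 1 + (y$1)\<^sup>2 + (y$2)\<^sup>2"
    and pos: "x$3 > 0" "y$3 > 0"
    using assms by (auto simp: hyp_plane_def mink_def power2_eq_square)
  have "(1 + ?r)\<^sup>2 \<le> (1 + ?r)\<^sup>2 + ((x$1 - y$1)\<^sup>2 + (x$2 - y$2)\<^sup>2 + (x$1 * y$2 - x$2 * y$1)\<^sup>2)"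
    by simp
  also have "\<dots> = (1 + (x$1)\<^sup>2 + (x$2)\<^sup>2) * (1 + (y$1)\<^sup>2 + (y$2)\<^sup>2)"
    by algebra
  also have "\<dots> = (x$3 * y$3)\<^sup>2"
    by (simp add: power_mult_distrib x y)
  finally have "1 + ?r \<le> x$3 * y$3"
    using pos by (metis less_eq_real_def mult_pos_pos power2_le_imp_le)
  then show ?thesis
    by (simp add: mink_def)
qed

text \<open>The vectors with \<open>mink y y = -1\<close> form two sheets, and products across the sheets are positive.\<close>

lemma in_hyp_plane_if:
  assumes "mink y y = -1" "q \<in> hyp_plane" "mink y q < 0"
  shows "y \<in> hyp_plane"
proof (rule ccontr)
  assume "y \<notin> hyp_plane"
  then have "y $ 3 \<le> 0"
    using assms by (auto simp: hyp_plane_def)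
  moreover have "y $ 3 \<noteq> 0"
  proof
    assume "y $ 3 = 0"
    then have "mink y y \<ge> 0" by (simp add: mink_def)
    then show False using assms by simp
  qed
  ultimately have "- y \<in> hyp_plane"
    using assms by (auto simp: hyp_plane_def mink_linear)
  from mink_hyp_plane_le[OF this assms(2)] show False
    using assms by (simp add: mink_linear)
qed

text \<open>The form is positive definite on the orthogonal complement of a timelike vector.\<close>

lemma orthogonal_null_vector:
  assumes "mink d d = 0" "mink d x = 0" "x \<in> hyp_plane"
  shows "d = 0"
proof -
  have d: "(d$3)\<^sup>2 = (d$1)\<^sup>2 + (d$2)\<^sup>2" and dx: "d$3 * x$3 = d$1 * x$1 + d$2 * x$2"
    and x: "(x$3)\<^sup>2 = 1 + (x$1)\<^sup>2 + (x$2)\<^sup>2"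
    using assms by (auto simp: hyp_plane_def mink_def power2_eq_square)
  have "(d$3)\<^sup>2 * (x$3)\<^sup>2 + (d$1 * x$2 - d$2 * x$1)\<^sup>2
      = ((d$1)\<^sup>2 + (d$2)\<^sup>2) * ((x$1)\<^sup>2 + (x$2)\<^sup>2)"
    unfolding power_mult_distrib[symmetric] dx by algebra
  also have "\<dots> = (d$3)\<^sup>2 * ((x$3)\<^sup>2 - 1)"
    using d x by simp
  finally have "(d$3)\<^sup>2 + (d$1 * x$2 - d$2 * x$1)\<^sup>2 = 0"
    by (simp add: algebra_simps)
  then have "d$3 = 0"
    by (simp add: sum_power2_eq_zero_iff)
  with d have "d$1 = 0" "d$2 = 0"
    by (auto simp: sum_power2_eq_zero_iff)
  with \<open>d$3 = 0\<close> show ?thesis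
    by (simp add: vec_eq_iff forall_3)
qed

lemma cosh_hyp_dist:
  assumes "x \<in> hyp_plane" "y \<in> hyp_plane"
  shows "cosh (hyp_dist x y) = - mink x y" "hyp_dist x y \<ge> 0"
  using mink_hyp_plane_le[OF assms] by (auto simp: hyp_dist_def)

lemma hyp_dist_commute: "hyp_dist x y = hyp_dist y x"
  by (simp add: hyp_dist_def mink_commute)

lemma hyp_dist_self: "x \<in> hyp_plane \<Longrightarrow> hyp_dist x x = 0"
  by (simp add: hyp_dist_def hyp_planeD)

lemma hyp_gram:
  assumes "x \<in> hyp_plane" "y \<in> hyp_plane" "z \<in> hyp_plane"
  shows "(mink x z + mink x y * mink y z)\<^sup>2 + (det3 x y z)\<^sup>2
     = ((mink x y)\<^sup>2 - 1) * ((mink y z)\<^sup>2 - 1)"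
  unfolding gram_det_square using assms[THEN hyp_planeD(1)]
  by (simp add: power2_eq_square algebra_simps)

text \<open>As \<open>(det3 x y z)\<^sup>2 \<ge> 0\<close>, the Gram determinant bounds \<open>- mink x z\<close> by the right-hand side of
  the addition formula for \<open>cosh\<close>.\<close>

lemma hyp_dist_triangle:
  assumes "x \<in> hyp_plane" "y \<in> hyp_plane" "z \<in> hyp_plane"
  shows "hyp_dist x z \<le> hyp_dist x y + hyp_dist y z"
proof -
  let ?d = "hyp_dist x y" and ?e = "hyp_dist y z"
  note [simp] = cosh_hyp_dist(1)[OF assms(1,2)] cosh_hyp_dist(1)[OF assms(2,3)]
    cosh_hyp_dist(1)[OF assms(1,3)]
  note nonneg = cosh_hyp_dist(2)[OF assms(1,2)] cosh_hyp_dist(2)[OF assms(2,3)]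
    cosh_hyp_dist(2)[OF assms(1,3)]
  have "0 \<le> (det3 x y z)\<^sup>2"
    by simp
  then have "(mink x z + mink x y * mink y z)\<^sup>2 \<le> ((mink x y)\<^sup>2 - 1) * ((mink y z)\<^sup>2 - 1)"
    using hyp_gram[OF assms] by linarith
  also have "(mink x y)\<^sup>2 - 1 = (sinh ?d)\<^sup>2"
    unfolding sinh_square_eq by simp
  also have "(mink y z)\<^sup>2 - 1 = (sinh ?e)\<^sup>2"
    unfolding sinh_square_eq by simp
  finally have "(mink x z + mink x y * mink y z)\<^sup>2 \<le> (sinh ?d * sinh ?e)\<^sup>2"
    unfolding power_mult_distrib .
  moreover have "0 \<le> sinh ?d * sinh ?e"
    using nonneg by (intro mult_nonneg_nonneg) auto
  ultimately have "\<bar>mink x z + mink x y * mink y z\<bar> \<le> sinh ?d * sinh ?e"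
    using abs_le_square_iff by force
  then have "cosh (hyp_dist x z) \<le> cosh (?d + ?e)"
    by (simp add: cosh_add)
  then show ?thesis
    using nonneg by (subst (asm) cosh_real_nonneg_le_iff) auto
qed

text \<open>The length of a segment is the diameter of its set of points. This matters since a
  label-preserving isometry is only required to match the sides as sets, not their corners.\<close>

lemma hyp_dist_le_ends_of_segment:
  assumes "x \<in> hyp_plane" "y \<in> hyp_plane" "z \<in> hyp_segment x y" "w \<in> hyp_segment x y"
  shows "hyp_dist z w \<le> hyp_dist x y"
proof -
  have zw: "z \<in> hyp_plane" "w \<in> hyp_plane" and
    "hyp_dist x z + hyp_dist z y = hyp_dist x y" "hyp_dist x w + hyp_dist w y = hyp_dist x y"
    using assms by (auto simp: hyp_segment_def)
  moreover have "hyp_dist z w \<le> hyp_dist z x + hyp_dist x w"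
    "hyp_dist z w \<le> hyp_dist z y + hyp_dist y w"
    using hyp_dist_triangle assms zw by blast+
  ultimately show ?thesis
    using hyp_dist_commute[of z x] hyp_dist_commute[of w y] by linarith
qed

lemma ends_in_hyp_segment:
  assumes "x \<in> hyp_plane" "y \<in> hyp_plane"
  shows "x \<in> hyp_segment x y" "y \<in> hyp_segment x y"
  using assms by (auto simp: hyp_segment_def hyp_dist_self)

section \<open>Isometry classes of hexagons\<close>

lemma hyp_isometry_compose:
  "hyp_isometry f \<Longrightarrow> hyp_isometry g \<Longrightarrow> hyp_isometry (g \<circ> f)"
  unfolding hyp_isometry_def by (auto intro: bij_betw_trans simp: bij_betw_apply)

lemma hyp_isometry_inverse:
  assumes "hyp_isometry f"
  shows "hyp_isometry (the_inv_into hyp_plane f)"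
proof -
  have f: "bij_betw f hyp_plane hyp_plane"
    using assms by (simp add: hyp_isometry_def)
  have "hyp_dist (the_inv_into hyp_plane f x) (the_inv_into hyp_plane f y) = hyp_dist x y"
    if "x \<in> hyp_plane" "y \<in> hyp_plane" for x y
  proof -
    have "the_inv_into hyp_plane f z \<in> hyp_plane" "f (the_inv_into hyp_plane f z) = z"
      if "z \<in> hyp_plane" for z
      using bij_betw_apply[OF bij_betw_the_inv_into[OF f] that] f_the_inv_into_f_bij_betw[OF f] that
      by auto
    then show ?thesis
      using that assms unfolding hyp_isometry_def by metis
  qed
  then show ?thesis
    using f bij_betw_the_inv_into by (auto simp: hyp_isometry_def)
qed

lemma hex_side_subset: "hex_side p s \<subseteq> hyp_plane"
  by (auto simp: hex_side_def hyp_segment_def)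

lemma equiv_label_isometric: "equiv (Collect right_hexagon) label_isometric"
proof (rule equivI)
  show "label_isometric \<subseteq> Collect right_hexagon \<times> Collect right_hexagon"
    by (auto simp: label_isometric_def)
  have "hyp_isometry id"
    by (simp add: hyp_isometry_def)
  then show "refl_on (Collect right_hexagon) label_isometric"
    by (force simp: refl_on_def label_isometric_def)
  show "sym label_isometric"
  proof (rule symI)
    fix p q assume "(p, q) \<in> label_isometric"
    then obtain f where f: "right_hexagon p" "right_hexagon q" "hyp_isometry f"
      "\<And>s. f ` hex_side p s = hex_side q s"
      by (auto simp: label_isometric_def)
    have "the_inv_into hyp_plane f ` hex_side q s = hex_side p s" for s
    proof -
      have "the_inv_into hyp_plane f ` f ` hex_side p s = hex_side p s"
        using f(3) hex_side_subset[of p s]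
        by (force simp: hyp_isometry_def bij_betw_def the_inv_into_f_f image_image subset_iff)
      then show ?thesis by (simp add: f)
    qed
    then show "(q, p) \<in> label_isometric"
      using f hyp_isometry_inverse[OF f(3)] by (auto simp: label_isometric_def)
  qed
  show "trans label_isometric"
  proof (rule transI)
    fix p q r assume "(p, q) \<in> label_isometric" "(q, r) \<in> label_isometric"
    then obtain f g where "right_hexagon p" "right_hexagon r" "hyp_isometry f" "hyp_isometry g"
      "\<And>s. f ` hex_side p s = hex_side q s" "\<And>s. g ` hex_side q s = hex_side r s"
      by (auto simp: label_isometric_def)
    then have "hyp_isometry (g \<circ> f)" "\<And>s. (g \<circ> f) ` hex_side p s = hex_side r s"
      by (auto simp only: hyp_isometry_compose image_comp[symmetric])
    then show "(p, r) \<in> label_isometric"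
      using \<open>right_hexagon p\<close> \<open>right_hexagon r\<close> unfolding label_isometric_def by blast
  qed
qed

definition len :: "(side \<Rightarrow> real ^ 3) \<Rightarrow> side \<Rightarrow> real" where
  "len p s = hyp_dist (p s) (p (next_side s))"

lemma sym_label_isometric: "sym label_isometric"
  using equiv_label_isometric by (rule equivE)

lemma len_le_if_label_isometric:
  assumes "(p, q) \<in> label_isometric"
  shows "len q s \<le> len p s"
proof -
  obtain f where f: "right_hexagon p" "right_hexagon q" "hyp_isometry f"
    "f ` hex_side p s = hex_side q s"
    using assms by (auto simp: label_isometric_def)
  have "q s \<in> hex_side q s" "q (next_side s) \<in> hex_side q s"
    using f(2) ends_in_hyp_segment by (auto simp: hex_side_def right_hexagon_def)
  then obtain z w where zw: "z \<in> hex_side p s" "w \<in> hex_side p s" "q s = f z" "q (next_side s) = f w"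
    using f(4) by (metis imageE)
  then have "len q s = hyp_dist z w"
    using f(3) hex_side_subset[of p s] by (auto simp: len_def hyp_isometry_def)
  also have "\<dots> \<le> len p s"
    unfolding len_def using zw(1,2) f(1) hyp_dist_le_ends_of_segment
    unfolding hex_side_def right_hexagon_def by blast
  finally show ?thesis .
qed

lemma side_length_class:
  assumes "right_hexagon p"
  shows "side_length (label_isometric `` {p}) s = len p s"
proof -
  have "len q s = len p s" if "(p, q) \<in> label_isometric" for q
    using len_le_if_label_isometric[OF that] that
      len_le_if_label_isometric[OF symD[OF sym_label_isometric that]]
    by (meson order_antisym)
  moreover have "(p, p) \<in> label_isometric"
    using equiv_class_self[OF equiv_label_isometric] assms by auto
  ultimately have "(\<lambda>p. hyp_dist (p s) (p (next_side s))) ` label_isometric `` {p} = {len p s}"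
    unfolding len_def by blast
  then show ?thesis
    by (simp add: side_length_def)
qed

section \<open>Side normals and the law of cosines\<close>

lemma next_prev [simp]: "next_side (prev_side s) = s" and prev_next [simp]: "prev_side (next_side s) = s"
  by (cases s; simp)+

lemma next_side_neq [simp]: "next_side s \<noteq> s" "s \<noteq> next_side s"
  "next_side (next_side s) \<noteq> s" "s \<noteq> next_side (next_side s)"
  "prev_side s \<noteq> s" "s \<noteq> prev_side s" "prev_side s \<noteq> next_side s" "next_side s \<noteq> prev_side s"
  by (cases s; simp)+

lemma right_angle_iff:
  assumes "x \<in> hyp_plane"
  shows "right_angle y x z \<longleftrightarrow> mink y z + mink x y * mink x z = 0"
  unfolding right_angle_def tangent_toward_def mink_linear hyp_planeD(1)[OF assms]
  by (simp add: mink_commute algebra_simps)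

text \<open>The unit normal at \<open>x\<close> to the line that meets the segment from \<open>z\<close> to \<open>x\<close> orthogonally
  at \<open>x\<close>, pointing away from \<open>z\<close>.\<close>

definition away_normal :: "real ^ 3 \<Rightarrow> real ^ 3 \<Rightarrow> real ^ 3" where
  "away_normal z x = (1 / sinh (hyp_dist z x)) *\<^sub>R (cosh (hyp_dist z x) *\<^sub>R x - z)"

lemma sinh_hyp_dist_pos:
  assumes "x \<in> hyp_plane" "y \<in> hyp_plane" "z \<in> hyp_plane" "det3 x y z \<noteq> 0"
  shows "sinh (hyp_dist x y) > 0" "sinh (hyp_dist y z) > 0" "sinh (hyp_dist x z) > 0"
proof -
  have "((mink x y)\<^sup>2 - 1) * ((mink y z)\<^sup>2 - 1) > 0"
    using hyp_gram[OF assms(1-3)] assms(4)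
    by (smt (verit) zero_less_power2 zero_le_power2)
  moreover have "((mink x z)\<^sup>2 - 1) * ((mink z y)\<^sup>2 - 1) > 0"
  proof -
    have "det3 x z y \<noteq> 0"
      using assms(4) by (simp add: det3_expand algebra_simps)
    then show ?thesis
      using hyp_gram[OF assms(1,3,2)] by (smt (verit) zero_less_power2 zero_le_power2)
  qed
  ultimately have ne: "mink x y \<noteq> -1" "mink y z \<noteq> -1" "mink x z \<noteq> -1"
    by auto
  have "sinh (hyp_dist u v) > 0" if "u \<in> hyp_plane" "v \<in> hyp_plane" "mink u v \<noteq> -1" for u v
  proof -
    have "hyp_dist u v \<noteq> 0"
      using cosh_hyp_dist(1)[OF that(1,2)] that(3) by auto
    then show ?thesis
      using cosh_hyp_dist(2)[OF that(1,2)] by simp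
  qed
  then show "sinh (hyp_dist x y) > 0" "sinh (hyp_dist y z) > 0" "sinh (hyp_dist x z) > 0"
    using ne assms by auto
qed

lemma mink_away_normal:
  assumes "x \<in> hyp_plane" "z \<in> hyp_plane" "sinh (hyp_dist z x) > 0"
  shows "mink (away_normal z x) (away_normal z x) = 1" "mink (away_normal z x) x = 0"
proof -
  note c = cosh_hyp_dist(1)[OF assms(2,1)]
  show "mink (away_normal z x) x = 0"
    by (simp add: away_normal_def mink_linear c hyp_planeD(1)[OF assms(1)])
  have "mink (cosh (hyp_dist z x) *\<^sub>R x - z) (cosh (hyp_dist z x) *\<^sub>R x - z) = (sinh (hyp_dist z x))\<^sup>2"
    unfolding sinh_square_eq
    by (simp add: mink_linear c hyp_planeD(1)[OF assms(1)] hyp_planeD(1)[OF assms(2)]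
        mink_commute[of x z] power2_eq_square)
  then show "mink (away_normal z x) (away_normal z x) = 1"
    using assms(3) by (simp add: away_normal_def mink_scale_left mink_scale_right power2_eq_square)
qed

lemma away_normal_orthogonal:
  assumes "x \<in> hyp_plane" "z \<in> hyp_plane" "right_angle z x y"
  shows "mink (away_normal z x) y = 0"
  using assms(3) unfolding right_angle_iff[OF assms(1)]
  by (simp add: away_normal_def mink_linear cosh_hyp_dist(1)[OF assms(2,1)] mink_commute[of x z])

text \<open>The line through \<open>x\<close> and \<open>y\<close> has only two unit normals. The normals constructed at \<open>x\<close> and at \<open>y\<close>
  agree, since \<open>z\<close> and \<open>w\<close> lie on the same side of the line.\<close>

lemma common_normal:
  assumes x: "x \<in> hyp_plane" and y: "y \<in> hyp_plane" and z: "z \<in> hyp_plane" and w: "w \<in> hyp_plane"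
    and zxy: "right_angle z x y" and xyw: "right_angle x y w"
    and side: "det3 x y z * det3 x y w > 0"
  shows "away_normal z x = away_normal w y"
proof -
  let ?u = "away_normal z x" and ?v = "away_normal w y"
  have nz: "det3 x y z \<noteq> 0" "det3 x y w \<noteq> 0"
    using side by auto
  have pos: "sinh (hyp_dist z x) > 0" "sinh (hyp_dist w y) > 0"
    using sinh_hyp_dist_pos[OF x y z nz(1)] sinh_hyp_dist_pos[OF x y w nz(2)]
    by (auto simp: hyp_dist_commute)
  have u: "mink ?u ?u = 1" "mink ?u x = 0" "mink ?u y = 0"
    using mink_away_normal[OF x z pos(1)] away_normal_orthogonal[OF x z zxy] by auto
  have "right_angle w y x"
    using xyw by (simp add: right_angle_def mink_commute)
  then have v: "mink ?v ?v = 1" "mink ?v y = 0" "mink ?v x = 0"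
    using mink_away_normal[OF y w pos(2)] away_normal_orthogonal[OF y w] by auto
  note uv = u v u(2,3)[unfolded mink_commute[of ?u]] v(2,3)[unfolded mink_commute[of ?v]]
    hyp_planeD(1)[OF x] hyp_planeD(1)[OF y]
  have sq: "(det3 x y ?u)\<^sup>2 = (mink x y)\<^sup>2 - 1" "(det3 x y ?v)\<^sup>2 = (mink x y)\<^sup>2 - 1"
    unfolding gram_det_square by (simp_all add: uv power2_eq_square)
  have prod: "det3 x y ?u * det3 x y ?v = ((mink x y)\<^sup>2 - 1) * mink ?u ?v"
    unfolding gram_det by (simp add: uv power2_eq_square mink_commute[of y x] algebra_simps)
  have du: "det3 x y ?u = - det3 x y z / sinh (hyp_dist z x)"
    "det3 x y ?v = - det3 x y w / sinh (hyp_dist w y)"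
    using pos by (simp_all add: away_normal_def det3_expand field_simps)
  have "det3 x y ?u * det3 x y ?v > 0"
    unfolding du using pos side by (simp add: zero_less_divide_iff)
  moreover have "det3 x y ?u = det3 x y ?v \<or> det3 x y ?u = - det3 x y ?v"
    using sq by (metis power2_eq_iff)
  ultimately have "det3 x y ?u = det3 x y ?v" "det3 x y ?u \<noteq> 0"
    by (auto simp: zero_less_mult_iff)
  then have "mink ?u ?v = 1"
    using prod sq by (auto simp: power2_eq_square)
  then have "mink (?u - ?v) (?u - ?v) = 0" "mink (?u - ?v) x = 0"
    using uv by (auto simp: mink_linear mink_commute[of ?v ?u])
  then show ?thesis
    using orthogonal_null_vector[OF _ _ x] by force
qed

text \<open>It points out of the hexagon, because the preceding corner lies on the inner side.\<close>

definition side_normal :: "(side \<Rightarrow> real ^ 3) \<Rightarrow> side \<Rightarrow> real ^ 3" where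
  "side_normal p s = away_normal (p (prev_side s)) (p s)"

lemma right_hexagonD:
  assumes "right_hexagon p"
  shows "p s \<in> hyp_plane" "right_angle (p (prev_side s)) (p s) (p (next_side s))"
    "r \<noteq> s \<Longrightarrow> r \<noteq> next_side s \<Longrightarrow> t \<noteq> s \<Longrightarrow> t \<noteq> next_side s \<Longrightarrow>
      det3 (p s) (p (next_side s)) (p r) * det3 (p s) (p (next_side s)) (p t) > 0"
proof -
  show "p s \<in> hyp_plane" "right_angle (p (prev_side s)) (p s) (p (next_side s))"
    using assms by (auto simp: right_hexagon_def)
  assume "r \<noteq> s" "r \<noteq> next_side s" "t \<noteq> s" "t \<noteq> next_side s"
  moreover have "strictly_same_side (p s) (p (next_side s)) (p ` (- {s, next_side s}))"
    using assms unfolding right_hexagon_def by blast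
  ultimately show "det3 (p s) (p (next_side s)) (p r) * det3 (p s) (p (next_side s)) (p t) > 0"
    unfolding strictly_same_side_def det3_def by (auto simp: zero_less_mult_iff)
qed

lemma right_hexagon_len:
  assumes "right_hexagon p"
  shows "sinh (len p s) > 0" "len p s > 0"
    "mink (p s) (p (next_side s)) = - cosh (len p s)"
    "mink (p (next_side s)) (p s) = - cosh (len p s)"
proof -
  note p = right_hexagonD[OF assms]
  have "det3 (p s) (p (next_side s)) (p (prev_side s)) \<noteq> 0"
    using p(3)[of "prev_side s" s "prev_side s"] by auto
  then show "sinh (len p s) > 0"
    unfolding len_def using sinh_hyp_dist_pos p(1) by blast
  then show "len p s > 0"
    by simp
  show "mink (p s) (p (next_side s)) = - cosh (len p s)"
    by (simp add: len_def cosh_hyp_dist p(1))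
  then show "mink (p (next_side s)) (p s) = - cosh (len p s)"
    by (simp add: mink_commute)
qed

lemma side_normal_start:
  "side_normal p (next_side s) =
     (1 / sinh (len p s)) *\<^sub>R (cosh (len p s) *\<^sub>R p (next_side s) - p s)"
  by (simp add: side_normal_def away_normal_def len_def)

text \<open>The normal of a side can be read off at its other end as well; so each side \<open>s\<close> links the
  normals of the two sides adjacent to it.\<close>

lemma side_normal_end:
  assumes "right_hexagon p"
  shows "side_normal p (prev_side s) =
     (1 / sinh (len p s)) *\<^sub>R (cosh (len p s) *\<^sub>R p s - p (next_side s))"
proof -
  note p = right_hexagonD[OF assms]
  have "side_normal p (prev_side s) = away_normal (p (next_side s)) (p s)"
    unfolding side_normal_def
  proof (rule common_normal)
    show "right_angle (p (prev_side (prev_side s))) (p (prev_side s)) (p s)"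
      using p(2)[of "prev_side s"] by simp
    show "0 < det3 (p (prev_side s)) (p s) (p (prev_side (prev_side s))) *
        det3 (p (prev_side s)) (p s) (p (next_side s))"
      using p(3)[of "prev_side (prev_side s)" "prev_side s" "next_side s"]
      by (cases s) auto
  qed (use p in auto)
  then show ?thesis
    by (simp add: away_normal_def len_def hyp_dist_commute)
qed

lemma mink_side_normal:
  assumes "right_hexagon p"
  shows "mink (side_normal p s) (side_normal p s) = 1"
    "mink (side_normal p (prev_side s)) (side_normal p (next_side s)) = - cosh (len p s)"
    "mink (side_normal p (next_side s)) (side_normal p (prev_side s)) = - cosh (len p s)"
proof -
  note p = right_hexagonD[OF assms] and l = right_hexagon_len[OF assms]
  show "mink (side_normal p s) (side_normal p s) = 1"
    unfolding side_normal_def using mink_away_normal[of "p s" "p (prev_side s)"] p(1)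
      l(1)[of "prev_side s"] by (simp add: len_def)
  have "mink (cosh (len p s) *\<^sub>R p s - p (next_side s))
      (cosh (len p s) *\<^sub>R p (next_side s) - p s) = - cosh (len p s) * (sinh (len p s))\<^sup>2"
    unfolding sinh_square_eq
    by (simp add: mink_linear l(3,4) hyp_planeD(1)[OF p(1)] power2_eq_square algebra_simps)
  then show "mink (side_normal p (prev_side s)) (side_normal p (next_side s)) = - cosh (len p s)"
    using l(1)[of s]
    by (simp add: side_normal_end[OF assms] side_normal_start mink_scale_left mink_scale_right
        power2_eq_square)
  then show "mink (side_normal p (next_side s)) (side_normal p (prev_side s)) = - cosh (len p s)"
    by (simp add: mink_commute)
qed

text \<open>Two lines with outward unit normals \<open>u\<close>, \<open>v\<close> and \<open>mink u v = - cosh l\<close> are at distance \<open>l\<close>,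
  and this is the foot on the line of \<open>v\<close> of their common perpendicular.\<close>

definition foot :: "real \<Rightarrow> real ^ 3 \<Rightarrow> real ^ 3 \<Rightarrow> real ^ 3" where
  "foot l u v = (1 / sinh l) *\<^sub>R (u + cosh l *\<^sub>R v)"

lemma corner_eq_foot:
  assumes "right_hexagon p"
  shows "p s = foot (len p s) (side_normal p (next_side s)) (side_normal p (prev_side s))"
    "p (next_side s) = foot (len p s) (side_normal p (prev_side s)) (side_normal p (next_side s))"
proof -
  have *: "x = (1 / S) *\<^sub>R ((1 / S) *\<^sub>R (C *\<^sub>R y - x) + C *\<^sub>R (1 / S) *\<^sub>R (C *\<^sub>R x - y))"
    if "S > 0" "C\<^sup>2 = S\<^sup>2 + 1" for S C :: real and x y :: "real ^ 3"
  proof -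
    have "(1 / S) *\<^sub>R ((1 / S) *\<^sub>R (C *\<^sub>R y - x) + C *\<^sub>R (1 / S) *\<^sub>R (C *\<^sub>R x - y))
       = ((C\<^sup>2 - 1) / S\<^sup>2) *\<^sub>R x"
      by (simp add: vec_eq_iff power2_eq_square field_simps flip: add_divide_distrib)
    then show ?thesis
      using that by simp
  qed
  show "p s = foot (len p s) (side_normal p (next_side s)) (side_normal p (prev_side s))"
    "p (next_side s) = foot (len p s) (side_normal p (prev_side s)) (side_normal p (next_side s))"
    unfolding foot_def side_normal_start side_normal_end[OF assms]
    by (rule *; use right_hexagon_len(1)[OF assms, of s] cosh_square_eq[of "len p s"] in simp)+
qed

text \<open>The ends of the side \<open>next_side s\<close> are combinations of the normals of this side and of the two
  sides at distance two, whose products are the negated \<open>cosh\<close> of the three lengths on the right.\<close>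

theorem hexagon_cosine_law:
  assumes "right_hexagon p"
  shows "cosh (len p (next_side s)) =
    (cosh (len p (prev_side (prev_side s))) + cosh (len p s) * cosh (len p (next_side (next_side s))))
      / (sinh (len p s) * sinh (len p (next_side (next_side s))))"
proof -
  note l = right_hexagon_len[OF assms]
  define u where "u = side_normal p (prev_side s)"
  define v where "v = side_normal p (next_side s)"
  define w where "w = side_normal p (next_side (next_side (next_side s)))"
  have g: "mink v v = 1" "mink u v = - cosh (len p s)"
    "mink v w = - cosh (len p (next_side (next_side s)))"
    "mink u w = - cosh (len p (prev_side (prev_side s)))"
  proof -
    have "prev_side (prev_side s) = next_side (next_side (next_side (next_side s)))"
      by (cases s) auto
    then show "mink u w = - cosh (len p (prev_side (prev_side s)))"
      using mink_side_normal(3)[OF assms, of "prev_side (prev_side s)"]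
      by (metis next_prev prev_next u_def w_def)
  qed (use mink_side_normal(1,2)[OF assms] mink_side_normal(2)[OF assms, of "next_side (next_side s)"]
      in \<open>auto simp: u_def v_def w_def\<close>)
  have "mink (p (next_side s)) (p (next_side (next_side s)))
     = mink (foot (len p s) u v) (foot (len p (next_side (next_side s))) w v)"
    using corner_eq_foot(2)[OF assms, of s] corner_eq_foot(1)[OF assms, of "next_side (next_side s)"]
    by (simp add: u_def v_def w_def)
  then show ?thesis
    using l(1)[of s] l(1)[of "next_side (next_side s)"]
    by (simp add: foot_def mink_linear g l(3) field_simps)
qed

section \<open>Uniqueness of the hexagon with three given lengths\<close>

lemma det3_lincomb:
  "det3 (a1 *\<^sub>R u + b1 *\<^sub>R v + c1 *\<^sub>R w) (a2 *\<^sub>R u + b2 *\<^sub>R v + c2 *\<^sub>R w)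
      (a3 *\<^sub>R u + b3 *\<^sub>R v + c3 *\<^sub>R w)
    = (a1 * (b2 * c3 - c2 * b3) - b1 * (a2 * c3 - c2 * a3) + c1 * (a2 * b3 - b2 * a3)) * det3 u v w"
proof -
  have "(vector [a1 *\<^sub>R u + b1 *\<^sub>R v + c1 *\<^sub>R w, a2 *\<^sub>R u + b2 *\<^sub>R v + c2 *\<^sub>R w,
      a3 *\<^sub>R u + b3 *\<^sub>R v + c3 *\<^sub>R w] :: real ^ 3 ^ 3)
    = (vector [vector [a1, b1, c1], vector [a2, b2, c2], vector [a3, b3, c3]] :: real ^ 3 ^ 3) ** vector [u, v, w]"
    by (simp add: vec_eq_iff forall_3 matrix_matrix_mult_def sum_3)
  moreover have "det (vector [vector [a1, b1, c1], vector [a2, b2, c2], vector [a3, b3, c3]] :: real ^ 3 ^ 3)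
    = a1 * (b2 * c3 - c2 * b3) - b1 * (a2 * c3 - c2 * a3) + c1 * (a2 * b3 - b2 * a3)"
    by (simp add: det_3 algebra_simps)
  ultimately show ?thesis
    unfolding det3_def by (simp add: det_mul)
qed

lemma cramer:
  assumes "det3 u v w \<noteq> 0"
  shows "x = (det3 x v w / det3 u v w) *\<^sub>R u + (det3 u x w / det3 u v w) *\<^sub>R v
    + (det3 u v x / det3 u v w) *\<^sub>R w"
proof -
  have "det3 u v w *\<^sub>R x = det3 x v w *\<^sub>R u + det3 u x w *\<^sub>R v + det3 u v x *\<^sub>R w"
    by (simp add: vec_eq_iff forall_3 det3_expand algebra_simps)
  then have "(1 / det3 u v w) *\<^sub>R (det3 u v w *\<^sub>R x)
      = (1 / det3 u v w) *\<^sub>R (det3 x v w *\<^sub>R u + det3 u x w *\<^sub>R v + det3 u v x *\<^sub>R w)"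
    by (rule arg_cong)
  then show ?thesis
    using assms by (simp add: scaleR_add_right)
qed

text \<open>Coordinates with respect to a basis, so that two bases with the same Gram matrix are
  related by a Lorentz transformation.\<close>

lemma lorentz_map_between_bases:
  assumes d: "det3 u v w \<noteq> 0"
    and gram: "mink u u = mink u' u'" "mink v v = mink v' v'" "mink w w = mink w' w'"
      "mink u v = mink u' v'" "mink u w = mink u' w'" "mink v w = mink v' w'"
  obtains f where "\<And>a b c. f (a *\<^sub>R u + b *\<^sub>R v + c *\<^sub>R w) = a *\<^sub>R u' + b *\<^sub>R v' + c *\<^sub>R w'"
    "\<And>x y. mink (f x) (f y) = mink x y" "bij f"
proof -
  have "(det3 u' v' w')\<^sup>2 = (det3 u v w)\<^sup>2"
    unfolding gram_det_square gram ..
  then have d': "det3 u' v' w' \<noteq> 0"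
    using d by auto
  define crd where "crd u v w x = (det3 x v w / det3 u v w, det3 u x w / det3 u v w, det3 u v x / det3 u v w)"
    for u v w x
  define cmb where "cmb u v w t = fst t *\<^sub>R u + fst (snd t) *\<^sub>R v + snd (snd t) *\<^sub>R w"
    for u v w :: "real ^ 3" and t :: "real \<times> real \<times> real"
  have cc: "cmb u v w (crd u v w x) = x" if "det3 u v w \<noteq> 0" for u v w x
    using cramer[OF that] by (simp add: cmb_def crd_def)
  have cc': "crd u v w (cmb u v w t) = t" if "det3 u v w \<noteq> 0" for u v w t
  proof -
    obtain a b c where t: "t = (a, b, c)" by (cases t)
    have "det3 (a *\<^sub>R u + b *\<^sub>R v + c *\<^sub>R w) v w = a * det3 u v w"
      "det3 u (a *\<^sub>R u + b *\<^sub>R v + c *\<^sub>R w) w = b * det3 u v w"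
      "det3 u v (a *\<^sub>R u + b *\<^sub>R v + c *\<^sub>R w) = c * det3 u v w"
      using det3_lincomb[of a u b v c w 0 1 0 0 0 1] det3_lincomb[of 1 u 0 v 0 w a b c 0 0 1]
        det3_lincomb[of 1 u 0 v 0 w 0 1 0 a b c] by simp_all
    then show ?thesis
      using that by (simp add: crd_def cmb_def t)
  qed
  define f where "f x = cmb u' v' w' (crd u v w x)" for x
  have 1: "f (a *\<^sub>R u + b *\<^sub>R v + c *\<^sub>R w) = a *\<^sub>R u' + b *\<^sub>R v' + c *\<^sub>R w'" for a b c
    using cc'[OF d, of "(a, b, c)"] by (simp add: f_def cmb_def)
  have 2: "mink (f x) (f y) = mink x y" for x y
  proof -
    have "mink (cmb u' v' w' s) (cmb u' v' w' t) = mink (cmb u v w s) (cmb u v w t)" for s t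
      unfolding cmb_def mink_linear mink_commute[of v u] mink_commute[of w u] mink_commute[of w v]
        mink_commute[of v' u'] mink_commute[of w' u'] mink_commute[of w' v'] gram ..
    then show ?thesis
      by (simp add: f_def cc[OF d])
  qed
  have 3: "bij f"
    by (rule o_bij[where g = "\<lambda>x. cmb u v w (crd u' v' w' x)"])
      (auto simp: f_def cc[OF d] cc[OF d'] cc'[OF d] cc'[OF d'] o_def)
  show thesis
    using that 1 2 3 by blast
qed

text \<open>A Lorentz map permutes the two sheets of the hyperboloid, so one point decides.\<close>

lemma hyp_isometry_if_preserves_mink:
  assumes "bij f" and m: "\<And>x y. mink (f x) (f y) = mink x y"
    and "q \<in> hyp_plane" "f q \<in> hyp_plane"
  shows "hyp_isometry f"
proof -
  have "f x \<in> hyp_plane \<longleftrightarrow> x \<in> hyp_plane" for x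
  proof
    assume "x \<in> hyp_plane"
    then show "f x \<in> hyp_plane"
      using in_hyp_plane_if[of "f x" "f q"] mink_hyp_plane_le[of x q] assms
      by (auto simp: m hyp_planeD)
  next
    assume "f x \<in> hyp_plane"
    then show "x \<in> hyp_plane"
      using in_hyp_plane_if[of x q] mink_hyp_plane_le[of "f x" "f q"] hyp_planeD(1)[of "f x"] assms
      by (auto simp: m)
  qed
  then have "f ` hyp_plane = hyp_plane"
    using bij_is_surj[OF \<open>bij f\<close>] by (auto simp: image_iff surj_def) metis
  then have "bij_betw f hyp_plane hyp_plane"
    using inj_on_subset[OF bij_is_inj[OF \<open>bij f\<close>]] by (simp add: bij_betw_def)
  then show ?thesis
    by (simp add: hyp_isometry_def hyp_dist_def m)
qed

lemma hyp_isometry_image_segment: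
  assumes "hyp_isometry f" "x \<in> hyp_plane" "y \<in> hyp_plane"
  shows "f ` hyp_segment x y = hyp_segment (f x) (f y)"
proof
  show "f ` hyp_segment x y \<subseteq> hyp_segment (f x) (f y)"
    using assms by (auto simp: hyp_segment_def hyp_isometry_def bij_betw_apply)
  show "hyp_segment (f x) (f y) \<subseteq> f ` hyp_segment x y"
  proof
    fix w assume w: "w \<in> hyp_segment (f x) (f y)"
    then have "w \<in> f ` hyp_plane"
      using assms(1) by (auto simp: hyp_segment_def hyp_isometry_def bij_betw_def)
    then obtain z where "z \<in> hyp_plane" "w = f z" by auto
    then show "w \<in> f ` hyp_segment x y"
      using w assms by (auto simp: hyp_segment_def hyp_isometry_def)
  qed
qed

text \<open>The three lengths fix the Gram matrix of the normals of \<open>A\<close>, \<open>B\<close>, \<open>C\<close>, and the corners are fixed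
  combinations of these normals.\<close>

theorem right_hexagon_unique:
  assumes p: "right_hexagon p" and q: "right_hexagon q"
    and eq: "len p Side_a = len q Side_a" "len p Side_b = len q Side_b" "len p Side_c = len q Side_c"
  shows "(p, q) \<in> label_isometric"
proof -
  let ?n = "side_normal"
  have gram: "mink (?n r Side_A) (?n r Side_B) = - cosh (len r Side_c)"
    "mink (?n r Side_A) (?n r Side_C) = - cosh (len r Side_b)"
    "mink (?n r Side_B) (?n r Side_C) = - cosh (len r Side_a)"
    if "right_hexagon r" for r
    using mink_side_normal(2,3)[OF that, of Side_a] mink_side_normal(2,3)[OF that, of Side_b]
      mink_side_normal(2,3)[OF that, of Side_c] by auto
  \<comment> \<open>All entries of the Gram matrix off the diagonal are at most \<open>-1\<close>, so its determinant is negative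
    and the normals form a basis.\<close>
  note gp = gram[OF p] and gq = gram[OF q] and n1 = mink_side_normal(1)[OF p] mink_side_normal(1)[OF q]
  have "(det3 (?n p Side_A) (?n p Side_B) (?n p Side_C))\<^sup>2
     = (cosh (len p Side_a))\<^sup>2 + (cosh (len p Side_b))\<^sup>2 + (cosh (len p Side_c))\<^sup>2 - 1
       + 2 * (cosh (len p Side_a) * cosh (len p Side_b) * cosh (len p Side_c))"
    unfolding gram_det_square gp n1 by (simp add: power2_eq_square algebra_simps)
  moreover have "cosh (len p Side_a) \<ge> 1" "cosh (len p Side_b) \<ge> 1" "cosh (len p Side_c) \<ge> 1"
    by (rule cosh_real_ge_1)+
  moreover from this have "(cosh (len p Side_a))\<^sup>2 \<ge> 1" "(cosh (len p Side_b))\<^sup>2 \<ge> 1"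
    "cosh (len p Side_a) * cosh (len p Side_b) * cosh (len p Side_c) \<ge> 0"
    by (auto simp: one_le_power)
  ultimately have "(det3 (?n p Side_A) (?n p Side_B) (?n p Side_C))\<^sup>2 > 0"
    by (smt (verit) zero_le_power2)
  then have d: "det3 (?n p Side_A) (?n p Side_B) (?n p Side_C) \<noteq> 0"
    by auto
  obtain f where f: "\<And>a b c. f (a *\<^sub>R ?n p Side_A + b *\<^sub>R ?n p Side_B + c *\<^sub>R ?n p Side_C)
      = a *\<^sub>R ?n q Side_A + b *\<^sub>R ?n q Side_B + c *\<^sub>R ?n q Side_C"
    "\<And>x y. mink (f x) (f y) = mink x y" "bij f"
    by (rule lorentz_map_between_bases[OF d, of "?n q Side_A" "?n q Side_B" "?n q Side_C"])
      ((simp add: gp gq n1 eq; fail) | blast intro: that)+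
  have foot: "f (foot l (?n p S) (?n p T)) = foot l (?n q S) (?n q T)"
    if "S \<in> {Side_A, Side_B, Side_C}" "T \<in> {Side_A, Side_B, Side_C}" "S \<noteq> T" for l S T
  proof -
    let ?k = "\<lambda>R. if R = S then 1 / sinh l else if R = T then cosh l / sinh l else 0"
    have "foot l (?n r S) (?n r T) = ?k Side_A *\<^sub>R ?n r Side_A + ?k Side_B *\<^sub>R ?n r Side_B
        + ?k Side_C *\<^sub>R ?n r Side_C" for r
      using that by (auto simp: foot_def scaleR_add_right)
    then show ?thesis
      using f(1) by presburger
  qed
  have fp: "f (p s) = q s" for s
  proof -
    have feet: "r Side_a = foot (len r Side_a) (?n r Side_C) (?n r Side_B)"
      "r Side_C = foot (len r Side_a) (?n r Side_B) (?n r Side_C)"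
      "r Side_b = foot (len r Side_b) (?n r Side_A) (?n r Side_C)"
      "r Side_A = foot (len r Side_b) (?n r Side_C) (?n r Side_A)"
      "r Side_c = foot (len r Side_c) (?n r Side_B) (?n r Side_A)"
      "r Side_B = foot (len r Side_c) (?n r Side_A) (?n r Side_B)"
      if "right_hexagon r" for r
      using corner_eq_foot[OF that, of Side_a] corner_eq_foot[OF that, of Side_b]
        corner_eq_foot[OF that, of Side_c] by auto
    show ?thesis
      by (cases s; simp only: feet[OF p] feet[OF q] eq foot insert_iff side.distinct simp_thms)
  qed
  have hp: "p s \<in> hyp_plane" "q s \<in> hyp_plane" for s
    using p q right_hexagonD(1) by auto
  have iso: "hyp_isometry f"
    using hyp_isometry_if_preserves_mink[OF f(3,2), of "p Side_a"] hp by (simp add: fp)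
  then have "f ` hex_side p s = hex_side q s" for s
    unfolding hex_side_def using hyp_isometry_image_segment[OF iso] hp by (simp add: fp)
  then show ?thesis
    using p q iso by (auto simp: label_isometric_def)
qed

section \<open>Existence of hexagons\<close>

lemma foot_props:
  assumes "l > 0" "mink u u = 1" "mink v v = 1" "mink u v = - cosh l"
  shows "mink (foot l u v) (foot l u v) = -1" "mink (foot l u v) (foot l v u) = - cosh l"
    "mink (foot l u v) v = 0" "foot l v u = cosh l *\<^sub>R foot l u v - sinh l *\<^sub>R v"
proof -
  have s: "sinh l \<noteq> 0" and vu: "mink v u = - cosh l"
    using assms by (auto simp: mink_commute)
  have "mink (u + cosh l *\<^sub>R v) (u + cosh l *\<^sub>R v) = - (sinh l)\<^sup>2"
    "mink (u + cosh l *\<^sub>R v) (v + cosh l *\<^sub>R u) = - cosh l * (sinh l)\<^sup>2"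
    unfolding sinh_square_eq by (simp_all add: mink_linear assms vu power2_eq_square algebra_simps)
  then show "mink (foot l u v) (foot l u v) = -1" "mink (foot l u v) (foot l v u) = - cosh l"
    using s by (simp_all add: foot_def mink_scale_left mink_scale_right power2_eq_square)
  show "mink (foot l u v) v = 0"
    by (simp add: foot_def mink_linear assms)
  have "(cosh l * cosh l) = sinh l * sinh l + 1"
    using cosh_square_eq[of l] by (simp add: power2_eq_square)
  then have cc: "cosh l * (cosh l * x) = sinh l * (sinh l * x) + x" for x
    by (metis distrib_right mult.assoc mult_1)
  show "foot l v u = cosh l *\<^sub>R foot l u v - sinh l *\<^sub>R v"
    using s by (simp add: foot_def vec_eq_iff field_simps) (simp add: cc)
qed

lemma right_angle_foot:
  assumes "l > 0" "mink u u = 1" "mink v v = 1" "mink u v = - cosh l" "foot l u v \<in> hyp_plane"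
    and "mink v z = 0"
  shows "right_angle (foot l v u) (foot l u v) z" "right_angle z (foot l u v) (foot l v u)"
proof -
  note f = foot_props[OF assms(1-4)]
  show "right_angle (foot l v u) (foot l u v) z"
    unfolding right_angle_iff[OF assms(5)] f(2) by (simp add: f(4) mink_linear assms(6))
  then show "right_angle z (foot l u v) (foot l v u)"
    by (simp add: right_angle_def mink_commute)
qed

lemma strictly_same_sideI:
  assumes "\<And>z. z \<in> Z \<Longrightarrow> det3 x y z * k > 0"
  shows "strictly_same_side x y Z"
proof (cases "k > 0")
  case True
  then show ?thesis
    using assms unfolding strictly_same_side_def det3_def[symmetric]
    by (metis zero_less_mult_pos2)
next
  case False
  then show ?thesis
    using assms unfolding strictly_same_side_def det3_def[symmetric]
    by (metis linorder_not_less mult_nonneg_nonpos not_less_iff_gr_or_eq)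
qed

lemma mult_pos_of_multiple:
  fixes d :: real
  assumes "d = c * e" "c < 0" "e * k < 0"
  shows "d * k > 0"
  using assms by (metis mult.assoc mult_neg_neg)

text \<open>The shapes in which a foot enters the formula for the determinant of three combinations.\<close>

lemma foot_lincomb:
  "foot l u v = (1 / sinh l) *\<^sub>R u + (cosh l / sinh l) *\<^sub>R v + 0 *\<^sub>R w"
  "foot l u v = (1 / sinh l) *\<^sub>R u + 0 *\<^sub>R w + (cosh l / sinh l) *\<^sub>R v"
  "foot l u v = 0 *\<^sub>R w + (1 / sinh l) *\<^sub>R u + (cosh l / sinh l) *\<^sub>R v"
  "foot l u v = (cosh l / sinh l) *\<^sub>R v + (1 / sinh l) *\<^sub>R u + 0 *\<^sub>R w"
  "foot l u v = (cosh l / sinh l) *\<^sub>R v + 0 *\<^sub>R w + (1 / sinh l) *\<^sub>R u"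
  "foot l u v = 0 *\<^sub>R w + (cosh l / sinh l) *\<^sub>R v + (1 / sinh l) *\<^sub>R u"
  by (simp_all add: foot_def scaleR_add_right)

text \<open>Convexity at the side that joins the lines with normals \<open>u\<close> and \<open>v\<close>: the other corners have a
  positive \<open>w\<close>-coordinate with respect to \<open>u\<close>, \<open>v\<close>, \<open>w\<close>.\<close>

lemma det3_perpendicular:
  assumes l: "l > 0" "m > 0" and k: "det3 u v w * k < 0"
    and z: "z \<in> {foot m u w, foot m w u, foot m v w, foot m w v}"
  shows "det3 (foot l u v) (foot l v u) z * k > 0"
proof -
  have s: "sinh l > 0" "sinh m > 0" using l by auto
  have "det3 (foot l u v) (foot l v u) (a *\<^sub>R u + b *\<^sub>R v + c *\<^sub>R w) = - c * det3 u v w" for a b c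
    unfolding foot_lincomb(1)[of l u v w] foot_lincomb(4)[of l v u w] det3_lincomb
    using s cosh_square_eq[of l] by (simp add: power2_eq_square field_simps)
  note this[of "1 / sinh m" 0 "cosh m / sinh m"] this[of "cosh m / sinh m" 0 "1 / sinh m"]
    this[of 0 "1 / sinh m" "cosh m / sinh m"] this[of 0 "cosh m / sinh m" "1 / sinh m"]
  note d = this[folded foot_lincomb(2)[of m u w v] foot_lincomb(5)[of m w u v]
      foot_lincomb(3)[of m v w u] foot_lincomb(6)[of m w v u]]
  have neg: "- (cosh m / sinh m) < 0" "- (1 / sinh m) < 0"
    using s by auto
  show ?thesis
    using z mult_pos_of_multiple[OF _ neg(1) k] mult_pos_of_multiple[OF _ neg(2) k] d by blast
qed

text \<open>Convexity at the side that lies on the line with normal \<open>w\<close>.\<close>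

lemma det3_line:
  assumes l: "l > 0" "m > 0" "n > 0" and k: "det3 u v w * k < 0"
    and z: "z \<in> {foot l w u, foot m w v, foot n u v, foot n v u}"
  shows "det3 (foot l u w) (foot m v w) z * k > 0"
proof -
  have s: "sinh l > 0" "sinh m > 0" "sinh n > 0" "cosh l > 1" "cosh m > 1" "cosh n > 0"
    using l cosh_real_nonneg_less_iff[of 0 l] cosh_real_nonneg_less_iff[of 0 m] by auto
  let ?q = "\<lambda>a b c. (c - cosh m * b - cosh l * a) / (sinh l * sinh m)"
  have "det3 (foot l u w) (foot m v w) (a *\<^sub>R u + b *\<^sub>R v + c *\<^sub>R w) = ?q a b c * det3 u v w" for a b c
    unfolding foot_lincomb(2)[of l u w v] foot_lincomb(3)[of m v w u] det3_lincomb
    using s by (simp add: field_simps)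
  note this[of "cosh l / sinh l" 0 "1 / sinh l"] this[of 0 "cosh m / sinh m" "1 / sinh m"]
    this[of "1 / sinh n" "cosh n / sinh n" 0] this[of "cosh n / sinh n" "1 / sinh n" 0]
  note d = this[folded foot_lincomb(5)[of l w u v] foot_lincomb(6)[of m w v u]
      foot_lincomb(1)[of n u v w] foot_lincomb(4)[of n v u w]]
  have neg: "?q (cosh l / sinh l) 0 (1 / sinh l) < 0" "?q 0 (cosh m / sinh m) (1 / sinh m) < 0"
    "?q (1 / sinh n) (cosh n / sinh n) 0 < 0" "?q (cosh n / sinh n) (1 / sinh n) 0 < 0"
  proof -
    have "1 < cosh l * cosh l" "1 < cosh m * cosh m"
      using s by (auto intro: less_1_mult)
    then have "1 / sinh l - cosh l * (cosh l / sinh l) < 0" "1 / sinh m - cosh m * (cosh m / sinh m) < 0"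
      using s by (simp_all add: divide_strict_right_mono)
    then show "?q (cosh l / sinh l) 0 (1 / sinh l) < 0" "?q 0 (cosh m / sinh m) (1 / sinh m) < 0"
      using s by (simp_all add: divide_neg_pos)
    have "- (cosh m * (cosh n / sinh n)) - cosh l * (1 / sinh n) < 0"
      "- (cosh m * (1 / sinh n)) - cosh l * (cosh n / sinh n) < 0"
      using s by (smt (verit) divide_pos_pos mult_pos_pos)+
    then show "?q (1 / sinh n) (cosh n / sinh n) 0 < 0" "?q (cosh n / sinh n) (1 / sinh n) 0 < 0"
      using s by (simp_all add: divide_neg_pos)
  qed
  show ?thesis
    using z d neg[THEN mult_pos_of_multiple[OF _ _ k, rotated]] by blast
qed

text \<open>Three unit vectors with this Gram matrix are the outward normals of three lines at mutual
  distances \<open>a\<close>, \<open>b\<close>, \<open>c\<close>; the feet of their common perpendiculars are the corners.\<close>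

lemma right_hexagon_from_normals:
  assumes pos: "a > 0" "b > 0" "c > 0"
    and g: "mink A A = 1" "mink B B = 1" "mink C C = 1"
      "mink A B = - cosh c" "mink A C = - cosh b" "mink B C = - cosh a"
    and third: "A $ 3 \<ge> 0" "B $ 3 > 0" "C $ 3 > 0" and d: "det3 A B C \<noteq> 0"
  shows "\<exists>p. right_hexagon p \<and> len p Side_a = a \<and> len p Side_b = b \<and> len p Side_c = c"
proof -
  define p where "p = rec_side (foot a C B) (foot a B C) (foot b A C) (foot b C A) (foot c B A) (foot c A B)"
  have p [simp]: "p Side_a = foot a C B" "p Side_C = foot a B C" "p Side_b = foot b A C"
    "p Side_A = foot b C A" "p Side_c = foot c B A" "p Side_B = foot c A B"
    by (simp_all add: p_def)
  have g': "mink B A = - cosh c" "mink C A = - cosh b" "mink C B = - cosh a"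
    using g by (metis mink_commute)+
  note fa = foot_props[OF pos(1) g(2,3,6)] foot_props[OF pos(1) g(3,2) g'(3)]
  note fb = foot_props[OF pos(2) g(1,3,5)] foot_props[OF pos(2) g(3,1) g'(2)]
  note fc = foot_props[OF pos(3) g(1,2,4)] foot_props[OF pos(3) g(2,1) g'(1)]
  have third': "foot l u v \<in> hyp_plane"
    if "l > 0" "u $ 3 \<ge> 0" "v $ 3 \<ge> 0" "u $ 3 > 0 \<or> v $ 3 > 0"
      "mink (foot l u v) (foot l u v) = -1" for l u v
  proof -
    have "0 < u $ 3 + cosh l * v $ 3"
      using that(4)
    proof
      assume "u $ 3 > 0"
      then show ?thesis
        using that(3) by (intro add_pos_nonneg mult_nonneg_nonneg) auto
    next
      assume "v $ 3 > 0"
      then show ?thesis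
        using that(2) by (intro add_nonneg_pos mult_pos_pos) auto
    qed
    then show ?thesis
      using that(1,5) by (simp add: foot_def hyp_plane_def)
  qed
  have BC: "B $ 3 \<ge> 0" "C $ 3 \<ge> 0"
    using third by simp_all
  have hp: "foot a C B \<in> hyp_plane" "foot a B C \<in> hyp_plane" "foot b A C \<in> hyp_plane"
    "foot b C A \<in> hyp_plane" "foot c B A \<in> hyp_plane" "foot c A B \<in> hyp_plane"
    by (rule third'; use pos third BC fa(1,5) fb(1,5) fc(1,5) in blast)+
  have orth: "mink C (foot a B C) = 0" "mink C (foot b A C) = 0" "mink A (foot b C A) = 0"
    "mink A (foot c B A) = 0" "mink B (foot a C B) = 0" "mink B (foot c A B) = 0"
    using fa(3,7) fb(3,7) fc(3,7) by (metis mink_commute)+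
  have ang: "right_angle (p (prev_side s)) (p s) (p (next_side s))" for s
  proof (cases s)
    case Side_a
    then show ?thesis
      using right_angle_foot(2)[OF pos(1) g(3,2) g'(3) hp(1) orth(6)] by simp
  next
    case Side_C
    then show ?thesis
      using right_angle_foot(1)[OF pos(1) g(2,3,6) hp(2) orth(2)] by simp
  next
    case Side_b
    then show ?thesis
      using right_angle_foot(2)[OF pos(2) g(1,3,5) hp(3) orth(1)] by simp
  next
    case Side_A
    then show ?thesis
      using right_angle_foot(1)[OF pos(2) g(3,1) g'(2) hp(4) orth(4)] by simp
  next
    case Side_c
    then show ?thesis
      using right_angle_foot(2)[OF pos(3) g(2,1) g'(1) hp(5) orth(3)] by simp
  next
    case Side_B
    then show ?thesis
      using right_angle_foot(1)[OF pos(3) g(1,2,4) hp(6) orth(5)] by simp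
  qed
  have perm: "det3 u v w * det3 A B C < 0"
    if "(u, v, w) \<in> {(C, B, A), (A, C, B), (B, A, C)}" for u v w
  proof -
    have "det3 u v w = - det3 A B C"
      using that by (auto simp: det3_expand algebra_simps)
    then have "det3 u v w * det3 A B C = - (det3 A B C)\<^sup>2"
      by (simp add: power2_eq_square)
    also have "\<dots> < 0"
      using d by simp
    finally show ?thesis .
  qed
  have "strictly_same_side (p s) (p (next_side s)) (p ` (- {s, next_side s}))" for s
  proof (rule strictly_same_sideI[where k = "det3 A B C"])
    fix z assume "z \<in> p ` (- {s, next_side s})"
    then obtain t where t: "z = p t" "t \<noteq> s" "t \<noteq> next_side s" by auto
    show "0 < det3 (p s) (p (next_side s)) z * det3 A B C"
    proof (cases s)
      case Side_a
      then have "z \<in> {foot b C A, foot b A C, foot c B A, foot c A B}"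
        using t by (cases t) simp_all
      then have "0 < det3 (foot a C B) (foot a B C) z * det3 A B C"
        using det3_perpendicular[OF pos(1) _ perm[of C B A]] pos by blast
      then show ?thesis
        by (simp add: Side_a)
    next
      case Side_b
      then have "z \<in> {foot c A B, foot c B A, foot a C B, foot a B C}"
        using t by (cases t) simp_all
      then have "0 < det3 (foot b A C) (foot b C A) z * det3 A B C"
        using det3_perpendicular[OF pos(2) _ perm[of A C B]] pos by blast
      then show ?thesis
        by (simp add: Side_b)
    next
      case Side_c
      then have "z \<in> {foot a B C, foot a C B, foot b A C, foot b C A}"
        using t by (cases t) simp_all
      then have "0 < det3 (foot c B A) (foot c A B) z * det3 A B C"
        using det3_perpendicular[OF pos(3) _ perm[of B A C]] pos by blast
      then show ?thesis
        by (simp add: Side_c)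
    next
      case Side_C
      then have z: "z \<in> {foot a C B, foot b C A, foot c B A, foot c A B}"
        using t by (cases t) simp_all
      have "0 < det3 (foot a B C) (foot b A C) z * det3 A B C"
        by (rule det3_line[OF pos(1,2,3) perm z]) simp
      then show ?thesis
        by (simp add: Side_C)
    next
      case Side_A
      then have z: "z \<in> {foot b A C, foot c A B, foot a C B, foot a B C}"
        using t by (cases t) simp_all
      have "0 < det3 (foot b C A) (foot c B A) z * det3 A B C"
        by (rule det3_line[OF pos(2,3,1) perm z]) simp
      then show ?thesis
        by (simp add: Side_A)
    next
      case Side_B
      then have z: "z \<in> {foot c B A, foot a B C, foot b A C, foot b C A}"
        using t by (cases t) simp_all
      have "0 < det3 (foot c A B) (foot a C B) z * det3 A B C"
        by (rule det3_line[OF pos(3,1,2) perm z]) simp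
      then show ?thesis
        by (simp add: Side_B)
    qed
  qed
  moreover have "p s \<in> hyp_plane" for s
    by (cases s) (simp_all add: hp)
  ultimately have "right_hexagon p"
    unfolding right_hexagon_def using ang by blast
  moreover have "len p Side_a = a" "len p Side_b = b" "len p Side_c = c"
    using pos by (simp_all add: len_def hyp_dist_def fa(2,6) fb(2,6) fc(2,6) arcosh_cosh_real)
  ultimately show ?thesis by blast
qed

theorem right_hexagon_exists:
  assumes "a > 0" "b > 0" "c > 0"
  shows "\<exists>p. right_hexagon p \<and> len p Side_a = a \<and> len p Side_b = b \<and> len p Side_c = c"
proof -
  have s: "sinh a > 0" "sinh b > 0" "sinh c > 0" "cosh a > 0" "cosh b > 0" "cosh c > 0"
    using assms by auto
  \<comment> \<open>With the first two normals in standard position, \<open>z\<close> is forced by the product of the last two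
    and \<open>y\<close> by the norm of the third one.\<close>
  define z where "z = (cosh a + cosh b * cosh c) / sinh c"
  have "sinh b * sinh c < cosh b * cosh c"
    using s sinh_less_cosh_real by (intro mult_strict_mono) auto
  then have "sinh b < z"
    using s by (simp add: z_def field_simps add_strict_increasing)
  then have z: "z > 0" "(sinh b)\<^sup>2 < z\<^sup>2"
    using s(2) by (linarith, auto intro: power_strict_mono)
  define y where "y = sqrt (z\<^sup>2 - (sinh b)\<^sup>2)"
  have y: "y > 0" "y * y = z * z - sinh b * sinh b"
    using z by (auto simp: y_def power2_eq_square)
  have c2: "cosh x * cosh x = sinh x * sinh x + 1" for x :: real
    using cosh_square_eq[of x] by (simp add: power2_eq_square)
  let ?A = "vector [1, 0, 0] :: real ^ 3" and ?B = "vector [- cosh c, 0, sinh c] :: real ^ 3"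
    and ?C = "vector [- cosh b, y, z] :: real ^ 3"
  show ?thesis
  proof (rule right_hexagon_from_normals[OF assms, of ?A ?B ?C])
    show "mink ?B ?C = - cosh a"
      using s by (simp add: mink_def z_def)
    show "det3 ?A ?B ?C \<noteq> 0"
      using s y by (simp add: det3_expand)
  qed (use s y z in \<open>simp_all add: mink_def c2\<close>)
qed

section \<open>The image of Teichmueller space\<close>

text \<open>The law of cosines, solved for the length of the side opposite to the one of length \<open>x\<close>.\<close>

definition opposite_length :: "real \<Rightarrow> real \<Rightarrow> real \<Rightarrow> real" where
  "opposite_length x y z = arcosh ((cosh x + cosh y * cosh z) / (sinh y * sinh z))"

definition hexagon_lengths :: "real \<Rightarrow> real \<Rightarrow> real \<Rightarrow> real ^ side" where
  "hexagon_lengths a b c = (\<chi> s. rec_side a (opposite_length c a b) b (opposite_length a b c) c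
     (opposite_length b c a) s)"

lemma hexagon_lengths_nth [simp]:
  "hexagon_lengths a b c $ Side_a = a" "hexagon_lengths a b c $ Side_b = b"
  "hexagon_lengths a b c $ Side_c = c" "hexagon_lengths a b c $ Side_A = opposite_length a b c"
  "hexagon_lengths a b c $ Side_B = opposite_length b c a"
  "hexagon_lengths a b c $ Side_C = opposite_length c a b"
  by (simp_all add: hexagon_lengths_def)

lemma vec_eq_iff_side:
  "v = w \<longleftrightarrow> v $ Side_a = w $ Side_a \<and> v $ Side_b = w $ Side_b \<and> v $ Side_c = w $ Side_c \<and>
     v $ Side_A = w $ Side_A \<and> v $ Side_B = w $ Side_B \<and> v $ Side_C = w $ Side_C"
  using side.induct[of "\<lambda>s. v $ s = w $ s"] unfolding vec_eq_iff by blast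

lemma lengths_of_right_hexagon:
  assumes "right_hexagon p"
  shows "(\<chi> s. len p s) = hexagon_lengths (len p Side_a) (len p Side_b) (len p Side_c)"
proof -
  have eq: "len p s = arcosh t" if "cosh (len p s) = t" for s t
    using that right_hexagon_len(2)[OF assms, of s] by (metis arcosh_cosh_real less_imp_le)
  show ?thesis
    unfolding vec_eq_iff_side
    using hexagon_cosine_law[OF assms, of Side_a] hexagon_cosine_law[OF assms, of Side_b]
      hexagon_cosine_law[OF assms, of Side_c]
    by (auto simp: opposite_length_def intro: eq)
qed

lemma l_star_class:
  assumes "right_hexagon p"
  shows "l_star (label_isometric `` {p}) = hexagon_lengths (len p Side_a) (len p Side_b) (len p Side_c)"
  unfolding l_star_def side_length_class[OF assms] by (rule lengths_of_right_hexagon[OF assms])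

lemma Teich_cases:
  assumes "h \<in> Teich"
  obtains p where "right_hexagon p" "h = label_isometric `` {p}"
  using assms by (auto simp: Teich_def quotient_def)

theorem l_star_image:
  "l_star ` Teich = {hexagon_lengths a b c | a b c. a > 0 \<and> b > 0 \<and> c > 0}"
proof (intro equalityI subsetI)
  fix v assume "v \<in> l_star ` Teich"
  then show "v \<in> {hexagon_lengths a b c | a b c. a > 0 \<and> b > 0 \<and> c > 0}"
  proof (rule imageE)
    fix h assume v: "v = l_star h" and h: "h \<in> Teich"
    from h obtain p where p: "right_hexagon p" "h = label_isometric `` {p}"
      by (rule Teich_cases)
    show ?thesis
      unfolding v p(2) l_star_class[OF p(1)] using right_hexagon_len(2)[OF p(1)] by blast
  qed
next
  fix v assume "v \<in> {hexagon_lengths a b c | a b c. a > 0 \<and> b > 0 \<and> c > 0}"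
  then obtain a b c where v: "v = hexagon_lengths a b c" "a > 0" "b > 0" "c > 0" by blast
  then obtain p where p: "right_hexagon p" "len p Side_a = a" "len p Side_b = b" "len p Side_c = c"
    using right_hexagon_exists by blast
  then have "label_isometric `` {p} \<in> Teich"
    by (auto simp: Teich_def quotient_def)
  then show "v \<in> l_star ` Teich"
    using l_star_class[OF p(1)] v p by (metis image_eqI)
qed

theorem inj_on_l_star: "inj_on l_star Teich"
proof (rule inj_onI)
  fix h k assume "h \<in> Teich" "k \<in> Teich" and eq: "l_star h = l_star k"
  then obtain p q where p: "right_hexagon p" "h = label_isometric `` {p}"
    and q: "right_hexagon q" "k = label_isometric `` {q}"
    by (metis Teich_cases)
  have "len p s = len q s" if "s \<in> {Side_a, Side_b, Side_c}" for s
    using arg_cong[OF eq, of "\<lambda>v. v $ s"] that p(1) q(1) unfolding p(2) q(2) by (auto simp: l_star_class)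
  then have "(p, q) \<in> label_isometric"
    using right_hexagon_unique[OF p(1) q(1)] by simp
  then show "h = k"
    unfolding p(2) q(2) using equiv_class_eq[OF equiv_label_isometric] by blast
qed

section \<open>The hexagon in coordinates\<close>

primrec height :: "side \<Rightarrow> complex \<Rightarrow> real" where
  "height Side_a z = Re z"
| "height Side_C z = Im z"
| "height Side_b z = Im z - Re z"
| "height Side_A z = - Re z"
| "height Side_c z = - Im z"
| "height Side_B z = Re z - Im z"

text \<open>The heights over two consecutive sides are linear coordinates of the plane, so that statements
  about all sides can be made in a rotation invariant way.\<close>

lemma height_next_next [simp]: "height (next_side (next_side s)) z = height (next_side s) z - height s z"
  by (cases s) auto

lemma height_prev [simp]: "height (prev_side s) z = height s z - height (next_side s) z"
  by (cases s) auto

lemma height_linear: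
  "height s (x + y) = height s x + height s y" "height s (x - y) = height s x - height s y"
  "height s (r *\<^sub>R x) = r * height s x"
  by (cases s; simp add: algebra_simps)+

lemma continuous_on_height [continuous_intros]:
  "continuous_on S f \<Longrightarrow> continuous_on S (\<lambda>x. height s (f x))"
  by (cases s) (auto intro!: continuous_intros)

lemma height_eqI: "height s z = height s w \<Longrightarrow> height (next_side s) z = height (next_side s) w \<Longrightarrow> z = w"
  by (cases s) (auto simp: complex_eq_iff)

lemma height_corner: "height s (corner s) = 1" "height s (corner (next_side s)) = 1"
  "height (next_side s) (corner s) = 0" "height (next_side s) (corner (next_side s)) = 1"
  by (cases s; simp)+

lemma height_corner_le: "height s (corner t) \<le> 1"
  by (cases s; cases t) simp_all

text \<open>In the triangle spanned by \<open>0\<close> and the ends of a side, the heights over the two adjacent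
  sides are barycentric coordinates.\<close>

lemma sector_coordinates:
  "z = height (prev_side s) z *\<^sub>R corner s + height (next_side s) z *\<^sub>R corner (next_side s)"
  by (cases s) (simp_all add: complex_eq_iff)

lemma in_some_sector: "\<exists>s. height (prev_side s) z \<ge> 0 \<and> height (next_side s) z \<ge> 0"
proof -
  have "height (prev_side Side_a) z \<ge> 0 \<and> height (next_side Side_a) z \<ge> 0 \<or>
    height (prev_side Side_C) z \<ge> 0 \<and> height (next_side Side_C) z \<ge> 0 \<or>
    height (prev_side Side_b) z \<ge> 0 \<and> height (next_side Side_b) z \<ge> 0 \<or>
    height (prev_side Side_A) z \<ge> 0 \<and> height (next_side Side_A) z \<ge> 0 \<or>
    height (prev_side Side_c) z \<ge> 0 \<and> height (next_side Side_c) z \<ge> 0 \<or>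
    height (prev_side Side_B) z \<ge> 0 \<and> height (next_side Side_B) z \<ge> 0"
    by simp linarith
  then show ?thesis by blast
qed

lemma hexagon_eq: "hexagon = {z. \<forall>s. height s z \<le> 1}"
proof
  have "convex {z. \<forall>s. height s z \<le> 1}"
  proof (rule convexI)
    fix x y :: complex and u v :: real
    assume "x \<in> {z. \<forall>s. height s z \<le> 1}" "y \<in> {z. \<forall>s. height s z \<le> 1}" "0 \<le> u" "0 \<le> v" "u + v = 1"
    then show "u *\<^sub>R x + v *\<^sub>R y \<in> {z. \<forall>s. height s z \<le> 1}"
      by (simp add: height_linear convex_bound_le)
  qed
  then show "hexagon \<subseteq> {z. \<forall>s. height s z \<le> 1}"
    unfolding hexagon_def by (intro hull_minimal) (auto simp: height_corner_le)
next
  have c: "corner s \<in> hexagon" for s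
    by (simp add: hexagon_def hull_inc)
  have conv: "convex hexagon"
    by (simp add: hexagon_def)
  have "(1/2) *\<^sub>R corner Side_a + (1/2) *\<^sub>R corner Side_A \<in> hexagon"
    by (rule convexD[OF conv c c]) auto
  moreover have "(1/2) *\<^sub>R corner Side_a + (1/2) *\<^sub>R corner Side_A = 0"
    by (simp add: complex_eq_iff)
  ultimately have 0: "0 \<in> hexagon"
    by simp
  show "{z. \<forall>s. height s z \<le> 1} \<subseteq> hexagon"
  proof
    fix z assume z: "z \<in> {z. \<forall>s. height s z \<le> 1}"
    obtain s where s: "height (prev_side s) z \<ge> 0" "height (next_side s) z \<ge> 0"
      using in_some_sector by blast
    define r where "r = height s z"
    have r: "r = height (prev_side s) z + height (next_side s) z" "r \<le> 1"
      using z by (simp_all add: r_def)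
    show "z \<in> hexagon"
    proof (cases "r = 0")
      case True
      then have "height (prev_side s) z = 0" "height (next_side s) z = 0"
        using s r by linarith+
      then have "z = 0"
        using sector_coordinates[of z s] by simp
      then show ?thesis
        using 0 by simp
    next
      case False
      then have "r > 0"
        using r s by linarith
      define w where "w = (height (prev_side s) z / r) *\<^sub>R corner s
        + (height (next_side s) z / r) *\<^sub>R corner (next_side s)"
      have "w \<in> hexagon"
        unfolding w_def using s r(1) \<open>r > 0\<close>
        by (intro convexD[OF conv c c]) (simp_all del: height_prev flip: add_divide_distrib)
      then have "(1 - r) *\<^sub>R 0 + r *\<^sub>R w \<in> hexagon"
        using r(2) \<open>r > 0\<close> by (intro convexD[OF conv 0]) auto
      then show ?thesis
        using \<open>r > 0\<close> sector_coordinates[of z s] by (simp add: w_def scaleR_add_right del: height_prev)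
    qed
  qed
qed

lemma interior_hexagon: "interior hexagon = {z. \<forall>s. height s z < 1}"
proof
  show "interior hexagon \<subseteq> {z. \<forall>s. height s z < 1}"
  proof (intro subsetI CollectI allI)
    fix z s assume "z \<in> interior hexagon"
    then obtain e where e: "e > 0" "ball z e \<subseteq> hexagon"
      by (auto simp: mem_interior)
    have n: "norm (corner s) > 0"
      by (cases s) (simp_all add: complex_eq_iff)
    define t where "t = e / (2 * norm (corner s))"
    have t: "t > 0" "t * norm (corner s) < e"
      using e(1) n by (simp_all add: t_def)
    then have "z + t *\<^sub>R corner s \<in> ball z e"
      by (simp add: dist_norm)
    then have "height s (z + t *\<^sub>R corner s) \<le> 1"
      using e by (auto simp: hexagon_eq)
    then show "height s z < 1"
      using t by (simp add: height_linear height_corner)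
  qed
  have "{z. \<forall>s. height s z < 1} = (\<Inter>s. {z. height s z < 1})"
    by auto
  moreover have "open (\<Inter>s. {z. height s z < 1})"
    by (intro open_INT finite ballI open_Collect_less continuous_intros)
  ultimately show "{z. \<forall>s. height s z < 1} \<subseteq> interior hexagon"
    by (intro interior_maximal) (auto simp: hexagon_eq less_imp_le)
qed

lemma frontier_hexagon: "frontier hexagon = {z \<in> hexagon. \<exists>s. height s z = 1}"
proof -
  have "closed hexagon"
    by (simp add: hexagon_def compact_imp_closed finite_imp_compact_convex_hull)
  then have "frontier hexagon = hexagon - interior hexagon"
    by (simp add: frontier_def)
  also have "\<dots> = {z \<in> hexagon. \<exists>s. height s z = 1}"
    unfolding interior_hexagon unfolding hexagon_eq by (auto simp: not_less) (metis order_antisym, metis less_irrefl)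
  finally show ?thesis .
qed

lemma edge_eq: "edge s = {z. height s z = 1 \<and> 0 < height (next_side s) z \<and> height (next_side s) z < 1}"
proof (intro equalityI subsetI)
  fix z assume "z \<in> edge s"
  then show "z \<in> {z. height s z = 1 \<and> 0 < height (next_side s) z \<and> height (next_side s) z < 1}"
    by (auto simp: edge_def in_segment height_linear height_corner)
next
  fix z assume z: "z \<in> {z. height s z = 1 \<and> 0 < height (next_side s) z \<and> height (next_side s) z < 1}"
  have "z = (1 - height (next_side s) z) *\<^sub>R corner s + height (next_side s) z *\<^sub>R corner (next_side s)"
    using sector_coordinates[of z s] z by simp
  moreover have "corner s \<noteq> corner (next_side s)"
    by (cases s) auto
  ultimately show "z \<in> edge s"
    unfolding edge_def in_segment using z by blast
qed

lemma edge_disjoint: "z \<in> edge s \<Longrightarrow> z \<in> edge t \<Longrightarrow> s = t"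
  by (cases s; cases t) (auto simp: edge_eq)

lemma all_side_from: "(\<forall>t. P t) \<longleftrightarrow> P s \<and> P (next_side s) \<and> P (next_side (next_side s)) \<and>
    P (next_side (next_side (next_side s))) \<and> P (next_side (next_side (next_side (next_side s)))) \<and>
    P (prev_side s)"
proof -
  have "(\<forall>t. P t) \<longleftrightarrow> (P Side_a \<and> P Side_C \<and> P Side_b \<and> P Side_A \<and> P Side_c \<and> P Side_B)"
    using side.induct[of P] by blast
  then show ?thesis
    by (cases s) auto
qed

lemma edge_subset: "edge s \<subseteq> frontier hexagon" "edge s \<subseteq> hexagon"
proof -
  have "height t z \<le> 1" if "z \<in> edge s" for z t
  proof -
    have "\<forall>t. height t z \<le> 1"
      using that unfolding all_side_from[of _ s] edge_eq by simp
    then show ?thesis ..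
  qed
  then show "edge s \<subseteq> hexagon" by (auto simp: hexagon_eq)
  then show "edge s \<subseteq> frontier hexagon" unfolding frontier_hexagon by (auto simp: edge_eq)
qed

section \<open>Arcs that must cross\<close>

text \<open>The Fashoda theorem in the coordinates \<open>height s\<close> and \<open>height (next_side s)\<close>.\<close>

lemma rectangle_crossing:
  fixes f g :: "real \<Rightarrow> complex"
  assumes "path f" "path g"
    and sq: "\<And>z. z \<in> path_image f \<union> path_image g \<Longrightarrow> \<bar>height s z\<bar> \<le> 1 \<and> \<bar>height (next_side s) z\<bar> \<le> 1"
    and "height s (pathstart f) = 1" "height s (pathfinish f) = -1"
    and "height (next_side s) (pathstart g) = 1" "height (next_side s) (pathfinish g) = -1"
  shows "path_image f \<inter> path_image g \<noteq> {}"
proof -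
  define k :: "complex \<Rightarrow> real ^ 2" where
    "k z = height s z *\<^sub>R axis 1 1 + height (next_side s) z *\<^sub>R axis 2 1" for z
  have k: "k z $ 1 = height s z" "k z $ 2 = height (next_side s) z" for z
    by (simp_all add: k_def axis_def)
  have cont: "continuous_on A k" for A
    unfolding k_def by (intro continuous_intros)
  have inj: "k z = k w \<Longrightarrow> z = w" for z w
    by (metis k height_eqI)
  let ?F = "reversepath (k \<circ> f)" and ?G = "reversepath (k \<circ> g)"
  obtain y where "y \<in> path_image ?F" "y \<in> path_image ?G"
  proof (rule fashoda[of ?F ?G "vector [-1, -1]" "vector [1, 1]"])
    show "path ?F" "path ?G"
      using assms(1,2) cont by (simp_all add: path_continuous_image)
    show "path_image ?F \<subseteq> cbox (vector [- 1, - 1]) (vector [1, 1])"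
      "path_image ?G \<subseteq> cbox (vector [- 1, - 1]) (vector [1, 1])"
      using sq by (auto simp: path_image_compose mem_box_cart forall_2 k abs_le_iff minus_le_iff)
  qed (use assms in \<open>auto simp: pathstart_compose pathfinish_compose k\<close>)
  then obtain z w where "z \<in> path_image f" "w \<in> path_image g" "k z = k w"
    by (auto simp: path_image_compose)
  then show ?thesis
    using inj by blast
qed

text \<open>Both paths are continued beyond their final points until they join opposite sides of the
  parallelogram on which the heights over \<open>s\<close> and the next side lie between \<open>-1\<close> and \<open>1\<close>. The continued
  paths cross, and the crossing lies on the original paths: a continuation meets the hexagon only at its
  initial point or along a part of the boundary that the other path avoids, and the two
  continuations are disjoint.\<close>

lemma paths_cross:
  assumes f: "path f" "path_image f \<subseteq> hexagon" "f ` {0<..<1} \<subseteq> interior hexagon"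
    and g: "path g" "path_image g \<subseteq> hexagon"
    and f0: "pathstart f \<in> edge s"
    and f1: "pathfinish f \<in> edge (next_side (next_side s)) \<or>
      pathfinish f \<in> edge (next_side (next_side (next_side s)))"
    and g0: "pathstart g \<in> edge (next_side s)"
    and g1: "pathfinish g \<in> edge (next_side (next_side (next_side s))) \<or>
      pathfinish g \<in> edge (next_side (next_side (next_side (next_side s)))) \<or>
      pathfinish g \<in> edge (prev_side s)"
    and opp: "pathfinish f \<in> edge (next_side (next_side (next_side s))) \<Longrightarrow>
      pathfinish g \<in> edge (next_side (next_side (next_side (next_side s))))"
  shows "path_image f \<inter> path_image g \<noteq> {}"
proof -
  let ?X = "height s" and ?Y = "height (next_side s)"
  have sq: "\<bar>?X z\<bar> \<le> 1 \<and> \<bar>?Y z\<bar> \<le> 1 \<and> ?X z - ?Y z \<le> 1 \<and> ?Y z - ?X z \<le> 1" if "z \<in> hexagon" for z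
  proof -
    have "\<forall>t. height t z \<le> 1"
      using that by (simp add: hexagon_eq)
    then show ?thesis
      unfolding all_side_from[of _ s] by (simp add: abs_le_iff)
  qed
  define u where "u = pathfinish f - (?X (pathfinish f) + 1) *\<^sub>R corner s"
  define v where "v = pathfinish g - (?Y (pathfinish g) + 1) *\<^sub>R (corner (next_side s) - corner s)"
  let ?f1 = "pathfinish f" and ?g1 = "pathfinish g"
  have f1_cases: "(?Y ?f1 = 1 + ?X ?f1 \<and> -1 < ?X ?f1 \<and> ?X ?f1 < 0) \<or>
      (?X ?f1 = -1 \<and> -1 < ?Y ?f1 \<and> ?Y ?f1 < 0 \<and> ?Y ?g1 = -1)"
    using f1 opp by (auto simp: edge_eq)
  have g1_cases: "(?X ?g1 = -1 \<and> -1 < ?Y ?g1 \<and> ?Y ?g1 < 0) \<or> ?Y ?g1 = -1 \<or>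
      (?X ?g1 = 1 + ?Y ?g1 \<and> ?Y ?g1 < 0)"
    using g1 by (auto simp: edge_eq)
  have "?f1 \<in> hexagon" "?g1 \<in> hexagon"
    using f(2) g(2) pathfinish_in_path_image by blast+
  note end_sq = sq[OF this(1)] sq[OF this(2)]
  have tail_f: "?Y z = ?Y ?f1 \<and> -1 \<le> ?X z \<and> ?X z \<le> ?X ?f1" if "z \<in> closed_segment ?f1 u" for z
  proof -
    obtain t where t: "0 \<le> t" "t \<le> 1" "z = (1 - t) *\<^sub>R ?f1 + t *\<^sub>R u"
      using \<open>z \<in> closed_segment ?f1 u\<close> by (auto simp: in_segment)
    have "?X z = ?X ?f1 - t * (?X ?f1 + 1)" "?Y z = ?Y ?f1"
      by (simp_all add: t(3) u_def height_linear height_corner algebra_simps)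
    moreover have "0 \<le> t * (?X ?f1 + 1)" "t * (?X ?f1 + 1) \<le> ?X ?f1 + 1"
      using t end_sq mult_right_mono[of t 1 "?X ?f1 + 1"] by auto
    moreover define q where "q = t * (?X ?f1 + 1)"
    ultimately have "?Y z = ?Y ?f1" "-1 \<le> ?X z" "?X z \<le> ?X ?f1"
      unfolding q_def[symmetric] by linarith+
    then show ?thesis by blast
  qed
  have tail_g: "?X z = ?X ?g1 \<and> -1 \<le> ?Y z \<and> ?Y z \<le> ?Y ?g1" if "z \<in> closed_segment ?g1 v" for z
  proof -
    obtain t where t: "0 \<le> t" "t \<le> 1" "z = (1 - t) *\<^sub>R ?g1 + t *\<^sub>R v"
      using \<open>z \<in> closed_segment ?g1 v\<close> by (auto simp: in_segment)
    have "?Y z = ?Y ?g1 - t * (?Y ?g1 + 1)" "?X z = ?X ?g1"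
      by (simp_all add: t(3) v_def height_linear height_corner algebra_simps)
    moreover have "0 \<le> t * (?Y ?g1 + 1)" "t * (?Y ?g1 + 1) \<le> ?Y ?g1 + 1"
      using t end_sq mult_right_mono[of t 1 "?Y ?g1 + 1"] by auto
    moreover define q where "q = t * (?Y ?g1 + 1)"
    ultimately have "?X z = ?X ?g1" "-1 \<le> ?Y z" "?Y z \<le> ?Y ?g1"
      unfolding q_def[symmetric] by linarith+
    then show ?thesis by blast
  qed
  let ?F = "f +++ linepath ?f1 u" and ?G = "g +++ linepath ?g1 v"
  have F: "path_image ?F = path_image f \<union> closed_segment ?f1 u"
    and G: "path_image ?G = path_image g \<union> closed_segment ?g1 v"
    by (simp_all add: path_image_join)
  have "path_image ?F \<inter> path_image ?G \<noteq> {}"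
  proof (rule rectangle_crossing[where s = s])
    show "path ?F" "path ?G"
      using f(1) g(1) by (auto intro!: path_join_imp)
    show "\<bar>?X z\<bar> \<le> 1 \<and> \<bar>?Y z\<bar> \<le> 1" if zin: "z \<in> path_image ?F \<union> path_image ?G" for z
    proof -
      consider "z \<in> hexagon" | "z \<in> closed_segment ?f1 u" | "z \<in> closed_segment ?g1 v"
        using zin f(2) g(2) unfolding F G by blast
      then show ?thesis
      proof cases
        case 1
        then show ?thesis using sq[OF 1] by simp
      next
        case 2
        then show ?thesis using tail_f[OF 2] end_sq(1) unfolding abs_le_iff by linarith
      next
        case 3
        then show ?thesis using tail_g[OF 3] end_sq(2) unfolding abs_le_iff by linarith
      qed
    qed
    show "?X (pathstart ?F) = 1" "?Y (pathstart ?G) = 1"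
      using f0 g0 unfolding pathstart_join edge_eq by simp_all
    show "?X (pathfinish ?F) = -1" "?Y (pathfinish ?G) = -1"
      unfolding pathfinish_join pathfinish_linepath u_def v_def height_linear height_corner by simp_all
  qed
  then obtain z where z: "z \<in> path_image f \<or> z \<in> closed_segment ?f1 u"
      "z \<in> path_image g \<or> z \<in> closed_segment ?g1 v"
    unfolding F G by blast
  have meets_f: "z = ?f1" if "z \<in> closed_segment ?f1 u" "z \<in> path_image g"
  proof (rule height_eqI[of s])
    have "z \<in> hexagon"
      using that(2) g(2) by blast
    from sq[OF this] show "?X z = ?X ?f1"
      using tail_f[OF that(1)] f1_cases by (smt (verit))
    show "?Y z = ?Y ?f1"
      using tail_f[OF that(1)] by blast
  qed
  have meets_g: "z = ?g1" if zt: "z \<in> closed_segment ?g1 v" and zf: "z \<in> path_image f"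
  proof (cases "?X ?g1 = -1 \<and> -1 < ?Y ?g1")
    case False
    show ?thesis
    proof (rule height_eqI[of s])
      have "z \<in> hexagon"
        using zf f(2) by blast
      from sq[OF this] show "?Y z = ?Y ?g1"
        using tail_g[OF zt] g1_cases False by (smt (verit))
      show "?X z = ?X ?g1"
        using tail_g[OF zt] by blast
    qed
  next
    case True
    have "height (next_side (next_side (next_side s))) z = 1"
      using tail_g[OF zt] True unfolding height_next_next by linarith
    then have "z \<notin> interior hexagon"
      unfolding interior_hexagon by (metis (mono_tags) less_irrefl mem_Collect_eq)
    moreover obtain t where "0 \<le> t" "t \<le> 1" "z = f t"
      using zf by (auto simp: path_image_def)
    ultimately have "t = 0 \<or> t = 1"
      using f(3) by (smt (verit) greaterThanLessThan_iff image_subset_iff)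
    then have "z = pathstart f \<or> z = ?f1"
      using \<open>z = f t\<close> by (auto simp: pathstart_def pathfinish_def)
    moreover have "?X z = -1"
      using tail_g[OF zt] True by linarith
    moreover have "?X (pathstart f) = 1"
      using f0 by (simp add: edge_eq)
    ultimately show ?thesis
      using f1_cases True by (smt (verit))
  qed
  have "\<not> (z \<in> closed_segment ?f1 u \<and> z \<in> closed_segment ?g1 v)"
    using tail_f[of z] tail_g[of z] f1_cases g1_cases by (smt (verit))
  then have "z \<in> path_image f \<and> z \<in> path_image g"
    using z meets_f meets_g pathfinish_in_path_image[of f] pathfinish_in_path_image[of g] by metis
  then show ?thesis by blast
qed

section \<open>The nine classes of arcs\<close>

text \<open>An arc between non-adjacent sides cuts off one side or joins two opposite sides.\<close>

datatype arc_class = Around side | Across_a | Across_b | Across_c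

primrec end1 :: "arc_class \<Rightarrow> side" where
  "end1 (Around s) = prev_side s"
| "end1 Across_a = Side_a"
| "end1 Across_b = Side_b"
| "end1 Across_c = Side_c"

primrec end2 :: "arc_class \<Rightarrow> side" where
  "end2 (Around s) = next_side s"
| "end2 Across_a = Side_A"
| "end2 Across_b = Side_B"
| "end2 Across_c = Side_C"

definition class_ends :: "arc_class \<Rightarrow> side set" where
  "class_ends d = {end1 d, end2 d}"

lemma UNIV_arc_class: "(UNIV :: arc_class set) = Around ` UNIV \<union> {Across_a, Across_b, Across_c}"
proof -
  have "d \<in> Around ` UNIV \<union> {Across_a, Across_b, Across_c}" for d
    by (cases d) auto
  then show ?thesis by blast
qed

instance arc_class :: finite
  by standard (simp add: UNIV_arc_class)

lemma inj_class_ends: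
  assumes "class_ends d = class_ends e"
  shows "d = e"
proof -
  have 1: "class_ends (Around s) = class_ends (Around t) \<Longrightarrow> s = t" for s t
    by (cases s; cases t) (simp_all add: class_ends_def doubleton_eq_iff)
  have 2: "class_ends (Around s) \<noteq> class_ends Across_a" "class_ends (Around s) \<noteq> class_ends Across_b"
    "class_ends (Around s) \<noteq> class_ends Across_c" for s
    by (cases s; simp add: class_ends_def doubleton_eq_iff)+
  have 3: "class_ends Across_a \<noteq> class_ends Across_b" "class_ends Across_a \<noteq> class_ends Across_c"
    "class_ends Across_b \<noteq> class_ends Across_c"
    by (simp_all add: class_ends_def doubleton_eq_iff)
  show ?thesis
    using assms 1 2 3 by (metis arc_class.exhaust)
qed

lemma class_ends_nonadjacent: "nonadjacent (end1 d) (end2 d)"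
proof (cases d)
  case (Around s)
  then show ?thesis by (cases s) (auto simp: nonadjacent_def)
qed (auto simp: nonadjacent_def)

lemma nonadjacent_class:
  assumes "nonadjacent i j"
  obtains d where "class_ends d = {i, j}"
proof -
  have "\<exists>d. class_ends d = {i, j}"
  proof (cases "\<exists>s. {prev_side s, next_side s} = {i, j}")
    case True
    then obtain s where "{prev_side s, next_side s} = {i, j}" by blast
    then have "class_ends (Around s) = {i, j}" by (simp add: class_ends_def)
    then show ?thesis by blast
  next
    case False
    then have "{prev_side (next_side i), next_side (next_side i)} \<noteq> {i, j}"
      "{prev_side (next_side j), next_side (next_side j)} \<noteq> {i, j}"
      by blast+
    then have "{i, j} \<in> {class_ends Across_a, class_ends Across_b, class_ends Across_c}"
      using assms by (cases i; cases j) (auto simp: nonadjacent_def class_ends_def)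
    then show ?thesis by auto
  qed
  then show ?thesis using that by blast
qed

definition joins :: "arc_class \<Rightarrow> (real \<Rightarrow> complex) \<Rightarrow> bool" where
  "joins d \<gamma> \<longleftrightarrow> arc_joins (end1 d) (end2 d) \<gamma> \<or> arc_joins (end2 d) (end1 d) \<gamma>"

lemma joins_if_arc_joins: "arc_joins i j \<gamma> \<Longrightarrow> class_ends d = {i, j} \<Longrightarrow> joins d \<gamma>"
  by (auto simp: joins_def class_ends_def doubleton_eq_iff)

lemma joins_ends:
  "joins d \<gamma> \<Longrightarrow> \<exists>i j. class_ends d = {i, j} \<and> pathstart \<gamma> \<in> edge i \<and> pathfinish \<gamma> \<in> edge j"
  by (auto simp: joins_def class_ends_def arc_joins_def)

lemma joins_unique:
  assumes "joins d \<gamma>" "joins e \<gamma>"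
  shows "d = e"
proof -
  obtain i j where ij: "class_ends d = {i, j}" "pathstart \<gamma> \<in> edge i" "pathfinish \<gamma> \<in> edge j"
    using joins_ends[OF assms(1)] by blast
  obtain k l where kl: "class_ends e = {k, l}" "pathstart \<gamma> \<in> edge k" "pathfinish \<gamma> \<in> edge l"
    using joins_ends[OF assms(2)] by blast
  have "i = k" "j = l"
    using edge_disjoint ij kl by blast+
  then show ?thesis
    using ij(1) kl(1) inj_class_ends by simp
qed

lemma joins_reversepath [simp]: "joins d (reversepath \<gamma>) \<longleftrightarrow> joins d \<gamma>"
  by (auto simp: joins_def arc_joins_def)

text \<open>Since the hexagon and its sides are convex, the straight-line homotopy shows that arcs
  joining the same sides are homotopic.\<close>

lemma homotopic_if_same_ends:
  assumes "path \<alpha>" "path_image \<alpha> \<subseteq> hexagon" "path \<beta>" "path_image \<beta> \<subseteq> hexagon"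
    and "arc_joins i j \<alpha>" "arc_joins i j \<beta>"
  shows "homotopic_with_canon (arc_joins i j) {0..1} hexagon \<alpha> \<beta>"
proof -
  define h where "h = (\<lambda>(t, x). (1 - t) *\<^sub>R \<alpha> x + t *\<^sub>R \<beta> x)"
  have conv: "convex hexagon" "convex (edge s)" for s
    by (simp_all add: hexagon_def edge_def)
  have "continuous_on ({0..1} \<times> {0..1}) h"
    unfolding h_def case_prod_unfold using assms(1,3)
    by (intro continuous_intros continuous_on_compose2[where g = \<alpha> and f = snd]
        continuous_on_compose2[where g = \<beta> and f = snd]) (auto simp: path_def)
  moreover have "h ` ({0..1} \<times> {0..1}) \<subseteq> hexagon"
    using assms(2,4) by (auto simp: h_def path_image_def intro!: convexD[OF conv(1)])
  moreover have "arc_joins i j (\<lambda>x. h (t, x))" if "t \<in> {0..1}" for t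
    using assms(5,6) that
    by (auto simp: arc_joins_def pathstart_def pathfinish_def h_def intro!: convexD[OF conv(2)])
  ultimately show ?thesis
    unfolding homotopic_with_def by (intro exI[of _ h]) (auto simp: h_def)
qed

lemma hexagon_arc_path:
  assumes "hexagon_arc \<gamma>"
  shows "path \<gamma>" "path_image \<gamma> \<subseteq> hexagon" "\<gamma> ` {0<..<1} \<subseteq> interior hexagon"
proof -
  show "path \<gamma>" "\<gamma> ` {0<..<1} \<subseteq> interior hexagon"
    using assms by (auto simp: hexagon_arc_def arc_imp_path)
  have "\<gamma> t \<in> hexagon" if t: "0 \<le> t" "t \<le> 1" for t
  proof -
    consider "t = 0" | "t = 1" | "t \<in> {0<..<1}" using t by fastforce
    then show ?thesis
    proof cases
      case 3
      then have "\<gamma> t \<in> interior hexagon"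
        using assms by (auto simp: hexagon_arc_def)
      then show ?thesis
        using interior_subset by blast
    qed (use assms in \<open>auto simp: hexagon_arc_def pathstart_def pathfinish_def frontier_hexagon\<close>)
  qed
  then show "path_image \<gamma> \<subseteq> hexagon"
    by (auto simp: path_image_def)
qed

lemma hexagon_arc_reversepath:
  assumes "hexagon_arc \<gamma>"
  shows "hexagon_arc (reversepath \<gamma>)"
proof -
  have "reversepath \<gamma> ` {0<..<1} \<subseteq> interior hexagon"
    using hexagon_arc_path(3)[OF assms] by (auto simp: reversepath_def image_subset_iff)
  then show ?thesis
    using assms by (simp add: hexagon_arc_def arc_reversepath)
qed

text \<open>Homotopies keep both ends on their open sides, and distinct open sides are disjoint.\<close>

lemma arcs_homotopic_iff_joins:
  assumes "joins d \<alpha>" "hexagon_arc \<alpha>" "hexagon_arc \<beta>"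
  shows "arcs_homotopic \<alpha> \<beta> \<longleftrightarrow> joins d \<beta>"
proof
  have *: "joins d \<gamma>" if "homotopic_with_canon (arc_joins i j) {0..1} hexagon \<alpha> \<gamma>" for i j \<gamma>
  proof -
    have "arc_joins i j \<alpha>" "arc_joins i j \<gamma>"
      using homotopic_with_imp_property[OF that] by auto
    then show ?thesis
      using joins_ends[OF assms(1)] edge_disjoint joins_if_arc_joins
      unfolding arc_joins_def by metis
  qed
  assume "arcs_homotopic \<alpha> \<beta>"
  then show "joins d \<beta>"
    unfolding arcs_homotopic_def using * joins_reversepath by blast
next
  note a = hexagon_arc_path[OF assms(2)] and b = hexagon_arc_path[OF assms(3)]
  have b': "path (reversepath \<beta>)" "path_image (reversepath \<beta>) \<subseteq> hexagon"
    using b by auto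
  assume "joins d \<beta>"
  then show "arcs_homotopic \<alpha> \<beta>"
    using assms(1) homotopic_if_same_ends[OF a(1,2) b(1,2)] homotopic_if_same_ends[OF a(1,2) b']
    unfolding arcs_homotopic_def joins_def by (simp add: arc_joins_def) blast
qed

text \<open>The classes whose ends alternate along the boundary: the ends of \<open>Around s\<close> separate the side
  \<open>s\<close> from the rest, and those of two distinct classes joining opposite sides always alternate.\<close>

definition crossing :: "arc_class \<Rightarrow> arc_class \<Rightarrow> bool" where
  "crossing d e \<longleftrightarrow> (\<exists>s. d = Around s \<and> s \<in> class_ends e) \<or> (\<exists>s. e = Around s \<and> s \<in> class_ends d) \<or>
     (d \<noteq> e \<and> range Around \<inter> {d, e} = {})"

text \<open>After reversing the arcs if necessary, the two sides adjacent to \<open>s\<close> and the ends of the other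
  arc are in the position treated by \<open>paths_cross\<close>.\<close>

lemma around_arc_crosses:
  assumes "hexagon_arc \<alpha>" "hexagon_arc \<beta>" "joins (Around s) \<alpha>" "joins d \<beta>" "s \<in> class_ends d"
  shows "path_image \<alpha> \<inter> path_image \<beta> \<noteq> {}"
proof -
  note a = hexagon_arc_path[OF assms(1)] and b = hexagon_arc_path[OF assms(2)]
  let ?s = "prev_side s"
  obtain f where f: "path f" "path_image f \<subseteq> hexagon" "f ` {0<..<1} \<subseteq> interior hexagon"
    "pathstart f \<in> edge ?s" "pathfinish f \<in> edge (next_side (next_side ?s))" "path_image f = path_image \<alpha>"
  proof (cases "arc_joins ?s (next_side s) \<alpha>")
    case True
    then show ?thesis using that[of \<alpha>] a by (simp add: arc_joins_def)
  next
    case False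
    then have "arc_joins (next_side s) ?s \<alpha>"
      using assms(3) by (simp add: joins_def)
    moreover have "reversepath \<alpha> ` {0<..<1} \<subseteq> interior hexagon"
      using a(3) by (auto simp: reversepath_def image_subset_iff)
    ultimately show ?thesis using that[of "reversepath \<alpha>"] a by (simp add: arc_joins_def)
  qed
  obtain t where t: "class_ends d = {s, t}" "s \<noteq> t" "t \<noteq> next_side s" "t \<noteq> prev_side s"
  proof -
    have "nonadjacent (end1 d) (end2 d)" by (rule class_ends_nonadjacent)
    then show ?thesis
      using assms(5) that[of "end1 d"] that[of "end2 d"] unfolding nonadjacent_def class_ends_def
      by (metis insert_commute insertE next_prev singletonD)
  qed
  obtain g where g: "path g" "path_image g \<subseteq> hexagon" "pathstart g \<in> edge s" "pathfinish g \<in> edge t"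
    "path_image g = path_image \<beta>"
  proof (cases "arc_joins s t \<beta>")
    case True
    then show ?thesis using that[of \<beta>] b by (simp add: arc_joins_def)
  next
    case False
    then have "arc_joins t s \<beta>"
      using assms(4) t unfolding joins_def class_ends_def by (auto simp: doubleton_eq_iff)
    then show ?thesis using that[of "reversepath \<beta>"] b by (simp add: arc_joins_def)
  qed
  have "t = next_side (next_side (next_side ?s)) \<or> t = next_side (next_side (next_side (next_side ?s))) \<or>
      t = prev_side ?s"
    using t(2-4) by (cases s; cases t) simp_all
  moreover have "pathfinish f \<notin> edge (next_side (next_side (next_side ?s)))"
    using f(5) edge_disjoint[OF f(5)] by (cases s) fastforce+
  ultimately have "path_image f \<inter> path_image g \<noteq> {}"
    using f g by (intro paths_cross[of f g ?s]) auto
  then show ?thesis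
    using f g by simp
qed

lemma across_arcs_cross:
  assumes "hexagon_arc \<alpha>" "hexagon_arc \<beta>" "arc_joins s (next_side (next_side (next_side s))) \<alpha>"
    "arc_joins (next_side s) (next_side (next_side (next_side (next_side s)))) \<beta> \<or>
     arc_joins (next_side (next_side (next_side (next_side s)))) (next_side s) \<beta>"
  shows "path_image \<alpha> \<inter> path_image \<beta> \<noteq> {}"
proof -
  note a = hexagon_arc_path[OF assms(1)] and b = hexagon_arc_path[OF assms(2)]
  obtain g where g: "path g" "path_image g \<subseteq> hexagon" "pathstart g \<in> edge (next_side s)"
    "pathfinish g \<in> edge (next_side (next_side (next_side (next_side s))))" "path_image g = path_image \<beta>"
    using assms(4) b path_reversepath[of \<beta>] path_image_reversepath[of \<beta>]
      pathstart_reversepath[of \<beta>] pathfinish_reversepath[of \<beta>]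
    unfolding arc_joins_def by metis
  have "path_image \<alpha> \<inter> path_image g \<noteq> {}"
    using a g assms(3) by (intro paths_cross[of \<alpha> g s]) (auto simp: arc_joins_def)
  then show ?thesis using g by simp
qed

theorem crossing_arcs_intersect:
  assumes "hexagon_arc \<alpha>" "hexagon_arc \<beta>" "joins d \<alpha>" "joins e \<beta>" "crossing d e"
  shows "path_image \<alpha> \<inter> path_image \<beta> \<noteq> {}"
proof -
  consider s where "d = Around s" "s \<in> class_ends e" | s where "e = Around s" "s \<in> class_ends d"
    | "d \<noteq> e" "range Around \<inter> {d, e} = {}"
    using assms(5) unfolding crossing_def by blast
  then show ?thesis
  proof cases
    case 1
    then show ?thesis using around_arc_crosses assms by blast
  next
    case 2
    then show ?thesis using around_arc_crosses[of \<beta> \<alpha>] assms by (metis inf_commute)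
  next
    case 3
    have ab: "hexagon_arc \<alpha>" "hexagon_arc \<beta>" "hexagon_arc (reversepath \<alpha>)" "hexagon_arc (reversepath \<beta>)"
      using assms(1,2) hexagon_arc_reversepath by auto
    have "joins d (reversepath \<alpha>)" "joins e (reversepath \<beta>)"
      using assms by auto
    show ?thesis
      using 3 assms(3,4) across_arcs_cross[OF ab(1,2), of "end1 d"] across_arcs_cross[OF ab(3,2), of "end1 d"]
        across_arcs_cross[OF ab(2,1), of "end1 e"] across_arcs_cross[OF ab(4,1), of "end1 e"]
        across_arcs_cross[OF ab(1,2), of "end2 d"] across_arcs_cross[OF ab(3,2), of "end2 d"]
      by (cases d; cases e) (auto simp: joins_def arc_joins_def Int_commute)
  qed
qed

section \<open>Measured foliations as weighted arc classes\<close>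

definition band_class :: "band \<Rightarrow> arc_class" where
  "band_class b = (THE d. joins d (leaf b 0))"

lemma band_class_eq: "joins d (leaf b 0) \<Longrightarrow> band_class b = d"
  unfolding band_class_def using joins_unique by blast

lemma foliated_bandD:
  assumes "foliated_band b" "0 \<le> t" "t \<le> fst b"
  shows "hexagon_arc (leaf b t)" "joins (band_class b) (leaf b t)"
proof -
  obtain i j where ij: "nonadjacent i j" "\<forall>t\<in>{0..fst b}. hexagon_arc (leaf b t) \<and> arc_joins i j (leaf b t)"
    using assms(1) unfolding foliated_band_def by blast
  obtain d where d: "class_ends d = {i, j}"
    using nonadjacent_class[OF ij(1)] .
  have "fst b > 0"
    using assms(1) by (simp add: foliated_band_def)
  have "joins d (leaf b t)" if "t \<in> {0..fst b}" for t
    using ij(2) that joins_if_arc_joins[OF _ d] by blast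
  then have "joins d (leaf b 0)" "joins d (leaf b t)"
    using assms(2,3) \<open>fst b > 0\<close> by auto
  then show "joins (band_class b) (leaf b t)"
    using band_class_eq by blast
  show "hexagon_arc (leaf b t)"
    using ij(2) assms(2,3) by auto
qed

definition weight :: "band set \<Rightarrow> arc_class \<Rightarrow> real" where
  "weight F d = (\<Sum>b | b \<in> F \<and> band_class b = d. fst b)"

text \<open>These are the weightings that come from foliations. Two bands of the same class are not
  allowed, so that the weight of a class is the width of its only band.\<close>

definition admissible :: "(arc_class \<Rightarrow> real) \<Rightarrow> bool" where
  "admissible w \<longleftrightarrow> (\<forall>d. w d \<ge> 0) \<and> (\<exists>d. w d \<noteq> 0) \<and>
     (\<forall>d e. crossing d e \<longrightarrow> w d = 0 \<or> w e = 0)"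

lemma crossing_irrefl: "\<not> crossing d d"
proof
  assume "crossing d d"
  then obtain s where "d = Around s" "s \<in> class_ends d"
    unfolding crossing_def by blast
  then show False
    by (cases s) (auto simp: class_ends_def)
qed

lemma measured_foliationD:
  assumes "measured_foliation F"
  shows "finite F" "F \<noteq> {}" "inj_on band_class F" "\<And>b. b \<in> F \<Longrightarrow> foliated_band b"
    "\<And>b. b \<in> F \<Longrightarrow> fst b > 0"
    "\<And>b b'. b \<in> F \<Longrightarrow> b' \<in> F \<Longrightarrow> \<not> crossing (band_class b) (band_class b')"
proof -
  show *: "finite F" "F \<noteq> {}" "\<And>b. b \<in> F \<Longrightarrow> foliated_band b"
    using assms by (auto simp: measured_foliation_def)
  show pos: "\<And>b. b \<in> F \<Longrightarrow> fst b > 0"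
    using *(3) by (auto simp: foliated_band_def)
  have l0: "hexagon_arc (leaf b 0)" "joins (band_class b) (leaf b 0)" if "b \<in> F" for b
    using foliated_bandD[OF *(3)[OF that], of 0] pos[OF that] by auto
  show "inj_on band_class F"
  proof (rule inj_onI)
    fix b b' assume b: "b \<in> F" "b' \<in> F" "band_class b = band_class b'"
    then have "arcs_homotopic (leaf b 0) (leaf b' 0)"
      using l0 arcs_homotopic_iff_joins by metis
    then show "b = b'"
      using assms b unfolding measured_foliation_def by blast
  qed
  fix b b' assume b: "b \<in> F" "b' \<in> F"
  show "\<not> crossing (band_class b) (band_class b')"
  proof (cases "b = b'")
    case False
    have sub: "path_image (leaf b 0) \<subseteq> band_support b" if "b \<in> F" for b
      using pos[OF that] by (auto simp: path_image_def leaf_def band_support_def)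
    have "band_support b \<inter> band_support b' = {}"
      using assms b False unfolding measured_foliation_def by blast
    then have "path_image (leaf b 0) \<inter> path_image (leaf b' 0) = {}"
      using sub[OF b(1)] sub[OF b(2)] by blast
    then show ?thesis
      using crossing_arcs_intersect l0 b by blast
  qed (simp add: crossing_irrefl)
qed

lemma weight_band:
  assumes "measured_foliation F" "b \<in> F"
  shows "weight F (band_class b) = fst b"
proof -
  have "{b' \<in> F. band_class b' = band_class b} = {b}"
    using measured_foliationD(3)[OF assms(1)] assms(2) by (auto dest: inj_onD)
  then show ?thesis by (simp add: weight_def)
qed

lemma weight_zero: "d \<notin> band_class ` F \<Longrightarrow> weight F d = 0"
  unfolding weight_def by (rule sum.neutral) blast

lemma weight_nonzero_iff:
  assumes "measured_foliation F"
  shows "weight F d \<noteq> 0 \<longleftrightarrow> d \<in> band_class ` F"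
proof (cases "d \<in> band_class ` F")
  case True
  then obtain b where "b \<in> F" "d = band_class b" by blast
  then show ?thesis
    using weight_band[OF assms] measured_foliationD(5)[OF assms, of b] by simp
qed (simp add: weight_zero)

lemma admissible_weight:
  assumes "measured_foliation F"
  shows "admissible (weight F)"
proof -
  have "weight F d \<ge> 0" for d
    unfolding weight_def using measured_foliationD(5)[OF assms] by (intro sum_nonneg) (simp add: less_imp_le)
  moreover have "\<exists>d. weight F d \<noteq> 0"
    using weight_nonzero_iff[OF assms] measured_foliationD(2)[OF assms] by blast
  moreover have "weight F d = 0 \<or> weight F e = 0" if "crossing d e" for d e
    using that weight_nonzero_iff[OF assms, of d] weight_nonzero_iff[OF assms, of e]
      measured_foliationD(6)[OF assms] by blast
  ultimately show ?thesis
    unfolding admissible_def by blast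
qed

lemma bands_homotopic_iff:
  assumes "foliated_band b" "foliated_band b'"
  shows "arcs_homotopic (leaf b 0) (leaf b' 0) \<longleftrightarrow> band_class b = band_class b'"
proof -
  have "fst b \<ge> 0" "fst b' \<ge> 0"
    using assms by (auto simp: foliated_band_def)
  note b = foliated_bandD[OF assms(1) order_refl this(1)] foliated_bandD[OF assms(2) order_refl this(2)]
  have "joins (band_class b) (leaf b' 0) \<longleftrightarrow> band_class b = band_class b'"
    using b(4) joins_unique by metis
  then show ?thesis
    using arcs_homotopic_iff_joins[OF b(2,1,3)] by simp
qed

text \<open>Bands are homotopic exactly if they belong to the same class, so the bijection between the bands
  of equivalent foliations is the one that preserves classes.\<close>

lemma foliation_equiv_iff:
  "(F, G) \<in> foliation_equiv \<longleftrightarrow> measured_foliation F \<and> measured_foliation G \<and> weight F = weight G"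
proof
  assume "(F, G) \<in> foliation_equiv"
  then obtain f where F: "measured_foliation F" and G: "measured_foliation G"
    and f: "bij_betw f F G" "\<And>b. b \<in> F \<Longrightarrow> fst (f b) = fst b"
      "\<And>b. b \<in> F \<Longrightarrow> arcs_homotopic (leaf b 0) (leaf (f b) 0)"
    unfolding foliation_equiv_def mem_Collect_eq prod.case by blast
  have fG: "f b \<in> G" if "b \<in> F" for b
    using f(1) that by (rule bij_betw_apply)
  have cls: "band_class (f b) = band_class b" if "b \<in> F" for b
    using f(3)[OF that] bands_homotopic_iff[OF measured_foliationD(4)[OF F that]
        measured_foliationD(4)[OF G fG[OF that]]] by simp
  have eq: "weight F (band_class b) = weight G (band_class b)" if "b \<in> F" for b
    using weight_band[OF F that] weight_band[OF G fG[OF that]] f(2)[OF that] cls[OF that] by metis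
  have "band_class ` G = band_class ` f ` F"
    using f(1) by (simp add: bij_betw_def)
  also have "\<dots> = band_class ` F"
    unfolding image_image using cls by (rule image_cong[OF refl])
  finally have "weight F d = weight G d" for d
    using eq weight_zero[of d F] weight_zero[of d G] by (cases "d \<in> band_class ` F") auto
  then show "measured_foliation F \<and> measured_foliation G \<and> weight F = weight G"
    using F G by blast
next
  assume *: "measured_foliation F \<and> measured_foliation G \<and> weight F = weight G"
  then have F: "measured_foliation F" and G: "measured_foliation G" and w: "weight F = weight G"
    by simp_all
  have img: "band_class ` F = band_class ` G"
    using weight_nonzero_iff[OF F] weight_nonzero_iff[OF G] unfolding w by (intro set_eqI) simp
  have bG: "bij_betw band_class G (band_class ` G)"
    using measured_foliationD(3)[OF G] by (simp add: bij_betw_def)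
  have bF: "bij_betw band_class F (band_class ` G)"
    using measured_foliationD(3)[OF F] img by (simp add: bij_betw_def)
  define f where "f = the_inv_into G band_class \<circ> band_class"
  have f: "bij_betw f F G"
    unfolding f_def using bij_betw_trans[OF bF bij_betw_the_inv_into[OF bG]] .
  have "fst (f b) = fst b \<and> arcs_homotopic (leaf b 0) (leaf (f b) 0)" if b: "b \<in> F" for b
  proof
    have fG: "f b \<in> G"
      using f b by (rule bij_betw_apply)
    have cls: "band_class (f b) = band_class b"
      unfolding f_def comp_def by (rule f_the_inv_into_f_bij_betw[OF bG]) (use bij_betw_apply[OF bF b] in simp)
    show "fst (f b) = fst b"
      using weight_band[OF F b] weight_band[OF G fG] w cls by simp
    show "arcs_homotopic (leaf b 0) (leaf (f b) 0)"
      using cls bands_homotopic_iff[OF measured_foliationD(4)[OF F b] measured_foliationD(4)[OF G fG]]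
      by simp
  qed
  then show "(F, G) \<in> foliation_equiv"
    unfolding foliation_equiv_def mem_Collect_eq prod.case using F G f by blast
qed

lemma equiv_foliation_equiv: "equiv (Collect measured_foliation) foliation_equiv"
proof (rule equivI)
  show "foliation_equiv \<subseteq> Collect measured_foliation \<times> Collect measured_foliation"
    by (auto simp: foliation_equiv_def)
  show "refl_on (Collect measured_foliation) foliation_equiv"
    unfolding refl_on_def foliation_equiv_iff by blast
  show "sym foliation_equiv"
    unfolding sym_def foliation_equiv_iff by metis
  show "trans foliation_equiv"
    unfolding trans_def foliation_equiv_iff by metis
qed

section \<open>Straight bands\<close>

definition point :: "side \<Rightarrow> real \<Rightarrow> real \<Rightarrow> complex" where
  "point s x y = (x - y) *\<^sub>R corner s + y *\<^sub>R corner (next_side s)"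

lemma height_point [simp]: "height s (point s x y) = x" "height (next_side s) (point s x y) = y"
  by (simp_all add: point_def height_linear height_corner)

text \<open>The chord parallel to the side \<open>s\<close> at depth \<open>v\<close> below it.\<close>

definition chord :: "side \<Rightarrow> real \<Rightarrow> real \<Rightarrow> complex" where
  "chord s v x = point s (1 - v) (x * (1 + v) - v)"

text \<open>A chord from the side \<open>s\<close> to the opposite one; the chords with different \<open>c\<close> are parallel.\<close>

definition diameter_chord :: "side \<Rightarrow> real \<Rightarrow> real \<Rightarrow> complex" where
  "diameter_chord s c x = point s (1 - 2 * x) ((1 - 2 * x + c) / 2)"

lemma hexagon_arcI:
  assumes "path \<gamma>" "inj_on \<gamma> {0..1}" "\<And>x s. 0 < x \<Longrightarrow> x < 1 \<Longrightarrow> height s (\<gamma> x) < 1" "arc_joins i j \<gamma>"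
  shows "hexagon_arc \<gamma>"
  using assms edge_subset(1)
  unfolding hexagon_arc_def arc_def arc_joins_def interior_hexagon by auto

lemma chord_arc:
  assumes "0 < v" "v < 1"
  shows "hexagon_arc (chord s v)" "arc_joins (prev_side s) (next_side s) (chord s v)"
proof -
  show j: "arc_joins (prev_side s) (next_side s) (chord s v)"
    using assms by (simp add: arc_joins_def pathstart_def pathfinish_def edge_eq chord_def)
  show "hexagon_arc (chord s v)"
  proof (rule hexagon_arcI[OF _ _ _ j])
    show "path (chord s v)"
      unfolding path_def chord_def point_def by (intro continuous_intros)
    show "inj_on (chord s v) {0..1}"
    proof (rule inj_onI)
      fix x y assume "chord s v x = chord s v y"
      then have "height (next_side s) (chord s v x) = height (next_side s) (chord s v y)"
        by simp
      then show "x = y"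
        using assms by (simp add: chord_def)
    qed
    fix x t assume x: "0 < x" "x < (1 :: real)"
    define q where "q = x * (1 + v)"
    have "q > 0"
      unfolding q_def using x assms by simp
    moreover have "q < 1 * (1 + v)"
      unfolding q_def using x assms by (intro mult_strict_right_mono) auto
    ultimately have "\<forall>t. height t (chord s v x) < 1"
      unfolding all_side_from[of _ s] chord_def q_def[symmetric] using assms by simp
    then show "height t (chord s v x) < 1" ..
  qed
qed

lemma diameter_chord_arc:
  assumes "0 \<le> c" "c \<le> 1/4"
  shows "hexagon_arc (diameter_chord s c)"
    "arc_joins s (next_side (next_side (next_side s))) (diameter_chord s c)"
proof -
  show j: "arc_joins s (next_side (next_side (next_side s))) (diameter_chord s c)"
    using assms by (simp add: arc_joins_def pathstart_def pathfinish_def edge_eq diameter_chord_def)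
  show "hexagon_arc (diameter_chord s c)"
  proof (rule hexagon_arcI[OF _ _ _ j])
    show "path (diameter_chord s c)"
      unfolding path_def diameter_chord_def point_def by (intro continuous_intros) auto
    show "inj_on (diameter_chord s c) {0..1}"
    proof (rule inj_onI)
      fix x y assume "diameter_chord s c x = diameter_chord s c y"
      then have "height s (diameter_chord s c x) = height s (diameter_chord s c y)"
        by simp
      then show "x = y"
        by (simp add: diameter_chord_def)
    qed
    fix x t assume x: "0 < x" "x < (1 :: real)"
    have "\<forall>t. height t (diameter_chord s c x) < 1"
      unfolding all_side_from[of _ s] using assms x by (simp add: diameter_chord_def field_simps)
    then show "height t (diameter_chord s c x) < 1" ..
  qed
qed

text \<open>As \<open>u\<close> runs through the unit interval the leaves fill a band. The depths between \<open>1/8\<close> and \<open>1/4\<close>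
  of the bands around the sides leave room for a transversal at depth \<open>1/16\<close>, and they are so small that
  bands of non-crossing classes are disjoint.\<close>

primrec straight_leaf :: "arc_class \<Rightarrow> real \<Rightarrow> real \<Rightarrow> complex" where
  "straight_leaf (Around s) u = chord s ((1 + u) / 8)"
| "straight_leaf Across_a u = diameter_chord Side_a (u / 4)"
| "straight_leaf Across_b u = diameter_chord Side_b (u / 4)"
| "straight_leaf Across_c u = diameter_chord Side_c (u / 4)"

lemma straight_leaf_arc:
  assumes "0 \<le> u" "u \<le> 1"
  shows "hexagon_arc (straight_leaf d u)" "arc_joins (end1 d) (end2 d) (straight_leaf d u)"
    "joins d (straight_leaf d u)"
proof -
  show "hexagon_arc (straight_leaf d u)" and j: "arc_joins (end1 d) (end2 d) (straight_leaf d u)"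
    using assms chord_arc[of "(1 + u) / 8"] diameter_chord_arc[of "u / 4" Side_a]
      diameter_chord_arc[of "u / 4" Side_b] diameter_chord_arc[of "u / 4" Side_c]
    by (cases d; simp)+
  show "joins d (straight_leaf d u)"
    using j by (simp add: joins_def)
qed

text \<open>A linear functional that is constant along the straight leaves of a class.\<close>

primrec level :: "arc_class \<Rightarrow> complex \<Rightarrow> real" where
  "level (Around s) z = height s z"
| "level Across_a z = 2 * height Side_C z - height Side_a z"
| "level Across_b z = 2 * height Side_A z - height Side_b z"
| "level Across_c z = 2 * height Side_B z - height Side_c z"

lemma level_straight_leaf:
  "level d (straight_leaf d u x) = (if d \<in> range Around then (7 - u) / 8 else u / 4)"
proof (cases d)
  case Across_a
  then show ?thesis
    using height_point[of Side_a] by (auto simp: diameter_chord_def add_divide_distrib diff_divide_distrib)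
next
  case Across_b
  then show ?thesis
    using height_point[of Side_b] by (auto simp: diameter_chord_def add_divide_distrib diff_divide_distrib)
next
  case Across_c
  then show ?thesis
    using height_point[of Side_c] by (auto simp: diameter_chord_def add_divide_distrib diff_divide_distrib)
qed (simp add: chord_def add_divide_distrib diff_divide_distrib)

lemma inj_straight_leaf:
  assumes "straight_leaf d u x = straight_leaf d u' x'" "0 \<le> u" "0 \<le> u'"
    "x \<in> {0..1}" "x' \<in> {0..1}" "u \<le> 1"
  shows "u = u' \<and> x = x'"
proof
  show u: "u = u'"
    using level_straight_leaf[of d u x] level_straight_leaf[of d u' x'] assms(1) by (auto split: if_splits)
  have "inj_on (straight_leaf d u) {0..1}"
    using straight_leaf_arc(1)[OF assms(2,6)] by (simp add: hexagon_arc_def arc_def)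
  then show "x = x'"
    using assms u by (auto dest: inj_onD)
qed

text \<open>Near the side \<open>s\<close> there are only the straight leaves that end on \<open>s\<close> or cut off \<open>s\<close>. This gives
  both the disjointness of the bands of non-crossing classes and the control over the intersections
  with a transversal parallel to \<open>s\<close>.\<close>

lemma straight_leaf_near_side:
  assumes "z = straight_leaf d u x" "z \<in> hexagon" "0 \<le> u" "u \<le> 1" "height s z \<ge> 3/4" "s \<notin> class_ends d"
  shows "d = Around s"
proof -
  have l: "level d z = (if d \<in> range Around then (7 - u) / 8 else u / 4)"
    using assms(1) level_straight_leaf by simp
  have "height t z \<le> 1" for t
    using assms(2) by (simp add: hexagon_eq)
  from this[of Side_a] this[of Side_b] this[of Side_c] this[of Side_A] this[of Side_B] this[of Side_C]
  have h: "Re z \<le> 1" "Im z - Re z \<le> 1" "- Im z \<le> 1" "- Re z \<le> 1" "Re z - Im z \<le> 1" "Im z \<le> 1"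
    by simp_all
  show ?thesis
  proof (cases d)
    case (Around t)
    then have "height t z \<ge> 3/4"
      using l assms(3,4) by simp
    then show ?thesis
      using assms(5,6) h Around by (cases s; cases t; simp add: class_ends_def)
  next
    case Across_a
    then show ?thesis
      using l assms(3-6) h by (cases s; simp add: class_ends_def image_iff)
  next
    case Across_b
    then show ?thesis
      using l assms(3-6) h by (cases s; simp add: class_ends_def image_iff)
  next
    case Across_c
    then show ?thesis
      using l assms(3-6) h by (cases s; simp add: class_ends_def image_iff)
  qed
qed

text \<open>A leaf that ends on \<open>s\<close> is transverse to the chords parallel to \<open>s\<close>, so its level and the height
  over \<open>s\<close> are independent coordinates.\<close>

lemma straight_leaf_meets_chord_once:
  assumes "s \<in> class_ends d" "level d z = level d z'" "height s z = height s z'"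
  shows "z = z'"
proof (cases d)
  case (Around t)
  then show ?thesis
    using assms by (cases s; cases t; simp add: class_ends_def complex_eq_iff)
qed (use assms in \<open>cases s; simp add: class_ends_def complex_eq_iff\<close>)+

section \<open>Intersection numbers\<close>

definition straight_band :: "(arc_class \<Rightarrow> real) \<Rightarrow> arc_class \<Rightarrow> band" where
  "straight_band w d = (w d, \<lambda>(t, x). straight_leaf d (t / w d) x)"

definition straight_foliation :: "(arc_class \<Rightarrow> real) \<Rightarrow> band set" where
  "straight_foliation w = straight_band w ` {d. w d \<noteq> 0}"

lemma leaf_straight_band [simp]: "leaf (straight_band w d) t = straight_leaf d (t / w d)"
  by (simp add: leaf_def straight_band_def fun_eq_iff)

lemma fst_straight_band [simp]: "fst (straight_band w d) = w d"
  by (simp add: straight_band_def)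

lemma foliated_straight_band:
  assumes "w d > 0"
  shows "foliated_band (straight_band w d)" "band_class (straight_band w d) = d"
proof -
  have u: "0 \<le> t / w d" "t / w d \<le> 1" if "t \<in> {0..w d}" for t
    using that assms by auto
  have "continuous_on ({0..w d} \<times> {0..1}) (\<lambda>p. straight_leaf d (fst p / w d) (snd p))"
    using assms
    by (cases d) (auto simp: chord_def diameter_chord_def point_def intro!: continuous_intros)
  then have cont: "continuous_on ({0..w d} \<times> {0..1}) (snd (straight_band w d))"
    by (simp add: straight_band_def case_prod_unfold)
  have inj: "inj_on (snd (straight_band w d)) ({0..w d} \<times> {0..1})"
  proof (rule inj_onI)
    fix p q assume p: "p \<in> {0..w d} \<times> {0..1}" and q: "q \<in> {0..w d} \<times> {0..1}"
      and eq: "snd (straight_band w d) p = snd (straight_band w d) q"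
    have "straight_leaf d (fst p / w d) (snd p) = straight_leaf d (fst q / w d) (snd q)"
      using eq by (simp add: straight_band_def case_prod_unfold)
    then have "fst p / w d = fst q / w d \<and> snd p = snd q"
      using p q u by (intro inj_straight_leaf) auto
    then show "p = q"
      using assms by (simp add: prod_eq_iff)
  qed
  show "foliated_band (straight_band w d)"
    unfolding foliated_band_def fst_straight_band leaf_straight_band
    using assms cont inj u straight_leaf_arc class_ends_nonadjacent[of d] by blast
  show "band_class (straight_band w d) = d"
    using straight_leaf_arc(3)[of 0 d] by (intro band_class_eq) simp
qed

lemma straight_leaves_disjoint:
  assumes "d \<noteq> e" "\<not> crossing d e" "0 \<le> u" "u \<le> 1" "0 \<le> v" "v \<le> 1" "x \<in> {0..1}" "y \<in> {0..1}"
  shows "straight_leaf d u x \<noteq> straight_leaf e v y"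
proof
  assume eq: "straight_leaf d u x = straight_leaf e v y"
  define z where "z = straight_leaf d u x"
  have zd: "z = straight_leaf d u x" and ze: "z = straight_leaf e v y"
    using eq by (simp_all add: z_def)
  have z: "z \<in> hexagon"
    using hexagon_arc_path(2)[OF straight_leaf_arc(1)[OF assms(3,4), of d]] assms(7)
    by (auto simp: path_image_def zd)
  consider s where "d = Around s" | s where "e = Around s" | "range Around \<inter> {d, e} = {}"
    by blast
  then show False
  proof cases
    case 1
    then have "height s z \<ge> 3/4"
      using level_straight_leaf[of d u x] assms(4) by (simp add: zd)
    then show False
      using straight_leaf_near_side[OF ze z assms(5,6)] 1 assms(1,2) unfolding crossing_def by blast
  next
    case 2
    then have "height s z \<ge> 3/4"
      using level_straight_leaf[of e v y] assms(6) by (simp add: ze)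
    then show False
      using straight_leaf_near_side[OF zd z assms(3,4)] 2 assms(1,2) unfolding crossing_def by blast
  next
    case 3
    then show False
      using assms(1,2) unfolding crossing_def by blast
  qed
qed

lemma straight_foliation:
  assumes "admissible w"
  shows "measured_foliation (straight_foliation w)" "weight (straight_foliation w) = w"
proof -
  have pos: "w d > 0" if "w d \<noteq> 0" for d
    using assms that unfolding admissible_def by (metis order_le_less)
  show m: "measured_foliation (straight_foliation w)"
    unfolding measured_foliation_def
  proof (intro conjI ballI impI)
    show "finite (straight_foliation w)" "straight_foliation w \<noteq> {}"
      using assms by (auto simp: straight_foliation_def admissible_def)
    fix b assume "b \<in> straight_foliation w"
    then obtain d where d: "b = straight_band w d" "w d \<noteq> 0"
      by (auto simp: straight_foliation_def)
    show b: "foliated_band b"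
      using foliated_straight_band(1) pos d by blast
    fix b' assume "b' \<in> straight_foliation w" and ne: "b \<noteq> b'"
    then obtain e where e: "b' = straight_band w e" "w e \<noteq> 0"
      by (auto simp: straight_foliation_def)
    have de: "d \<noteq> e"
      using ne d e by blast
    have "\<not> crossing d e"
      using assms d e unfolding admissible_def by blast
    then show "band_support b \<inter> band_support b' = {}"
      using straight_leaves_disjoint[OF de] pos[OF d(2)] pos[OF e(2)]
      by (auto simp: band_support_def d e straight_band_def)
    show "\<not> arcs_homotopic (leaf b 0) (leaf b' 0)"
      using de d e pos foliated_straight_band bands_homotopic_iff by metis
  qed
  show "weight (straight_foliation w) = w"
  proof
    fix d
    show "weight (straight_foliation w) d = w d"
    proof (cases "w d = 0")
      case True
      then have "d \<notin> band_class ` straight_foliation w"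
        using foliated_straight_band(2) pos by (auto simp: straight_foliation_def)
      then show ?thesis
        using True weight_zero by simp
    next
      case False
      then have "straight_band w d \<in> straight_foliation w"
        by (simp add: straight_foliation_def)
      from weight_band[OF m this] show ?thesis
        using foliated_straight_band(2)[of w d, OF pos[OF False]] by simp
    qed
  qed
qed

definition side_sum :: "(arc_class \<Rightarrow> real) \<Rightarrow> side \<Rightarrow> real" where
  "side_sum w s = (\<Sum>d | s \<in> class_ends d. w d)"

lemma sum_bands_ending_on_side:
  assumes "measured_foliation F"
  shows "(\<Sum>b\<in>F. if s \<in> class_ends (band_class b) then ennreal (fst b) else 0) = ennreal (side_sum (weight F) s)"
proof -
  let ?S = "{b \<in> F. s \<in> class_ends (band_class b)}"
  have fin: "finite F" and pos: "\<And>b. b \<in> F \<Longrightarrow> fst b > 0"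
    using measured_foliationD[OF assms] by auto
  have "side_sum (weight F) s = (\<Sum>d | s \<in> class_ends d. \<Sum>b | b \<in> ?S \<and> band_class b = d. fst b)"
    unfolding side_sum_def weight_def by (intro sum.cong refl arg_cong[where f = "sum fst"]) auto
  also have "\<dots> = (\<Sum>b\<in>?S. fst b)"
    using fin by (intro sum.group) auto
  finally have "side_sum (weight F) s = (\<Sum>b\<in>?S. fst b)" .
  moreover have "(\<Sum>b\<in>?S. ennreal (fst b)) = ennreal (\<Sum>b\<in>?S. fst b)"
    using pos by (intro sum_ennreal) (auto intro: less_imp_le)
  moreover have "(\<Sum>b\<in>F. if s \<in> class_ends (band_class b) then ennreal (fst b) else 0) = (\<Sum>b\<in>?S. ennreal (fst b))"
    using fin by (simp add: sum.inter_filter)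
  ultimately show ?thesis by simp
qed

lemma parallel_arc_eq_chord: "parallel_arc s = chord s (1/2)"
proof
  fix x
  show "parallel_arc s x = chord s (1/2) x"
    by (cases s) (simp_all add: parallel_arc_def chord_def point_def linepath_def midpoint_def
      complex_eq_iff field_simps)
qed

lemma arcs_homotopic_parallel_arc:
  assumes "hexagon_arc \<delta>"
  shows "arcs_homotopic (parallel_arc s) \<delta> \<longleftrightarrow> joins (Around s) \<delta>"
proof -
  have "hexagon_arc (parallel_arc s)" "joins (Around s) (parallel_arc s)"
    using chord_arc[of "1/2" s] by (simp_all add: parallel_arc_eq_chord joins_def)
  then show ?thesis
    using arcs_homotopic_iff_joins assms by blast
qed

text \<open>An arc around \<open>s\<close> separates \<open>s\<close> from the sides that are not adjacent to it, so it crosses every leaf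
  that ends on \<open>s\<close>.\<close>

lemma transverse_measure_ge:
  assumes F: "measured_foliation F" and \<delta>: "hexagon_arc \<delta>" "joins (Around s) \<delta>"
  shows "ennreal (side_sum (weight F) s) \<le> transverse_measure F \<delta>"
  unfolding transverse_measure_def sum_bands_ending_on_side[OF F, symmetric]
proof (rule sum_mono)
  fix b assume b: "b \<in> F"
  let ?f = "\<lambda>t. emeasure (count_space UNIV) (path_image \<delta> \<inter> path_image (leaf b t))"
  show "(if s \<in> class_ends (band_class b) then ennreal (fst b) else 0) \<le> (\<integral>\<^sup>+t\<in>{0..fst b}. ?f t \<partial>lborel)"
  proof (cases "s \<in> class_ends (band_class b)")
    case True
    have "1 \<le> ?f t" if "t \<in> {0..fst b}" for t
    proof -
      have "path_image \<delta> \<inter> path_image (leaf b t) \<noteq> {}"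
      proof (rule crossing_arcs_intersect[OF \<delta>(1) _ \<delta>(2)])
        show "hexagon_arc (leaf b t)" "joins (band_class b) (leaf b t)"
          using foliated_bandD[OF measured_foliationD(4)[OF F b]] that by auto
        show "crossing (Around s) (band_class b)"
          using True by (auto simp: crossing_def)
      qed
      then obtain z where "z \<in> path_image \<delta> \<inter> path_image (leaf b t)" by blast
      then have "emeasure (count_space UNIV) {z} \<le> ?f t"
        by (intro emeasure_mono) auto
      then show ?thesis by simp
    qed
    then have "(\<integral>\<^sup>+t. indicator {0..fst b} t \<partial>lborel) \<le> (\<integral>\<^sup>+t\<in>{0..fst b}. ?f t \<partial>lborel)"
      by (intro nn_integral_mono) (auto simp: indicator_def)
    moreover have "(\<integral>\<^sup>+t. indicator {0..fst b} t \<partial>lborel) = ennreal (fst b)"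
      using measured_foliationD(5)[OF F b] by (simp add: less_imp_le)
    ultimately show ?thesis
      using True by simp
  qed simp
qed

lemma chord_meets_straight_leaf:
  assumes "0 \<le> u" "u \<le> 1"
  shows "emeasure (count_space UNIV) (path_image (chord s (1/16)) \<inter> path_image (straight_leaf d u))
    \<le> (if s \<in> class_ends d then 1 else 0)"
proof -
  let ?A = "path_image (chord s (1/16)) \<inter> path_image (straight_leaf d u)"
  have h: "height s z = 15/16" if "z \<in> ?A" for z
  proof -
    have "height s (chord s (1/16) x) = 15/16" for x
      by (simp add: chord_def)
    then show ?thesis
      using that unfolding path_image_def by blast
  qed
  have l: "level d z = (if d \<in> range Around then (7 - u) / 8 else u / 4)" if zA: "z \<in> ?A" for z
  proof -
    obtain x where "z = straight_leaf d u x"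
      using zA unfolding path_image_def by blast
    then show ?thesis
      by (simp only: level_straight_leaf)
  qed
  show ?thesis
  proof (cases "s \<in> class_ends d")
    case True
    have "z = z'" if "z \<in> ?A" "z' \<in> ?A" for z z'
      using straight_leaf_meets_chord_once[OF True] h l that by metis
    then consider "?A = {}" | z where "?A = {z}"
      by blast
    then have "emeasure (count_space UNIV) ?A \<le> 1"
      by cases simp_all
    then show ?thesis
      using True by simp
  next
    case False
    have "?A = {}"
    proof (rule ccontr)
      assume "?A \<noteq> {}"
      then obtain z where z: "z \<in> ?A" by blast
      then obtain x where x: "z = straight_leaf d u x"
        by (auto simp: path_image_def)
      have "z \<in> hexagon"
        using z hexagon_arc_path(2)[OF straight_leaf_arc(1)[OF assms]] by blast
      then have d: "d = Around s"
        using straight_leaf_near_side[OF x _ assms _ False] h[OF z] by simp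
      then show False
        using h[OF z] l[OF z] assms(1) by simp
    qed
    then show ?thesis by simp
  qed
qed

text \<open>The lower bound is attained: the transversal meets each straight leaf that ends on \<open>s\<close> once and
  no other leaf.\<close>

lemma transverse_measure_straight_foliation:
  assumes "admissible w"
  shows "transverse_measure (straight_foliation w) (chord s (1/16)) \<le> ennreal (side_sum w s)"
proof -
  note F = straight_foliation[OF assms]
  have "transverse_measure (straight_foliation w) (chord s (1/16)) \<le>
      (\<Sum>b\<in>straight_foliation w. if s \<in> class_ends (band_class b) then ennreal (fst b) else 0)"
    unfolding transverse_measure_def
  proof (rule sum_mono)
    fix b assume b: "b \<in> straight_foliation w"
    then obtain d where d: "b = straight_band w d"
      by (auto simp: straight_foliation_def)
    have pos: "w d > 0"
      using measured_foliationD(5)[OF F(1) b] d by simp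
    have cls: "band_class b = d"
      using foliated_straight_band(2)[of w d, OF pos] d by simp
    let ?c = "if s \<in> class_ends d then 1 else 0 :: ennreal"
    have "(\<integral>\<^sup>+t\<in>{0..fst b}. emeasure (count_space UNIV) (path_image (chord s (1/16)) \<inter> path_image (leaf b t)) \<partial>lborel)
      \<le> (\<integral>\<^sup>+t. ?c * indicator {0..fst b} t \<partial>lborel)"
    proof (rule nn_integral_mono)
      fix t
      show "emeasure (count_space UNIV) (path_image (chord s (1/16)) \<inter> path_image (leaf b t)) * indicator {0..fst b} t
          \<le> ?c * indicator {0..fst b} t"
      proof (cases "t \<in> {0..fst b}")
        case True
        then have "0 \<le> t / w d" "t / w d \<le> 1"
          using pos d by auto
        from chord_meets_straight_leaf[OF this, of s d] show ?thesis
          by (intro mult_right_mono) (simp_all add: d)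
      qed simp
    qed
    also have "\<dots> = ?c * ennreal (fst b)"
      using pos d by (simp add: nn_integral_cmult)
    finally show "(\<integral>\<^sup>+t\<in>{0..fst b}. emeasure (count_space UNIV)
        (path_image (chord s (1/16)) \<inter> path_image (leaf b t)) \<partial>lborel)
      \<le> (if s \<in> class_ends (band_class b) then ennreal (fst b) else 0)"
      by (simp add: cls split: if_splits)
  qed
  then show ?thesis
    using sum_bands_ending_on_side[OF F(1)] F(2) by simp
qed

lemma intersection_number_class:
  assumes F: "measured_foliation F"
  shows "intersection_number (foliation_equiv `` {F}) (parallel_arc s) = ennreal (side_sum (weight F) s)"
proof (rule antisym)
  note G = straight_foliation[OF admissible_weight[OF F]]
  have "straight_foliation (weight F) \<in> foliation_equiv `` {F}"
    using G F by (simp add: foliation_equiv_iff)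
  moreover have "hexagon_arc (chord s (1/16))" "arcs_homotopic (parallel_arc s) (chord s (1/16))"
    using chord_arc[of "1/16" s] arcs_homotopic_parallel_arc by (simp_all add: joins_def)
  ultimately show "intersection_number (foliation_equiv `` {F}) (parallel_arc s) \<le> ennreal (side_sum (weight F) s)"
    unfolding intersection_number_def
    by (intro INF_lower2[where i = "straight_foliation (weight F)"] INF_lower2[where i = "chord s (1/16)"])
      (auto intro: transverse_measure_straight_foliation admissible_weight F)
  show "ennreal (side_sum (weight F) s) \<le> intersection_number (foliation_equiv `` {F}) (parallel_arc s)"
    unfolding intersection_number_def
  proof (intro INF_greatest)
    fix G \<delta> assume "G \<in> foliation_equiv `` {F}" "\<delta> \<in> {\<delta>'. hexagon_arc \<delta>' \<and> arcs_homotopic (parallel_arc s) \<delta>'}"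
    then have "measured_foliation G" "weight F = weight G" "hexagon_arc \<delta>"
      and "arcs_homotopic (parallel_arc s) \<delta>"
      by (simp_all add: foliation_equiv_iff)
    moreover from this(3,4) have "joins (Around s) \<delta>"
      using arcs_homotopic_parallel_arc by blast
    ultimately show "ennreal (side_sum (weight F) s) \<le> transverse_measure G \<delta>"
      using transverse_measure_ge by simp
  qed
qed

definition intersection_vector :: "(arc_class \<Rightarrow> real) \<Rightarrow> real ^ side" where
  "intersection_vector w = (\<chi> s. side_sum w s)"

lemma i_star_class:
  assumes "measured_foliation F"
  shows "i_star (foliation_equiv `` {F}) = intersection_vector (weight F)"
proof -
  have "side_sum (weight F) s \<ge> 0" for s
    using admissible_weight[OF assms] unfolding side_sum_def admissible_def by (intro sum_nonneg) blast
  then show ?thesis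
    by (simp add: i_star_def intersection_vector_def intersection_number_class[OF assms] vec_eq_iff)
qed

lemma MF_cases:
  assumes "X \<in> MF"
  obtains F where "measured_foliation F" "X = foliation_equiv `` {F}"
  using assms by (auto simp: MF_def quotient_def)

lemma class_in_MF: "measured_foliation F \<Longrightarrow> foliation_equiv `` {F} \<in> MF"
  by (auto simp: MF_def quotient_def)

lemma i_star_image: "i_star ` MF = intersection_vector ` Collect admissible"
proof (intro equalityI subsetI)
  fix v assume "v \<in> i_star ` MF"
  then obtain X where X: "X \<in> MF" "v = i_star X" by blast
  obtain F where "measured_foliation F" "X = foliation_equiv `` {F}"
    using MF_cases[OF X(1)] .
  then show "v \<in> intersection_vector ` Collect admissible"
    using X(2) i_star_class admissible_weight by auto
next
  fix v assume "v \<in> intersection_vector ` Collect admissible"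
  then obtain w where w: "admissible w" "v = intersection_vector w" by blast
  then have "v = i_star (foliation_equiv `` {straight_foliation w})"
    using straight_foliation[OF w(1)] i_star_class by simp
  then show "v \<in> i_star ` MF"
    using class_in_MF straight_foliation[OF w(1)] by blast
qed

lemma scale_band:
  assumes "c > 0" "foliated_band b"
  shows "foliated_band (scale_band c b)" "band_class (scale_band c b) = band_class b"
    "fst (scale_band c b) = c * fst b" "band_support (scale_band c b) = band_support b"
    "leaf (scale_band c b) 0 = leaf b 0"
proof -
  have sb: "snd (scale_band c b) = snd b \<circ> map_prod (\<lambda>t. t / c) id"
    by (auto simp: scale_band_def fun_eq_iff)
  have img: "map_prod (\<lambda>t. t / c) id ` ({0..c * fst b} \<times> {0..1}) = {0..fst b} \<times> {0..1 :: real}"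
  proof -
    have "(\<lambda>t. t / c) ` {0..c * fst b} = {0..fst b}"
      using assms(1) image_divide_atLeastAtMost[of c 0 "c * fst b"] by simp
    then show ?thesis
      by (simp add: map_prod_surj_on)
  qed
  have l: "leaf (scale_band c b) t = leaf b (t / c)" for t
    by (simp add: leaf_def scale_band_def)
  show f: "fst (scale_band c b) = c * fst b"
    by (simp add: scale_band_def)
  show "leaf (scale_band c b) 0 = leaf b 0"
    by (simp add: l)
  then show "band_class (scale_band c b) = band_class b"
    by (simp add: band_class_def)
  show "band_support (scale_band c b) = band_support b"
    unfolding band_support_def f sb image_comp[symmetric] img ..
  have b: "fst b > 0" "continuous_on ({0..fst b} \<times> {0..1}) (snd b)" "inj_on (snd b) ({0..fst b} \<times> {0..1})"
    "\<exists>i j. nonadjacent i j \<and> (\<forall>t\<in>{0..fst b}. hexagon_arc (leaf b t) \<and> arc_joins i j (leaf b t))"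
    using assms(2) unfolding foliated_band_def by blast+
  have tc: "t / c \<in> {0..fst b}" if "t \<in> {0..c * fst b}" for t
    using that assms(1) by (auto simp: field_simps)
  show "foliated_band (scale_band c b)"
    unfolding foliated_band_def f sb l
  proof (intro conjI)
    show "0 < c * fst b"
      using assms b by simp
    have "continuous_on ({0..c * fst b} \<times> {0..1}) (map_prod (\<lambda>t. t / c) (id :: real \<Rightarrow> real))"
      using assms(1) unfolding map_prod_def case_prod_unfold by (auto intro!: continuous_intros)
    then show "continuous_on ({0..c * fst b} \<times> {0..1}) (snd b \<circ> map_prod (\<lambda>t. t / c) id)"
      using b(2) by (intro continuous_on_compose) (simp_all only: img)
    have "inj (map_prod (\<lambda>t. t / c) (id :: real \<Rightarrow> real))"
      using assms(1) by (auto simp: inj_def)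
    then show "inj_on (snd b \<circ> map_prod (\<lambda>t. t / c) id) ({0..c * fst b} \<times> {0..1})"
      using b(3) by (intro comp_inj_on) (simp_all only: img, blast intro: inj_on_subset)
    show "\<exists>i j. nonadjacent i j \<and>
        (\<forall>t\<in>{0..c * fst b}. hexagon_arc (leaf b (t / c)) \<and> arc_joins i j (leaf b (t / c)))"
      using b(4) tc by blast
  qed
qed

lemma scale_foliation:
  assumes "c > 0" "measured_foliation F"
  shows "measured_foliation (scale_band c ` F)" "weight (scale_band c ` F) = (\<lambda>d. c * weight F d)"
proof -
  note F = measured_foliationD[OF assms(2)]
  note sc = scale_band[OF assms(1) F(4)]
  show m: "measured_foliation (scale_band c ` F)"
    unfolding measured_foliation_def
  proof (intro conjI ballI impI)
    show "finite (scale_band c ` F)" "scale_band c ` F \<noteq> {}"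
      using F(1,2) by auto
    fix x assume "x \<in> scale_band c ` F"
    then obtain b where b: "b \<in> F" "x = scale_band c b" by blast
    then show "foliated_band x"
      using sc(1) by blast
    fix y assume "y \<in> scale_band c ` F" and "x \<noteq> y"
    then obtain b' where b': "b' \<in> F" "y = scale_band c b'" "b \<noteq> b'"
      using b by blast
    then have "band_support b \<inter> band_support b' = {}" "\<not> arcs_homotopic (leaf b 0) (leaf b' 0)"
      using assms(2) b(1) unfolding measured_foliation_def by blast+
    then show "band_support x \<inter> band_support y = {}" "\<not> arcs_homotopic (leaf x 0) (leaf y 0)"
      using sc(4,5) b b' by simp_all
  qed
  show "weight (scale_band c ` F) = (\<lambda>d. c * weight F d)"
  proof
    fix d
    show "weight (scale_band c ` F) d = c * weight F d"
    proof (cases "d \<in> band_class ` F")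
      case True
      then obtain b where b: "b \<in> F" "d = band_class b" by blast
      then show ?thesis
        using weight_band[OF m, of "scale_band c b"] weight_band[OF assms(2) b(1)] by (simp add: sc)
    next
      case False
      then have "d \<notin> band_class ` scale_band c ` F"
        by (auto simp: sc)
      then show ?thesis
        using False weight_zero by simp
    qed
  qed
qed

section \<open>Tropical coordinates of measured foliations\<close>

definition ppart :: "real \<Rightarrow> real" where "ppart t = max t 0"
definition npart :: "real \<Rightarrow> real" where "npart t = max (- t) 0"

lemma ppart_npart: "ppart t \<ge> 0" "npart t \<ge> 0" "ppart t - npart t = t" "ppart t = 0 \<or> npart t = 0" "t \<le> ppart t"
  by (auto simp: ppart_def npart_def max_def)

text \<open>The intersection numbers of a foliation in the coordinates \<open>y\<close> in which the hexagons have
  \<open>y\<^sub>i\<close> equal to \<open>ln (sinh a)\<close>, \<open>ln (sinh b)\<close>, \<open>ln (sinh c)\<close>. A positive coordinate is the intersection number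
  with the side; a negative one is minus the weight of the class around the side, which excludes all
  arcs that end on the side.\<close>

definition tropical_lengths :: "real ^ 3 \<Rightarrow> real ^ side" where
  "tropical_lengths y = (\<chi> s. rec_side
     (ppart (y$1)) (npart (y$1) + npart (y$2) + ppart (ppart (y$3) - ppart (y$1) - ppart (y$2)))
     (ppart (y$2)) (npart (y$2) + npart (y$3) + ppart (ppart (y$1) - ppart (y$2) - ppart (y$3)))
     (ppart (y$3)) (npart (y$3) + npart (y$1) + ppart (ppart (y$2) - ppart (y$3) - ppart (y$1))) s)"

lemma tropical_lengths_nth [simp]:
  "tropical_lengths y $ Side_a = ppart (y$1)" "tropical_lengths y $ Side_b = ppart (y$2)"
  "tropical_lengths y $ Side_c = ppart (y$3)"
  "tropical_lengths y $ Side_A = npart (y$2) + npart (y$3) + ppart (ppart (y$1) - ppart (y$2) - ppart (y$3))"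
  "tropical_lengths y $ Side_B = npart (y$3) + npart (y$1) + ppart (ppart (y$2) - ppart (y$3) - ppart (y$1))"
  "tropical_lengths y $ Side_C = npart (y$1) + npart (y$2) + ppart (ppart (y$3) - ppart (y$1) - ppart (y$2))"
  by (simp_all add: tropical_lengths_def)

lemma tropical_lengths_nonneg: "tropical_lengths y $ s \<ge> 0"
  using ppart_npart by (cases s) auto

text \<open>Every non-crossing family contains or admits an arc around some side, and then no arc ends on
  this side.\<close>

lemma tropical_lengths_zero_coordinate: "\<exists>s. tropical_lengths y $ s = 0"
proof -
  have "tropical_lengths y $ Side_a = 0 \<or> tropical_lengths y $ Side_b = 0 \<or>
      tropical_lengths y $ Side_c = 0 \<or> tropical_lengths y $ Side_A = 0 \<or> tropical_lengths y $ Side_B = 0"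
    by (simp add: ppart_def npart_def max_def)
  then show ?thesis by blast
qed

lemma tropical_lengths_scale:
  assumes "c \<ge> 0"
  shows "tropical_lengths (c *\<^sub>R y) = c *\<^sub>R tropical_lengths y"
proof -
  have ppart: "ppart (c * t) = c * ppart t" and npart: "npart (c * t) = c * npart t" for t
    using assms max_mult_distrib_left[of c t 0] max_mult_distrib_left[of c "- t" 0]
    by (simp_all add: ppart_def npart_def)
  have *: "c * x - c * y - c * z = c * (x - y - z)" for x y z
    by (simp add: algebra_simps)
  show ?thesis
    unfolding vec_eq_iff_side by (simp add: ppart npart * distrib_left)
qed

lemma tropical_lengths_0 [simp]: "tropical_lengths 0 = 0"
  using tropical_lengths_scale[of 0 0] by simp

lemma inj_tropical_lengths: "inj tropical_lengths"
proof (rule injI)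
  fix x y assume eq: "tropical_lengths x = tropical_lengths y"
  have p: "ppart (x$1) = ppart (y$1)" "ppart (x$2) = ppart (y$2)" "ppart (x$3) = ppart (y$3)"
    using eq unfolding vec_eq_iff_side by simp_all
  then have n: "npart (x$2) + npart (x$3) = npart (y$2) + npart (y$3)" "npart (x$3) + npart (x$1) = npart (y$3) + npart (y$1)"
    "npart (x$1) + npart (x$2) = npart (y$1) + npart (y$2)"
    using eq unfolding vec_eq_iff_side by simp_all
  have "x$1 = y$1" "x$2 = y$2" "x$3 = y$3"
    using p n ppart_npart(3)[of "x$1"] ppart_npart(3)[of "x$2"] ppart_npart(3)[of "x$3"]
      ppart_npart(3)[of "y$1"] ppart_npart(3)[of "y$2"] ppart_npart(3)[of "y$3"] by linarith+
  then show "x = y"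
    by (simp add: vec_eq_iff forall_3)
qed

lemma continuous_on_tropical_lengths: "continuous_on S tropical_lengths"
proof -
  have "continuous_on S (\<lambda>y. tropical_lengths y $ s)" for s
    by (cases s) (auto simp: ppart_def npart_def intro!: continuous_intros)
  then have "continuous_on S (\<lambda>y. \<chi> s. tropical_lengths y $ s)"
    by (rule continuous_on_vec_lambda)
  then show ?thesis by simp
qed

lemma ends_on_side:
  "{d. Side_a \<in> class_ends d} = {Around Side_C, Around Side_B, Across_a}"
  "{d. Side_b \<in> class_ends d} = {Around Side_C, Around Side_A, Across_b}"
  "{d. Side_c \<in> class_ends d} = {Around Side_B, Around Side_A, Across_c}"
  "{d. Side_A \<in> class_ends d} = {Around Side_c, Around Side_b, Across_a}"
  "{d. Side_B \<in> class_ends d} = {Around Side_c, Around Side_a, Across_b}"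
  "{d. Side_C \<in> class_ends d} = {Around Side_b, Around Side_a, Across_c}"
proof -
  have "(s \<in> class_ends (Around t)) = (t = next_side s \<or> t = prev_side s)" for s t
    by (cases s; cases t) (simp_all add: class_ends_def)
  moreover have "Side_a \<in> class_ends Across_a" "Side_A \<in> class_ends Across_a"
    "Side_b \<in> class_ends Across_b" "Side_B \<in> class_ends Across_b"
    "Side_c \<in> class_ends Across_c" "Side_C \<in> class_ends Across_c"
    by (simp_all add: class_ends_def)
  moreover have "class_ends Across_a = {Side_a, Side_A}" "class_ends Across_b = {Side_b, Side_B}"
    "class_ends Across_c = {Side_c, Side_C}"
    by (simp_all add: class_ends_def)
  ultimately have *: "s \<in> class_ends d \<longleftrightarrow> d = Around (next_side s) \<or> d = Around (prev_side s) \<or>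
      d = Across_a \<and> s \<in> {Side_a, Side_A} \<or> d = Across_b \<and> s \<in> {Side_b, Side_B} \<or>
      d = Across_c \<and> s \<in> {Side_c, Side_C}" for s d
    by (cases d) auto
  show "{d. Side_a \<in> class_ends d} = {Around Side_C, Around Side_B, Across_a}"
    "{d. Side_b \<in> class_ends d} = {Around Side_C, Around Side_A, Across_b}"
    "{d. Side_c \<in> class_ends d} = {Around Side_B, Around Side_A, Across_c}"
    "{d. Side_A \<in> class_ends d} = {Around Side_c, Around Side_b, Across_a}"
    "{d. Side_B \<in> class_ends d} = {Around Side_c, Around Side_a, Across_b}"
    "{d. Side_C \<in> class_ends d} = {Around Side_b, Around Side_a, Across_c}"
    unfolding * by auto
qed

lemma side_sum_eqs:
  "side_sum w Side_a = w (Around Side_C) + w (Around Side_B) + w Across_a"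
  "side_sum w Side_b = w (Around Side_C) + w (Around Side_A) + w Across_b"
  "side_sum w Side_c = w (Around Side_B) + w (Around Side_A) + w Across_c"
  "side_sum w Side_A = w (Around Side_c) + w (Around Side_b) + w Across_a"
  "side_sum w Side_B = w (Around Side_c) + w (Around Side_a) + w Across_b"
  "side_sum w Side_C = w (Around Side_b) + w (Around Side_a) + w Across_c"
  unfolding side_sum_def ends_on_side by simp_all

text \<open>A positive weight around \<open>s\<close> excludes precisely the classes that end on \<open>s\<close>.\<close>

lemma admissible_iff:
  "admissible w \<longleftrightarrow> (\<forall>d. w d \<ge> 0) \<and> (\<exists>d. w d \<noteq> 0) \<and> (\<forall>s. w (Around s) = 0 \<or> side_sum w s = 0) \<and>
     (w Across_a = 0 \<or> w Across_b = 0) \<and> (w Across_b = 0 \<or> w Across_c = 0) \<and>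
     (w Across_a = 0 \<or> w Across_c = 0)" (is "_ \<longleftrightarrow> ?R")
proof
  assume w: "admissible w"
  have nn: "w d \<ge> 0" for d
    using w by (simp add: admissible_def)
  have x: "w d = 0 \<or> w e = 0" if "crossing d e" for d e
    using w that by (simp add: admissible_def)
  have "w (Around s) = 0 \<or> side_sum w s = 0" for s
  proof (cases "w (Around s) = 0")
    case False
    have "w d = 0" if "s \<in> class_ends d" for d
      using x[of "Around s" d] False that by (auto simp: crossing_def)
    then show ?thesis
      by (simp add: side_sum_def)
  qed simp
  moreover have "crossing Across_a Across_b" "crossing Across_b Across_c" "crossing Across_a Across_c"
    by (auto simp: crossing_def)
  ultimately show ?R
    using w x nn unfolding admissible_def by blast
next
  assume R: ?R
  have around: "w (Around s) = 0 \<or> w d = 0" if "s \<in> class_ends d" for s d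
  proof (cases "w (Around s) = 0")
    case False
    then have "side_sum w s = 0"
      using R by blast
    then show ?thesis
      unfolding side_sum_def using R that by (subst (asm) sum_nonneg_eq_0_iff) auto
  qed simp
  have "w d = 0 \<or> w e = 0" if "crossing d e" for d e
  proof -
    consider s where "d = Around s" "s \<in> class_ends e" | s where "e = Around s" "s \<in> class_ends d"
      | "d \<noteq> e" "range Around \<inter> {d, e} = {}"
      using \<open>crossing d e\<close> unfolding crossing_def by blast
    then show ?thesis
    proof cases
      case 3
      then show ?thesis
        using R by (cases d; cases e) auto
    qed (use around in blast)+
  qed
  then show "admissible w"
    using R unfolding admissible_def by blast
qed

definition coordinates :: "(arc_class \<Rightarrow> real) \<Rightarrow> real ^ 3" where
  "coordinates w = vector [side_sum w Side_a - w (Around Side_a), side_sum w Side_b - w (Around Side_b),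
     side_sum w Side_c - w (Around Side_c)]"

text \<open>If a class joining opposite sides \<open>a\<close> and \<open>A\<close> has positive weight, then the classes between \<open>b\<close>
  and \<open>c\<close> and the other two joining opposite sides are absent, and the weight is the defect in the
  triangle inequality \<open>a \<le> b + c\<close>; otherwise the triangle inequality holds.\<close>

lemma admissible_coordinates:
  assumes "admissible w"
  defines "y \<equiv> coordinates w"
  shows "ppart (y$1) = side_sum w Side_a" "ppart (y$2) = side_sum w Side_b" "ppart (y$3) = side_sum w Side_c"
    "npart (y$1) = w (Around Side_a)" "npart (y$2) = w (Around Side_b)" "npart (y$3) = w (Around Side_c)"
    "ppart (ppart (y$1) - ppart (y$2) - ppart (y$3)) = w Across_a"
    "ppart (ppart (y$2) - ppart (y$3) - ppart (y$1)) = w Across_b"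
    "ppart (ppart (y$3) - ppart (y$1) - ppart (y$2)) = w Across_c"
    "intersection_vector w = tropical_lengths y" "y \<noteq> 0"
proof -
  have w: "\<And>d. w d \<ge> 0" "\<exists>d. w d \<noteq> 0" and z: "\<And>s. w (Around s) = 0 \<or> side_sum w s = 0"
    and ac: "w Across_a = 0 \<or> w Across_b = 0" "w Across_b = 0 \<or> w Across_c = 0" "w Across_a = 0 \<or> w Across_c = 0"
    using assms(1) unfolding admissible_iff by blast+
  have ss: "side_sum w s \<ge> 0" for s
    unfolding side_sum_def using w(1) by (simp add: sum_nonneg)
  have y: "y$1 = side_sum w Side_a - w (Around Side_a)" "y$2 = side_sum w Side_b - w (Around Side_b)"
    "y$3 = side_sum w Side_c - w (Around Side_c)"
    by (simp_all add: y_def coordinates_def)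
  have pn: "ppart (u - v) = u \<and> npart (u - v) = v" if "v = 0 \<or> u = 0" "u \<ge> 0" "v \<ge> 0" for u v
    using that by (auto simp: ppart_def npart_def)
  show p: "ppart (y$1) = side_sum w Side_a" "ppart (y$2) = side_sum w Side_b" "ppart (y$3) = side_sum w Side_c"
    and n: "npart (y$1) = w (Around Side_a)" "npart (y$2) = w (Around Side_b)" "npart (y$3) = w (Around Side_c)"
    unfolding y using pn z ss w(1) by blast+
  note nn = w(1)[of "Around Side_A"] w(1)[of "Around Side_B"] w(1)[of "Around Side_C"]
    w(1)[of "Around Side_a"] w(1)[of "Around Side_b"] w(1)[of "Around Side_c"]
    w(1)[of Across_a] w(1)[of Across_b] w(1)[of Across_c]
  have across: "ppart (X - 2 * V - Y - Z) = X"
    if "V = 0 \<or> X = 0" "X = 0 \<or> Y = 0" "X = 0 \<or> Z = 0" "X \<ge> 0" "V \<ge> 0" "Y \<ge> 0" "Z \<ge> 0"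
    for X V Y Z :: real
    using that by (auto simp: ppart_def)
  show A: "ppart (ppart (y$1) - ppart (y$2) - ppart (y$3)) = w Across_a"
    using across[of "w (Around Side_A)" "w Across_a" "w Across_b" "w Across_c"] z[of Side_A] ac nn
    unfolding p side_sum_eqs by (simp add: algebra_simps) argo
  show B: "ppart (ppart (y$2) - ppart (y$3) - ppart (y$1)) = w Across_b"
    using across[of "w (Around Side_B)" "w Across_b" "w Across_c" "w Across_a"] z[of Side_B] ac nn
    unfolding p side_sum_eqs by (simp add: algebra_simps) argo
  show C: "ppart (ppart (y$3) - ppart (y$1) - ppart (y$2)) = w Across_c"
    using across[of "w (Around Side_C)" "w Across_c" "w Across_a" "w Across_b"] z[of Side_C] ac nn
    unfolding p side_sum_eqs by (simp add: algebra_simps) argo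
  show t: "intersection_vector w = tropical_lengths y"
    unfolding vec_eq_iff_side tropical_lengths_nth A B C unfolding p n
    by (simp add: intersection_vector_def side_sum_eqs)
  show "y \<noteq> 0"
  proof
    assume "y = 0"
    then have "intersection_vector w = 0"
      using t by simp
    then have "side_sum w s = 0" for s
      by (simp add: intersection_vector_def vec_eq_iff)
    then have zero: "w d = 0" if "s \<in> class_ends d" for d s
      using that w(1) unfolding side_sum_def by (metis (mono_tags, lifting) finite mem_Collect_eq sum_nonneg_eq_0_iff)
    have "w d = 0" for d
      using zero[of "end1 d" d] by (simp add: class_ends_def)
    then show False
      using w(2) by blast
  qed
qed

lemma inj_on_intersection_vector: "inj_on intersection_vector (Collect admissible)"
proof (rule inj_onI)
  fix w v assume "w \<in> Collect admissible" "v \<in> Collect admissible"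
    and eq: "intersection_vector w = intersection_vector v"
  then have wv: "admissible w" "admissible v" by auto
  note W = admissible_coordinates[OF wv(1)] and V = admissible_coordinates[OF wv(2)]
  have y: "coordinates w = coordinates v"
    using eq W(10) V(10) inj_tropical_lengths by (simp add: inj_eq)
  have ss: "side_sum w s = side_sum v s" for s
    using eq by (simp add: intersection_vector_def vec_eq_iff)
  have 1: "w (Around Side_a) = v (Around Side_a)" "w (Around Side_b) = v (Around Side_b)"
    "w (Around Side_c) = v (Around Side_c)"
    "w Across_a = v Across_a" "w Across_b = v Across_b" "w Across_c = v Across_c"
    using W(4-9) V(4-9) unfolding y by simp_all
  have 2: "w (Around Side_A) = v (Around Side_A)" "w (Around Side_B) = v (Around Side_B)"
    "w (Around Side_C) = v (Around Side_C)"
    using ss[of Side_a] ss[of Side_b] ss[of Side_c] 1 unfolding side_sum_eqs by linarith+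
  have "w d = v d" for d
  proof (cases d)
    case (Around s)
    then show ?thesis using 1 2 by (cases s) simp_all
  qed (simp_all add: 1)
  then show "w = v" ..
qed

text \<open>The inverse of \<open>coordinates\<close>.\<close>

definition weights_of :: "real ^ 3 \<Rightarrow> arc_class \<Rightarrow> real" where
  "weights_of y = (let a = ppart (y$1); b = ppart (y$2); c = ppart (y$3) in
     rec_arc_class
       (rec_side (npart (y$1)) (ppart (min (min a b) ((a + b - c) / 2)))
          (npart (y$2)) (ppart (min (min b c) ((b + c - a) / 2)))
          (npart (y$3)) (ppart (min (min c a) ((c + a - b) / 2))))
       (ppart (a - b - c)) (ppart (b - c - a)) (ppart (c - a - b)))"

text \<open>The weights of the three classes around a triangle are half the excesses in its triangle
  inequalities, and they add up to the sides; when an inequality fails, the class joining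
  opposite sides takes the defect.\<close>

lemma tripod_weights:
  fixes a b c :: real
  assumes "a \<ge> 0" "b \<ge> 0" "c \<ge> 0"
  shows "ppart (min (min a b) ((a + b - c) / 2)) + ppart (min (min c a) ((c + a - b) / 2)) + ppart (a - b - c) = a"
proof -
  define h k where "h = (a + b - c) / 2" and "k = (c + a - b) / 2"
  have "2 * h = a + b - c" "2 * k = c + a - b"
    by (simp_all add: h_def k_def)
  then show ?thesis
    unfolding h_def[symmetric] k_def[symmetric] ppart_def using assms by linarith
qed

lemma tripod_weight_zero:
  fixes a b c n m :: real
  assumes "n = 0 \<or> b = 0" "m = 0 \<or> c = 0" "n \<ge> 0" "m \<ge> 0" "b \<ge> 0" "c \<ge> 0"
  shows "ppart (min (min b c) ((b + c - a) / 2)) = 0 \<or> n + m + ppart (a - b - c) = 0"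
proof -
  define h where "h = (b + c - a) / 2"
  have "2 * h = b + c - a"
    by (simp add: h_def)
  then show ?thesis
    unfolding h_def[symmetric] ppart_def using assms by linarith
qed

lemma weights_of_admissible:
  assumes "y \<noteq> 0"
  shows "admissible (weights_of y)" "intersection_vector (weights_of y) = tropical_lengths y"
proof -
  let ?w = "weights_of y"
  define a b c where abc: "a = ppart (y$1)" "b = ppart (y$2)" "c = ppart (y$3)"
  have nn: "a \<ge> 0" "b \<ge> 0" "c \<ge> 0"
    by (simp_all add: abc ppart_npart)
  have w: "?w (Around Side_a) = npart (y$1)" "?w (Around Side_b) = npart (y$2)" "?w (Around Side_c) = npart (y$3)"
    "?w (Around Side_C) = ppart (min (min a b) ((a + b - c) / 2))"
    "?w (Around Side_A) = ppart (min (min b c) ((b + c - a) / 2))"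
    "?w (Around Side_B) = ppart (min (min c a) ((c + a - b) / 2))"
    "?w Across_a = ppart (a - b - c)" "?w Across_b = ppart (b - c - a)" "?w Across_c = ppart (c - a - b)"
    by (simp_all add: weights_of_def Let_def abc)
  note split = tripod_weights
  have s: "side_sum ?w Side_a = a" "side_sum ?w Side_b = b" "side_sum ?w Side_c = c"
    unfolding side_sum_eqs w using split[OF nn] split[OF nn(2,3,1)] split[OF nn(3,1,2)]
    by (simp_all only: add.commute)
  show t: "intersection_vector ?w = tropical_lengths y"
    unfolding vec_eq_iff_side tropical_lengths_nth abc[symmetric]
    by (simp add: intersection_vector_def s) (simp add: side_sum_eqs w)
  show "admissible ?w"
    unfolding admissible_iff
  proof (intro conjI allI)
    show "0 \<le> ?w d" for d
    proof (cases d)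
      case (Around s)
      then show ?thesis by (cases s) (simp_all add: w ppart_npart)
    qed (simp_all add: w ppart_npart)
    show "\<exists>d. ?w d \<noteq> 0"
    proof (rule ccontr)
      assume "\<nexists>d. ?w d \<noteq> 0"
      then have "tropical_lengths y = tropical_lengths 0"
        using t by (simp add: intersection_vector_def side_sum_def vec_eq_iff)
      then show False
        using assms injD[OF inj_tropical_lengths] by blast
    qed
    show "?w Across_a = 0 \<or> ?w Across_b = 0" "?w Across_b = 0 \<or> ?w Across_c = 0" "?w Across_a = 0 \<or> ?w Across_c = 0"
      using nn unfolding w ppart_def by linarith+
    note big = tripod_weight_zero
    have pn: "npart (y$1) = 0 \<or> a = 0" "npart (y$2) = 0 \<or> b = 0" "npart (y$3) = 0 \<or> c = 0"
      using ppart_npart(4) by (auto simp: abc)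
    show "?w (Around s) = 0 \<or> side_sum ?w s = 0" for s
    proof (cases s)
      case Side_A
      then show ?thesis
        using big[OF pn(2,3), of a] ppart_npart(2) nn unfolding side_sum_eqs w by (simp add: add_ac side_sum_eqs w)
    next
      case Side_B
      then show ?thesis
        using big[OF pn(3,1), of b] ppart_npart(2) nn unfolding side_sum_eqs w by (simp add: add_ac side_sum_eqs w)
    next
      case Side_C
      then show ?thesis
        using big[OF pn(1,2), of c] ppart_npart(2) nn unfolding side_sum_eqs w by (simp add: add_ac side_sum_eqs w)
    qed (use pn in \<open>simp_all add: w s\<close>)
  qed
qed

theorem i_star_image_tropical: "i_star ` MF = tropical_lengths ` (- {0})"
proof -
  have "intersection_vector ` Collect admissible = tropical_lengths ` (- {0})"
  proof (intro equalityI subsetI)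
    fix v assume "v \<in> intersection_vector ` Collect admissible"
    then obtain w where "admissible w" "v = intersection_vector w" by blast
    then show "v \<in> tropical_lengths ` (- {0})"
      using admissible_coordinates(10,11)[of w] by blast
  next
    fix v assume "v \<in> tropical_lengths ` (- {0})"
    then obtain y where "y \<noteq> 0" "v = tropical_lengths y" by blast
    then show "v \<in> intersection_vector ` Collect admissible"
      using weights_of_admissible[of y] by (metis imageI mem_Collect_eq)
  qed
  then show ?thesis
    using i_star_image by simp
qed

text \<open>A foliation class is determined by its weights, and the weights by the intersection numbers.\<close>

theorem inj_on_i_star: "inj_on i_star MF"
proof (rule inj_onI)
  fix X Y assume X: "X \<in> MF" and Y: "Y \<in> MF" and eq: "i_star X = i_star Y"
  obtain F where F: "measured_foliation F" "X = foliation_equiv `` {F}"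
    using MF_cases[OF X] .
  obtain G where G: "measured_foliation G" "Y = foliation_equiv `` {G}"
    using MF_cases[OF Y] .
  have "weight F = weight G"
    using eq i_star_class F G admissible_weight inj_on_intersection_vector
    by (metis inj_onD mem_Collect_eq)
  then have "(F, G) \<in> foliation_equiv"
    using F G foliation_equiv_iff by blast
  then show "X = Y"
    unfolding F(2) G(2) by (rule equiv_class_eq[OF equiv_foliation_equiv])
qed

lemma scaling_equiv_iff:
  "(X, Y) \<in> scaling_equiv \<longleftrightarrow> X \<in> MF \<and> Y \<in> MF \<and> (\<exists>c>0. i_star Y = c *\<^sub>R i_star X)"
proof
  assume "(X, Y) \<in> scaling_equiv"
  then obtain c F where XY: "X \<in> MF" "Y \<in> MF" and c: "c > 0" "F \<in> X" "scale_band c ` F \<in> Y"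
    unfolding scaling_equiv_def by blast
  obtain F0 where F0: "measured_foliation F0" "X = foliation_equiv `` {F0}"
    using MF_cases[OF XY(1)] .
  obtain G0 where G0: "measured_foliation G0" "Y = foliation_equiv `` {G0}"
    using MF_cases[OF XY(2)] .
  have F: "measured_foliation F" "weight F = weight F0"
    using c(2) F0 by (simp_all add: foliation_equiv_iff)
  have "weight G0 = weight (scale_band c ` F)"
    using c(3) G0 by (simp add: foliation_equiv_iff)
  then have "weight G0 = (\<lambda>d. c * weight F0 d)"
    using scale_foliation(2)[OF c(1) F(1)] F(2) by simp
  then have "i_star Y = c *\<^sub>R i_star X"
    using i_star_class[OF F0(1)] i_star_class[OF G0(1)] F0(2) G0(2)
    by (simp add: intersection_vector_def side_sum_def vec_eq_iff sum_distrib_left)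
  then show "X \<in> MF \<and> Y \<in> MF \<and> (\<exists>c>0. i_star Y = c *\<^sub>R i_star X)"
    using XY c(1) by blast
next
  assume "X \<in> MF \<and> Y \<in> MF \<and> (\<exists>c>0. i_star Y = c *\<^sub>R i_star X)"
  then obtain c where XY: "X \<in> MF" "Y \<in> MF" and c: "c > 0" "i_star Y = c *\<^sub>R i_star X"
    by blast
  obtain F where F: "measured_foliation F" "X = foliation_equiv `` {F}"
    using MF_cases[OF XY(1)] .
  note cF = scale_foliation[OF c(1) F(1)]
  have "i_star (foliation_equiv `` {scale_band c ` F}) = c *\<^sub>R i_star X"
    using i_star_class[OF F(1)] i_star_class[OF cF(1)] F(2)
    by (simp add: cF(2) intersection_vector_def side_sum_def vec_eq_iff sum_distrib_left)
  then have "foliation_equiv `` {scale_band c ` F} = Y"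
    using inj_onD[OF inj_on_i_star _ class_in_MF[OF cF(1)] XY(2)] c(2) by simp
  then have "scale_band c ` F \<in> Y"
    using equiv_class_self[OF equiv_foliation_equiv] cF(1) by blast
  moreover have "F \<in> X"
    using equiv_class_self[OF equiv_foliation_equiv] F by blast
  ultimately show "(X, Y) \<in> scaling_equiv"
    unfolding scaling_equiv_def using XY c(1) by blast
qed

section \<open>Lengths of hexagons near infinity\<close>

definition teich_lengths :: "real ^ 3 \<Rightarrow> real ^ side" where
  "teich_lengths y = hexagon_lengths (arsinh (exp (y$1))) (arsinh (exp (y$2))) (arsinh (exp (y$3)))"

lemma range_teich_lengths: "range teich_lengths = l_star ` Teich"
proof -
  have "\<exists>y. teich_lengths y = hexagon_lengths a b c" if "a > 0" "b > 0" "c > 0" for a b c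
  proof
    show "teich_lengths (vector [ln (sinh a), ln (sinh b), ln (sinh c)]) = hexagon_lengths a b c"
      using that by (simp add: teich_lengths_def arsinh_sinh_real)
  qed
  note surj = this
  show ?thesis
    unfolding l_star_image
  proof (intro equalityI subsetI)
    fix v assume "v \<in> range teich_lengths"
    then obtain y :: "real ^ 3" where "v = hexagon_lengths (arsinh (exp (y$1))) (arsinh (exp (y$2))) (arsinh (exp (y$3)))"
      by (auto simp: teich_lengths_def)
    moreover have "arsinh (exp t) > 0" for t :: real
      by simp
    ultimately show "v \<in> {hexagon_lengths a b c |a b c. 0 < a \<and> 0 < b \<and> 0 < c}"
      by blast
  next
    fix v assume "v \<in> {hexagon_lengths a b c |a b c. 0 < a \<and> 0 < b \<and> 0 < c}"
    then obtain a b c where "v = hexagon_lengths a b c" "0 < a" "0 < b" "0 < c"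
      by blast
    then show "v \<in> range teich_lengths"
      using surj[of a b c] by (metis rangeI)
  qed
qed

definition log_sinh_sides :: "real ^ side \<Rightarrow> real ^ 3" where
  "log_sinh_sides v = (\<chi> i. ln (sinh (v $ (if i = 1 then Side_a else if i = 2 then Side_b else Side_c))))"

lemma log_sinh_sides_teich_lengths [simp]: "log_sinh_sides (teich_lengths y) = y"
  by (simp add: log_sinh_sides_def teich_lengths_def vec_eq_iff forall_3)

lemma inj_teich_lengths: "inj teich_lengths"
  by (rule inj_on_inverseI[where g = log_sinh_sides]) simp

lemma teich_lengths_pos: "teich_lengths y $ s > 0"
proof -
  obtain h where h: "h \<in> Teich" "teich_lengths y = l_star h"
    using range_teich_lengths by blast
  from h(1) obtain p where p: "right_hexagon p" "h = label_isometric `` {p}"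
    by (rule Teich_cases)
  then have "teich_lengths y = (\<chi> s. len p s)"
    using h(2) l_star_class[OF p(1)] lengths_of_right_hexagon[OF p(1)] by simp
  then show ?thesis
    using right_hexagon_len(2)[OF p(1)] by simp
qed

lemma continuous_on_log_sinh_sides: "continuous_on (range teich_lengths) log_sinh_sides"
proof -
  have "continuous_on (range teich_lengths) (\<lambda>v. ln (sinh (v $ s)))" for s
  proof (intro continuous_on_ln continuous_intros ballI)
    fix v assume "v \<in> range teich_lengths"
    then have "sinh (v $ s) > 0"
      using teich_lengths_pos by auto
    then show "sinh (v $ s) \<noteq> 0" by linarith
  qed
  then show ?thesis
    unfolding log_sinh_sides_def by (intro continuous_on_vec_lambda)
qed

text \<open>For nonnegative \<open>r\<close> the numbers \<open>cosh r\<close> and \<open>exp r\<close> agree up to a factor of two.\<close>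

lemma arcosh_bounds:
  fixes x L :: real
  assumes "exp L \<le> x" "x \<le> 8 * exp L" "L \<ge> 0"
  shows "L \<le> arcosh x" "arcosh x \<le> L + ln 16"
proof -
  define r where "r = arcosh x"
  have x: "x \<ge> 1"
    using assms(1,3) one_le_exp_iff[of L] by linarith
  then have r: "r \<ge> 0" "cosh r = x"
    by (simp_all add: r_def)
  have "exp (- r) \<le> exp r"
    using r by simp
  then have c: "cosh r \<le> exp r" "exp r \<le> 2 * cosh r"
    by (simp_all add: cosh_field_def)
  show "L \<le> arcosh x"
    using c(1) r(2) assms(1) unfolding r_def[symmetric] by (metis exp_le_cancel_iff order_trans)
  have "exp r \<le> 16 * exp L"
    using c(2) r(2) assms(2) by linarith
  also have "\<dots> = exp (L + ln 16)"
    by (simp add: exp_add)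
  finally show "arcosh x \<le> L + ln 16"
    by (simp add: r_def)
qed

lemma cosh_arsinh_exp_bounds:
  "exp (ppart t) \<le> cosh (arsinh (exp t))" "cosh (arsinh (exp t)) \<le> 2 * exp (ppart t)"
proof -
  have c: "cosh (arsinh (exp t)) = sqrt ((exp t)\<^sup>2 + 1)"
    by (simp add: cosh_arsinh_real)
  have e: "exp (ppart t) = max (exp t) 1"
    by (simp add: ppart_def max_def)
  have m: "(max (exp t) 1)\<^sup>2 \<le> (exp t)\<^sup>2 + 1" "(exp t)\<^sup>2 \<le> (max (exp t) 1)\<^sup>2" "1 \<le> (max (exp t) 1)\<^sup>2"
    by (auto simp: max_def intro: power_mono one_le_power)
  show "exp (ppart t) \<le> cosh (arsinh (exp t))"
    unfolding c e using m(1) by (intro real_le_rsqrt)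
  show "cosh (arsinh (exp t)) \<le> 2 * exp (ppart t)"
  proof -
    have "(exp t)\<^sup>2 + 1 \<le> 4 * (max (exp t) 1)\<^sup>2"
      using m(2,3) by linarith
    also have "\<dots> = (2 * max (exp t) 1)\<^sup>2"
      by (simp add: power_mult_distrib)
    finally show ?thesis
      unfolding c e by (intro real_le_lsqrt) auto
  qed
qed

text \<open>Up to a bounded factor, \<open>cosh (arsinh (exp t))\<close> is \<open>exp (ppart t)\<close> and a sum is a maximum; so the
  term of the law of cosines becomes the exponential of a piecewise linear function.\<close>

lemma cosine_term_bounds:
  fixes x y z :: real
  defines "L \<equiv> npart y + npart z + ppart (ppart x - ppart y - ppart z)"
    and "r \<equiv> (cosh (arsinh (exp x)) + cosh (arsinh (exp y)) * cosh (arsinh (exp z)))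
      / (sinh (arsinh (exp y)) * sinh (arsinh (exp z)))"
  shows "exp L \<le> r" "r \<le> 8 * exp L" "L \<ge> 0"
proof -
  let ?cx = "cosh (arsinh (exp x))" and ?cy = "cosh (arsinh (exp y))" and ?cz = "cosh (arsinh (exp z))"
  have L: "L = max (ppart x - y - z) (ppart y + ppart z - y - z)"
    using ppart_npart(3)[of y] ppart_npart(3)[of z] unfolding L_def ppart_def[of "ppart x - ppart y - ppart z"] by linarith
  have r: "r = (?cx + ?cy * ?cz) * exp (- y - z)"
    by (simp add: r_def exp_minus exp_diff field_simps)
  have eL: "exp L = max (exp (ppart x)) (exp (ppart y) * exp (ppart z)) * exp (- y - z)"
  proof -
    have "exp (ppart x - y - z) = exp (ppart x) * exp (- y - z)"
      "exp (ppart y + ppart z - y - z) = exp (ppart y) * exp (ppart z) * exp (- y - z)"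
      by (simp_all flip: exp_add)
    moreover have "exp L = max (exp (ppart x - y - z)) (exp (ppart y + ppart z - y - z))"
      unfolding L by (simp add: max_def)
    ultimately show ?thesis
      by (simp add: max_mult_distrib_right)
  qed
  note bx = cosh_arsinh_exp_bounds[of x] and by' = cosh_arsinh_exp_bounds[of y]
    and bz = cosh_arsinh_exp_bounds[of z]
  have lo: "exp (ppart y) * exp (ppart z) \<le> ?cy * ?cz"
    using by'(1) bz(1) by (intro mult_mono) auto
  have hi: "?cy * ?cz \<le> (2 * exp (ppart y)) * (2 * exp (ppart z))"
    using by'(2) bz(2) by (intro mult_mono) auto
  have pos: "0 < exp (ppart y) * exp (ppart z)" "0 < exp (ppart x)" "0 < ?cy * ?cz" "0 < ?cx"
    by simp_all
  show "exp L \<le> r"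
  proof -
    have "max (exp (ppart x)) (exp (ppart y) * exp (ppart z)) \<le> ?cx + ?cy * ?cz"
      using lo bx(1) pos by linarith
    then show ?thesis
      unfolding eL r by (intro mult_right_mono) auto
  qed
  have "?cx + ?cy * ?cz \<le> 2 * exp (ppart x) + 4 * (exp (ppart y) * exp (ppart z))"
    using hi bx(2) by linarith
  also have "\<dots> \<le> 8 * max (exp (ppart x)) (exp (ppart y) * exp (ppart z))"
    using pos by linarith
  finally show "r \<le> 8 * exp L"
    unfolding eL r by (metis exp_ge_zero mult.assoc mult_right_mono)
  show "L \<ge> 0"
    by (simp add: L_def ppart_npart)
qed

lemma teich_lengths_near_tropical_lengths:
  "tropical_lengths y $ s \<le> teich_lengths y $ s" "teich_lengths y $ s \<le> tropical_lengths y $ s + ln 16"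
proof -
  have a: "ppart t \<le> arsinh (exp t) \<and> arsinh (exp t) \<le> ppart t + ln 16" for t
  proof -
    have "arsinh (exp t) = arcosh (cosh (arsinh (exp t)))"
      by (simp add: arcosh_cosh_real less_imp_le)
    moreover have "cosh (arsinh (exp t)) \<le> 8 * exp (ppart t)"
      using cosh_arsinh_exp_bounds(2)[of t] exp_gt_zero[of "ppart t"] by linarith
    ultimately show ?thesis
      using arcosh_bounds[OF cosh_arsinh_exp_bounds(1)[of t]] ppart_npart(1) by metis
  qed
  have o: "L \<le> opposite_length (arsinh (exp t)) (arsinh (exp u)) (arsinh (exp v)) \<and>
      opposite_length (arsinh (exp t)) (arsinh (exp u)) (arsinh (exp v)) \<le> L + ln 16"
    if "L = npart u + npart v + ppart (ppart t - ppart u - ppart v)" for L t u v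
    unfolding opposite_length_def that using arcosh_bounds[OF cosine_term_bounds] by blast
  have "tropical_lengths y $ s \<le> teich_lengths y $ s \<and> teich_lengths y $ s \<le> tropical_lengths y $ s + ln 16"
    by (cases s) (simp_all only: teich_lengths_def hexagon_lengths_nth tropical_lengths_nth a o[OF refl] simp_thms)
  then show "tropical_lengths y $ s \<le> teich_lengths y $ s" "teich_lengths y $ s \<le> tropical_lengths y $ s + ln 16"
    by blast+
qed

lemma continuous_on_teich_lengths: "continuous_on S teich_lengths"
proof -
  have c: "continuous_on S (\<lambda>y. arsinh (exp (y$i)))" for i :: 3
    by (intro continuous_on_compose2[OF continuous_on_arsinh[of UNIV]] continuous_intros) auto
  have o: "continuous_on S (\<lambda>y. opposite_length (arsinh (exp (y$i))) (arsinh (exp (y$j))) (arsinh (exp (y$k))))"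
    for i j k :: 3
    unfolding opposite_length_def
  proof (rule continuous_on_compose2[OF continuous_on_arcosh[OF order_refl]])
    show "continuous_on S (\<lambda>y. (cosh (arsinh (exp (y$i))) + cosh (arsinh (exp (y$j))) * cosh (arsinh (exp (y$k))))
        / (sinh (arsinh (exp (y$j))) * sinh (arsinh (exp (y$k)))))"
      by (intro continuous_intros c) auto
    have "1 \<le> (cosh (arsinh (exp (y$i))) + cosh (arsinh (exp (y$j))) * cosh (arsinh (exp (y$k))))
        / (sinh (arsinh (exp (y$j))) * sinh (arsinh (exp (y$k))))" for y :: "real ^ 3"
      using cosine_term_bounds(1,3)[where x = "y$i" and y = "y$j" and z = "y$k"]
      by (meson dual_order.trans one_le_exp_iff)
    then show "(\<lambda>y. (cosh (arsinh (exp (y$i))) + cosh (arsinh (exp (y$j))) * cosh (arsinh (exp (y$k))))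
        / (sinh (arsinh (exp (y$j))) * sinh (arsinh (exp (y$k))))) ` S \<subseteq> {1..}"
      by blast
  qed
  have "continuous_on S (\<lambda>y. teich_lengths y $ s)" for s
    by (cases s) (simp_all only: teich_lengths_def hexagon_lengths_nth o c)
  then have "continuous_on S (\<lambda>y. \<chi> s. teich_lengths y $ s)"
    by (rule continuous_on_vec_lambda)
  then show ?thesis by simp
qed

section \<open>Lengths of hexagons are not proportional\<close>

text \<open>Both sides of the cross-multiplied inequality are turned into sums of \<open>sinh\<close> by the product
  formulas and compared term by term.\<close>

lemma cosh_sinh_scale:
  assumes "0 < x" "x \<le> y" "1 \<le> (k :: real)"
  shows "cosh (k * x) / sinh (k * y) \<le> cosh x / sinh y"
proof -
  have "0 \<le> (k - 1) * (y - x)" "0 \<le> (k - 1) * (x + y)"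
    using assms by (intro mult_nonneg_nonneg; simp)+
  then have "sinh (k * x + y) \<le> sinh (x + k * y)" "sinh (y - k * x) \<le> sinh (k * y - x)"
    by (simp_all add: algebra_simps)
  then have "cosh (k * x) * sinh y \<le> cosh x * sinh (k * y)"
    by (simp add: sinh_add sinh_diff algebra_simps)
  moreover have "sinh y > 0" "sinh (k * y) > 0"
    using assms by auto
  ultimately show ?thesis
    by (simp add: field_simps)
qed

text \<open>The right-hand side of the law of cosines is composed of quotients of \<open>cosh\<close> by \<open>sinh\<close> to which
  \<open>cosh_sinh_scale\<close> applies, and of \<open>1 / sinh z\<close>, so none of its factors grows.\<close>

lemma opposite_length_scale:
  assumes "0 < x" "0 < y" "0 < z" "x \<le> y" "1 \<le> k"
    and "opposite_length (k * x) (k * y) (k * z) > 0" "opposite_length x y z > 0"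
  shows "opposite_length (k * x) (k * y) (k * z) \<le> opposite_length x y z"
proof -
  let ?r = "\<lambda>x y z :: real. (cosh x + cosh y * cosh z) / (sinh y * sinh z)"
  have s: "sinh y > 0" "sinh z > 0" "sinh (k * y) > 0" "sinh (k * z) > 0"
    using assms by auto
  have "0 \<le> (k - 1) * z"
    using assms by simp
  then have "sinh z \<le> sinh (k * z)"
    by (simp add: algebra_simps)
  then have i: "1 / sinh (k * z) \<le> 1 / sinh z"
    using s by (simp add: frac_le)
  have r: "?r x y z = cosh x / sinh y * (1 / sinh z) + cosh y / sinh y * (cosh z / sinh z)" for x y z
    by (simp add: add_divide_distrib)
  have "?r (k * x) (k * y) (k * z) \<le> ?r x y z"
    unfolding r using s assms(1-5)
    by (intro add_mono mult_mono cosh_sinh_scale i) auto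
  moreover have "?r x y z \<ge> 1" if "x > 0" "y > 0" "z > 0" for x y z
  proof -
    have "sinh y * sinh z \<le> cosh y * cosh z"
      using that by (intro mult_mono) (auto intro: less_imp_le sinh_less_cosh_real)
    then have "sinh y * sinh z \<le> cosh x + cosh y * cosh z"
      using cosh_real_pos[of x] by linarith
    then show ?thesis
      using that by simp
  qed
  ultimately show ?thesis
    unfolding opposite_length_def using assms(1-5) arcosh_real_strict_mono
    by (smt (verit) mult_pos_pos)
qed

lemma opposite_length_commute: "opposite_length x y z = opposite_length x z y"
  by (simp add: opposite_length_def mult.commute)

text \<open>The smaller of \<open>a\<close> and \<open>b\<close> is at most as long as the other, so \<open>opposite_length_scale\<close> applies:
  the side opposite to it does not grow when \<open>a\<close>, \<open>b\<close>, \<open>c\<close> are enlarged by a common factor.\<close>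

lemma teich_lengths_no_multiple:
  assumes "teich_lengths z = c *\<^sub>R teich_lengths y"
  shows "c \<le> 1"
proof (rule ccontr)
  assume "\<not> c \<le> 1"
  then have c: "c \<ge> 1" "c > 1" by simp_all
  define a b d where abd: "a = arsinh (exp (y$1))" "b = arsinh (exp (y$2))" "d = arsinh (exp (y$3))"
  have y: "teich_lengths y = hexagon_lengths a b d"
    by (simp add: teich_lengths_def abd)
  have nth: "teich_lengths z $ s = c * teich_lengths y $ s" for s
    using assms by simp
  have z: "teich_lengths z = hexagon_lengths (c * a) (c * b) (c * d)"
  proof -
    have "arsinh (exp (z$1)) = c * a" "arsinh (exp (z$2)) = c * b" "arsinh (exp (z$3)) = c * d"
      using nth[of Side_a] nth[of Side_b] nth[of Side_c] unfolding teich_lengths_def by (simp_all add: abd)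
    then show ?thesis by (simp add: teich_lengths_def)
  qed
  have pos: "a > 0" "b > 0" "d > 0"
    by (simp_all add: abd)
  have oy: "opposite_length a b d > 0" "opposite_length b d a > 0"
    using teich_lengths_pos[of y Side_A] teich_lengths_pos[of y Side_B] by (simp_all add: y)
  have oz: "opposite_length (c * a) (c * b) (c * d) = c * opposite_length a b d"
    "opposite_length (c * b) (c * d) (c * a) = c * opposite_length b d a"
    using nth[of Side_A] nth[of Side_B] by (simp_all add: y z)
  show False
  proof (cases "a \<le> b")
    case True
    have "opposite_length (c * a) (c * b) (c * d) \<le> opposite_length a b d"
      using opposite_length_scale[OF pos True c(1)] oy oz c by simp
    then show False
      using oz(1) oy(1) c by simp
  next
    case False
    then have "opposite_length (c * b) (c * a) (c * d) \<le> opposite_length b a d"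
      using opposite_length_scale[OF pos(2,1,3) _ c(1)] oy oz c opposite_length_commute by simp
    then have "opposite_length (c * b) (c * d) (c * a) \<le> opposite_length b d a"
      using opposite_length_commute by metis
    then show False
      using oz(2) oy(2) c by simp
  qed
qed

theorem teich_lengths_not_proportional:
  assumes "teich_lengths z = c *\<^sub>R teich_lengths y" "c > 0"
  shows "z = y"
proof -
  have "teich_lengths y = (1 / c) *\<^sub>R teich_lengths z"
    using assms by simp
  then have "c \<le> 1" "1 / c \<le> 1"
    using assms(1) teich_lengths_no_multiple by blast+
  then have "c = 1"
    using assms(2) by simp
  then show ?thesis
    using assms(1) inj_teich_lengths by (simp add: inj_eq)
qed

section \<open>Quotient and pullback topologies\<close>

lemma continuous_map_quotient_projection: "continuous_map X (quotient_topology X q) q"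
  by (auto simp: continuous_map_def topspace_quotient_topology openin_quotient_topology)

lemma continuous_map_from_quotient:
  assumes "continuous_map X Y (g \<circ> q)"
  shows "continuous_map (quotient_topology X q) Y g"
  unfolding continuous_map_def
proof (intro conjI allI impI)
  show "g \<in> topspace (quotient_topology X q) \<rightarrow> topspace Y"
    using assms by (auto simp: topspace_quotient_topology continuous_map_def Pi_iff)
  fix U assume "openin Y U"
  then have "openin X {x \<in> topspace X. (g \<circ> q) x \<in> U}"
    using assms by (auto simp: continuous_map_def)
  moreover have "{x \<in> topspace X. q x \<in> {z \<in> topspace (quotient_topology X q). g z \<in> U}}
      = {x \<in> topspace X. (g \<circ> q) x \<in> U}"
    by (auto simp: topspace_quotient_topology)
  ultimately show "openin (quotient_topology X q) {z \<in> topspace (quotient_topology X q). g z \<in> U}"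
    by (auto simp: openin_quotient_topology topspace_quotient_topology)
qed

lemma homeomorphic_map_pullback:
  assumes "inj_on f A"
  shows "homeomorphic_map (pullback_topology A f euclidean) (top_of_set (f ` A)) f"
proof -
  have ts: "topspace (pullback_topology A f euclidean) = A"
    by (simp add: topspace_pullback_topology)
  have "continuous_map (pullback_topology A f euclidean) (top_of_set (f ` A)) f"
    unfolding continuous_map_in_subtopology ts
    using continuous_map_pullback[of euclidean euclidean id A f] by (simp add: ts)
  moreover have "open_map (pullback_topology A f euclidean) (top_of_set (f ` A)) f"
    unfolding open_map_def
  proof (intro allI impI)
    fix U assume "openin (pullback_topology A f euclidean) U"
    then obtain V where V: "open V" "U = f -` V \<inter> A"
      by (auto simp: openin_pullback_topology)
    then have "f ` U = f ` A \<inter> V" by auto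
    then show "openin (top_of_set (f ` A)) (f ` U)"
      using V(1) by (auto simp: openin_open)
  qed
  ultimately show ?thesis
    using assms by (intro bijective_open_imp_homeomorphic_map) (auto simp: ts)
qed

section \<open>Projective space\<close>

lemma topspace_projective_space: "topspace projective_space = proj ` (- {0})"
  by (simp add: projective_space_def topspace_quotient_topology)

lemma proj_scale [simp]: "c \<noteq> 0 \<Longrightarrow> proj (c *\<^sub>R x) = proj x"
proof -
  assume c: "c \<noteq> 0"
  have "k *\<^sub>R x = (k / c) *\<^sub>R (c *\<^sub>R x)" for k
    using c by simp
  then have "range (\<lambda>k. k *\<^sub>R x) \<subseteq> range (\<lambda>k. k *\<^sub>R (c *\<^sub>R x))"
    by blast
  moreover have "range (\<lambda>k. k *\<^sub>R (c *\<^sub>R x)) \<subseteq> range (\<lambda>k. k *\<^sub>R x)"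
    by auto
  ultimately show ?thesis
    unfolding proj_def span_singleton by blast
qed

lemma proj_eqD:
  assumes "proj x = proj y" "x \<noteq> 0"
  obtains c where "c \<noteq> 0" "x = c *\<^sub>R y"
proof -
  have "x \<in> span {x}"
    by (simp add: span_base)
  then have "x \<in> span {y}"
    using assms(1) by (simp add: proj_def)
  then obtain c where c: "x = c *\<^sub>R y"
    by (auto simp: span_singleton)
  then have "c \<noteq> 0"
    using assms(2) by auto
  then show ?thesis
    using c by (rule that)
qed

lemma continuous_map_proj: "continuous_map (top_of_set (- {0})) projective_space proj"
  unfolding projective_space_def by (rule continuous_map_quotient_projection)

text \<open>The matrix of the orthogonal projection to a line separates the points of the projective space.\<close>

definition line_matrix :: "(real ^ side) set \<Rightarrow> real ^ side ^ side" where
  "line_matrix L = (let x = (SOME x. x \<in> L \<and> x \<noteq> 0) in \<chi> i j. x $ i * x $ j / (x \<bullet> x))"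

lemma line_matrix_proj:
  assumes "x \<noteq> 0"
  shows "line_matrix (proj x) = (\<chi> i j. x $ i * x $ j / (x \<bullet> x))"
proof -
  define z where "z = (SOME z. z \<in> proj x \<and> z \<noteq> 0)"
  have "x \<in> proj x \<and> x \<noteq> 0"
    using assms by (simp add: proj_def span_base)
  then have "z \<in> proj x \<and> z \<noteq> 0"
    unfolding z_def by (rule someI)
  then obtain c where c: "z = c *\<^sub>R x" "c \<noteq> 0"
    by (auto simp: proj_def span_singleton)
  have "line_matrix (proj x) = (\<chi> i j. z $ i * z $ j / (z \<bullet> z))"
    by (simp add: line_matrix_def z_def Let_def)
  also have "\<dots> = (\<chi> i j. x $ i * x $ j / (x \<bullet> x))"
  proof -
    have "z $ i * z $ j / (z \<bullet> z) = x $ i * x $ j / (x \<bullet> x)" for i j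
      unfolding c(1) using c(2) by simp
    then show ?thesis by simp
  qed
  finally show ?thesis .
qed

lemma Hausdorff_projective_space: "Hausdorff_space projective_space"
proof (rule Hausdorff_space_injective_preimage)
  have "continuous_on (- {0}) (\<lambda>x :: real ^ side. \<chi> i j. x $ i * x $ j / (x \<bullet> x))"
    by (intro continuous_on_vec_lambda continuous_intros) auto
  then have "continuous_on (- {0}) (line_matrix \<circ> proj)"
    by (rule continuous_on_eq) (simp add: line_matrix_proj)
  then show "continuous_map projective_space euclidean line_matrix"
    unfolding projective_space_def by (intro continuous_map_from_quotient) simp
  show "inj_on line_matrix (topspace projective_space)"
  proof (rule inj_onI)
    fix L M assume "L \<in> topspace projective_space" "M \<in> topspace projective_space"
      and eq: "line_matrix L = line_matrix M"
    then obtain x y where x: "x \<noteq> 0" "L = proj x" and y: "y \<noteq> 0" "M = proj y"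
      by (auto simp: topspace_projective_space)
    have e: "x $ i * x $ j / (x \<bullet> x) = y $ i * y $ j / (y \<bullet> y)" for i j
      using eq unfolding x(2) y(2) line_matrix_proj[OF x(1)] line_matrix_proj[OF y(1)]
      by (simp add: vec_eq_iff)
    obtain j where j: "x $ j \<noteq> 0"
      using x(1) by (auto simp: vec_eq_iff)
    define c where "c = y $ j * (x \<bullet> x) / ((y \<bullet> y) * x $ j)"
    have "x = c *\<^sub>R y"
    proof (rule vec_eq_iff[THEN iffD2], rule allI)
      fix i
      show "x $ i = (c *\<^sub>R y) $ i"
      proof -
        define p q where "p = x \<bullet> x" and "q = y \<bullet> y"
        have "p \<noteq> 0" "q \<noteq> 0" "x $ i * x $ j / p = y $ i * y $ j / q"
          using x(1) y(1) e[of i j] by (simp_all add: p_def q_def)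
        then show ?thesis
          using j unfolding c_def p_def[symmetric] q_def[symmetric] by (simp add: field_simps)
      qed
    qed
    moreover from this have "c \<noteq> 0"
      using x(1) by auto
    ultimately show "L = M"
      by (simp add: x(2) y(2))
  qed
qed simp

section \<open>The parametrised compactification\<close>

definition expand :: "real ^ 3 \<Rightarrow> real ^ 3" where
  "expand y = (1 / (1 - norm y)) *\<^sub>R y"

definition compress :: "real ^ 3 \<Rightarrow> real ^ 3" where
  "compress x = (1 / (1 + norm x)) *\<^sub>R x"

lemma compress_expand: "norm y < 1 \<Longrightarrow> compress (expand y) = y"
  by (simp add: compress_def expand_def field_simps abs_of_pos)

lemma norm_compress: "norm (compress x) < 1"
  by (simp add: compress_def field_simps abs_of_pos add_pos_nonneg)

lemma expand_compress: "expand (compress x) = x"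
proof -
  have "1 + norm x > 0"
    by (simp add: add_pos_nonneg)
  moreover have "norm (compress x) = norm x / (1 + norm x)"
    by (simp add: compress_def abs_of_pos add_pos_nonneg)
  ultimately have "1 - norm (compress x) = 1 / (1 + norm x)"
    by (simp add: field_simps)
  then show ?thesis
    using \<open>1 + norm x > 0\<close> by (simp add: expand_def) (simp add: compress_def)
qed

lemma homeomorphic_map_compress: "homeomorphic_map euclidean (top_of_set (ball 0 1)) compress"
  unfolding homeomorphic_map_maps homeomorphic_maps_def
proof (intro exI[of _ expand] conjI)
  have "1 + norm x \<noteq> 0" for x :: "real ^ 3"
    by (metis add_pos_nonneg less_irrefl norm_ge_zero zero_less_one)
  then have "continuous_on UNIV compress"
    unfolding compress_def by (intro continuous_intros) auto
  then show "continuous_map euclidean (top_of_set (ball 0 1)) compress"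
    using norm_compress by (auto simp: continuous_map_in_subtopology)
  have "continuous_on (ball 0 1) expand"
    unfolding expand_def by (intro continuous_intros) auto
  then show "continuous_map (top_of_set (ball 0 1)) euclidean expand"
    by simp
qed (auto simp: compress_expand expand_compress)

text \<open>The lengths, rescaled so as to stay bounded, extend continuously to the sphere at infinity.\<close>

definition scaled_lengths :: "real ^ 3 \<Rightarrow> real ^ side" where
  "scaled_lengths y = (if norm y < 1 then (1 - norm y) *\<^sub>R teich_lengths (expand y) else tropical_lengths y)"

lemma scaled_lengths_near_tropical_lengths:
  assumes "norm y \<le> 1"
  shows "norm (scaled_lengths y - tropical_lengths y) \<le> (1 - norm y) * (6 * ln 16)"
proof (cases "norm y < 1")
  case True
  then have "tropical_lengths y = tropical_lengths ((1 - norm y) *\<^sub>R expand y)"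
    by (simp add: expand_def)
  also have "\<dots> = (1 - norm y) *\<^sub>R tropical_lengths (expand y)"
    using True by (intro tropical_lengths_scale) simp
  finally have "scaled_lengths y - tropical_lengths y =
      (1 - norm y) *\<^sub>R (teich_lengths (expand y) - tropical_lengths (expand y))"
    using True by (simp add: scaled_lengths_def scaleR_diff_right)
  moreover have "norm (teich_lengths (expand y) - tropical_lengths (expand y)) \<le> 6 * ln 16"
  proof -
    have "norm (teich_lengths (expand y) - tropical_lengths (expand y))
        \<le> (\<Sum>s\<in>UNIV. \<bar>(teich_lengths (expand y) - tropical_lengths (expand y)) $ s\<bar>)"
      by (rule norm_le_l1_cart)
    also have "\<dots> \<le> (\<Sum>s\<in>(UNIV :: side set). ln 16)"
    proof (rule sum_mono)
      fix s
      show "\<bar>(teich_lengths (expand y) - tropical_lengths (expand y)) $ s\<bar> \<le> ln 16"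
        using teich_lengths_near_tropical_lengths[of "expand y" s] by simp
    qed
    also have "\<dots> = 6 * ln 16"
      by (simp add: UNIV_side)
    finally show ?thesis .
  qed
  ultimately show ?thesis
    using True by (simp add: mult_left_mono)
next
  case False
  then show ?thesis
    using assms by (simp add: scaled_lengths_def)
qed

text \<open>On the open ball continuity is clear. At the boundary the distance to the continuous function
  \<open>tropical_lengths\<close> tends to zero, because the rescaling turns the bounded difference into one of
  order \<open>1 - norm y\<close>.\<close>

lemma continuous_on_scaled_lengths: "continuous_on (cball 0 1) scaled_lengths"
proof -
  define D where "D y = scaled_lengths y - tropical_lengths y" for y
  have "continuous_on (ball 0 1) (\<lambda>y. (1 - norm y) *\<^sub>R teich_lengths (expand y))"
    unfolding expand_def
    by (intro continuous_intros continuous_on_compose2[OF continuous_on_teich_lengths[of UNIV]]) auto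
  then have "continuous_on (ball 0 1) scaled_lengths"
    by (rule continuous_on_eq) (simp add: scaled_lengths_def)
  then have ball: "continuous_on (ball 0 1) D"
    unfolding D_def by (intro continuous_intros continuous_on_tropical_lengths)
  have "continuous_on (cball 0 1) D"
    unfolding continuous_on_def
  proof
    fix y :: "real ^ 3" assume y: "y \<in> cball 0 1"
    show "(D \<longlongrightarrow> D y) (at y within cball 0 1)"
    proof (cases "norm y < 1")
      case True
      have "\<forall>x\<in>ball 0 1. isCont D x"
        using ball by (simp only: continuous_on_eq_continuous_at[OF open_ball])
      then have "isCont D y"
        using True by simp
      then show ?thesis
        by (simp add: isCont_def tendsto_within_subset[of D _ y UNIV])
    next
      case False
      then have n: "norm y = 1"
        using y by simp
      then have "D y = 0"
        by (simp add: D_def scaled_lengths_def)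
      have "((\<lambda>z. (1 - norm z) * (6 * ln 16)) \<longlongrightarrow> (1 - norm y) * (6 * ln 16)) (at y within cball 0 1)"
        by (intro tendsto_intros)
      then have lim: "((\<lambda>z. (1 - norm z) * (6 * ln 16)) \<longlongrightarrow> 0) (at y within cball 0 1)"
        by (simp add: n)
      have "(D \<longlongrightarrow> 0) (at y within cball 0 1)"
      proof (rule Lim_null_comparison[OF _ lim])
        show "\<forall>\<^sub>F z in at y within cball 0 1. norm (D z) \<le> (1 - norm z) * (6 * ln 16)"
          unfolding eventually_at_topological D_def
          using scaled_lengths_near_tropical_lengths by (intro exI[of _ UNIV]) auto
      qed
      then show ?thesis
        by (simp add: \<open>D y = 0\<close>)
    qed
  qed
  then have "continuous_on (cball 0 1) (\<lambda>y. D y + tropical_lengths y)"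
    by (intro continuous_intros continuous_on_tropical_lengths)
  then show ?thesis
    by (simp add: D_def)
qed

lemma tropical_lengths_nonzero: "y \<noteq> 0 \<Longrightarrow> tropical_lengths y \<noteq> 0"
  using inj_tropical_lengths tropical_lengths_0 by (metis injD)

lemma teich_lengths_nonzero: "teich_lengths y \<noteq> 0"
  using teich_lengths_pos[of y Side_a] by (metis less_irrefl zero_index)

lemma scaled_lengths_nonzero:
  assumes "norm y \<le> 1"
  shows "scaled_lengths y \<noteq> 0"
proof (cases "norm y < 1")
  case True
  then show ?thesis
    using teich_lengths_nonzero by (simp add: scaled_lengths_def)
next
  case False
  then have "y \<noteq> 0" by auto
  then show ?thesis
    using False tropical_lengths_nonzero[of y] by (simp add: scaled_lengths_def)
qed

lemma proj_eq_nonneg: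
  assumes "proj x = proj y" "x \<noteq> 0" "\<And>s. x $ s \<ge> 0" "\<And>s. y $ s \<ge> 0"
  obtains c where "c > 0" "x = c *\<^sub>R y"
proof -
  obtain c where c: "c \<noteq> 0" "x = c *\<^sub>R y"
    using proj_eqD[OF assms(1,2)] .
  obtain s where s: "x $ s \<noteq> 0"
    using assms(2) by (auto simp: vec_eq_iff)
  then have "x $ s > 0"
    using assms(3)[of s] by linarith
  then have "c * y $ s > 0"
    unfolding c(2) by simp
  then have "c > 0"
    using assms(4)[of s] by (simp add: zero_less_mult_iff)
  then show ?thesis
    using that c(2) by blast
qed

lemma proj_teich_lengths_eq:
  assumes "proj (teich_lengths x) = proj (teich_lengths y)"
  shows "x = y"
proof -
  have pos: "teich_lengths z $ s \<ge> 0" for z s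
    using teich_lengths_pos[of z s] by simp
  obtain c where "c > 0" "teich_lengths x = c *\<^sub>R teich_lengths y"
    using proj_eq_nonneg[OF assms teich_lengths_nonzero pos pos] .
  then show ?thesis
    using teich_lengths_not_proportional by blast
qed

lemma proj_tropical_lengths_eq:
  assumes "proj (tropical_lengths x) = proj (tropical_lengths y)" "x \<noteq> 0"
  obtains c where "c > 0" "x = c *\<^sub>R y"
proof -
  obtain c where c: "c > 0" "tropical_lengths x = c *\<^sub>R tropical_lengths y"
    using proj_eq_nonneg[OF assms(1) tropical_lengths_nonzero[OF assms(2)]
        tropical_lengths_nonneg tropical_lengths_nonneg] .
  then have "tropical_lengths x = tropical_lengths (c *\<^sub>R y)"
    by (simp add: tropical_lengths_scale)
  then show ?thesis
    using that c(1) injD[OF inj_tropical_lengths] by blast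
qed

text \<open>Lengths are positive, while a foliation does not meet some side.\<close>

lemma proj_teich_neq_proj_tropical: "proj (teich_lengths x) \<noteq> proj (tropical_lengths y)"
proof
  assume eq: "proj (teich_lengths x) = proj (tropical_lengths y)"
  obtain c where c: "c \<noteq> 0" "teich_lengths x = c *\<^sub>R tropical_lengths y"
    using proj_eqD[OF eq teich_lengths_nonzero] .
  obtain s where "tropical_lengths y $ s = 0"
    using tropical_lengths_zero_coordinate by blast
  then have "teich_lengths x $ s = 0"
    using c(2) by simp
  then show False
    using teich_lengths_pos[of x s] by simp
qed

definition compactification :: "real ^ 3 \<Rightarrow> (real ^ side) set" where
  "compactification y = proj (scaled_lengths y)"

lemma compactification_interior: "norm y < 1 \<Longrightarrow> compactification y = proj (teich_lengths (expand y))"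
  by (simp add: compactification_def scaled_lengths_def)

lemma compactification_boundary: "norm y = 1 \<Longrightarrow> compactification y = proj (tropical_lengths y)"
  by (simp add: compactification_def scaled_lengths_def)

lemma embedding_compactification: "embedding_map (top_of_set (cball 0 1)) projective_space compactification"
proof (rule injective_closed_imp_embedding_map)
  have "continuous_map (top_of_set (cball 0 1)) (top_of_set (- {0})) scaled_lengths"
    using continuous_on_scaled_lengths scaled_lengths_nonzero
    by (auto simp: continuous_map_in_subtopology)
  then show c: "continuous_map (top_of_set (cball 0 1)) projective_space compactification"
    using continuous_map_compose[OF _ continuous_map_proj] unfolding compactification_def comp_def by blast
  show "closed_map (top_of_set (cball 0 1)) projective_space compactification"
    by (rule continuous_imp_closed_map[OF c _ Hausdorff_projective_space])
      (simp add: compact_space_subtopology)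
  show "inj_on compactification (topspace (top_of_set (cball 0 1)))"
  proof (rule inj_onI)
    fix x y :: "real ^ 3"
    assume "x \<in> topspace (top_of_set (cball 0 1))" "y \<in> topspace (top_of_set (cball 0 1))"
      and eq: "compactification x = compactification y"
    then have "norm x \<le> 1" "norm y \<le> 1" by auto
    then consider "norm x < 1" "norm y < 1" | "norm x = 1" "norm y = 1"
      | "norm x < 1" "norm y = 1" | "norm x = 1" "norm y < 1"
      by linarith
    then show "x = y"
    proof cases
      case 1
      then have "expand x = expand y"
        using eq proj_teich_lengths_eq by (simp add: compactification_interior)
      then show ?thesis
        using 1 compress_expand by metis
    next
      case 2
      then have "proj (tropical_lengths x) = proj (tropical_lengths y)" "x \<noteq> 0"
        using eq by (auto simp: compactification_boundary)
      then obtain c where "c > 0" "x = c *\<^sub>R y"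
        using proj_tropical_lengths_eq by blast
      then show ?thesis
        using 2 by simp
    next
      case 3
      then show ?thesis
        using eq proj_teich_neq_proj_tropical by (simp add: compactification_interior compactification_boundary)
    next
      case 4
      then show ?thesis
        using eq proj_teich_neq_proj_tropical by (metis compactification_interior compactification_boundary)
    qed
  qed
qed

lemma compactification_ball: "compactification ` ball 0 1 = (proj \<circ> l_star) ` Teich"
proof -
  have "compactification ` ball 0 1 = (\<lambda>y. proj (teich_lengths (expand y))) ` ball 0 1"
    by (rule image_cong[OF refl]) (simp add: compactification_interior)
  also have "\<dots> = (\<lambda>x. proj (teich_lengths x)) ` expand ` ball 0 1"
    by (simp only: image_image)
  also have "expand ` ball 0 1 = UNIV"
  proof -
    have "x = expand (compress x)" "compress x \<in> ball 0 1" for x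
      using norm_compress[of x] by (simp_all add: expand_compress)
    then show ?thesis
      by blast
  qed
  also have "(\<lambda>x. proj (teich_lengths x)) ` UNIV = proj ` range teich_lengths"
    by (simp only: image_image)
  finally show ?thesis
    by (simp only: range_teich_lengths image_comp)
qed

lemma compactification_sphere: "compactification ` sphere 0 1 = (proj \<circ> i_star) ` MF"
proof -
  have "compactification ` sphere 0 1 = (\<lambda>x. proj (tropical_lengths x)) ` sphere 0 1"
    by (rule image_cong[OF refl]) (simp add: compactification_boundary)
  also have "\<dots> = (\<lambda>x. proj (tropical_lengths x)) ` (- {0})"
  proof
    show "(\<lambda>x. proj (tropical_lengths x)) ` sphere 0 1 \<subseteq> (\<lambda>x. proj (tropical_lengths x)) ` (- {0})"
      by (rule image_mono) auto
    show "(\<lambda>x. proj (tropical_lengths x)) ` (- {0}) \<subseteq> (\<lambda>x. proj (tropical_lengths x)) ` sphere 0 1"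
    proof (rule image_subsetI)
      fix x :: "real ^ 3" assume "x \<in> - {0}"
      then have x: "norm x \<noteq> 0" by simp
      let ?u = "(1 / norm x) *\<^sub>R x"
      have "tropical_lengths ?u = (1 / norm x) *\<^sub>R tropical_lengths x"
        by (intro tropical_lengths_scale) simp
      then have "proj (tropical_lengths ?u) = proj (tropical_lengths x)"
        using x by simp
      moreover have "?u \<in> sphere 0 1"
        using x by simp
      ultimately show "proj (tropical_lengths x) \<in> (\<lambda>x. proj (tropical_lengths x)) ` sphere 0 1"
        by (metis (mono_tags, lifting) imageI)
    qed
  qed
  also have "\<dots> = proj ` tropical_lengths ` (- {0})"
    by (simp only: image_image)
  finally show ?thesis
    by (simp only: i_star_image_tropical[symmetric] image_comp)
qed

section \<open>The embeddings\<close>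

text \<open>The open ball, the coordinates \<open>ln (sinh a)\<close>, \<open>ln (sinh b)\<close>, \<open>ln (sinh c)\<close> and the Teichmueller space
  are identified in such a way that the projectivised lengths become \<open>compactification\<close>.\<close>

lemma Teich_ball:
  obtains k where "homeomorphic_map Teich_topology (top_of_set (ball 0 1)) k"
    "\<And>h. h \<in> Teich \<Longrightarrow> compactification (k h) = proj (l_star h)"
proof -
  have 1: "homeomorphic_map Teich_topology (top_of_set (range teich_lengths)) l_star"
    unfolding Teich_topology_def range_teich_lengths by (rule homeomorphic_map_pullback[OF inj_on_l_star])
  have 2: "homeomorphic_map (top_of_set (range teich_lengths)) euclidean log_sinh_sides"
    unfolding homeomorphic_map_maps homeomorphic_maps_def
    using continuous_on_log_sinh_sides continuous_on_teich_lengths[of UNIV]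
    by (intro exI[of _ teich_lengths]) (auto simp: continuous_map_in_subtopology)
  let ?k = "compress \<circ> (log_sinh_sides \<circ> l_star)"
  have "homeomorphic_map Teich_topology (top_of_set (ball 0 1)) ?k"
    by (intro homeomorphic_map_compose[OF homeomorphic_map_compose[OF 1 2]] homeomorphic_map_compress)
  moreover have "compactification (?k h) = proj (l_star h)" if "h \<in> Teich" for h
  proof -
    have "l_star h \<in> range teich_lengths"
      using that range_teich_lengths by blast
    then obtain y where "l_star h = teich_lengths y" by blast
    then show ?thesis
      by (simp add: compactification_interior norm_compress expand_compress)
  qed
  ultimately show ?thesis
    using that by blast
qed

lemma topspace_Teich_topology: "topspace Teich_topology = Teich"
  by (simp add: Teich_topology_def topspace_pullback_topology)

lemma topspace_MF_topology: "topspace MF_topology = MF"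
  by (simp add: MF_topology_def topspace_pullback_topology)

lemma topspace_PMF_topology: "topspace PMF_topology = PMF"
  by (auto simp: PMF_topology_def topspace_quotient_topology topspace_MF_topology PMF_def quotient_def)

lemma embedding_Teich: "embedding_map Teich_topology projective_space (proj \<circ> l_star)"
proof -
  obtain k where k: "homeomorphic_map Teich_topology (top_of_set (ball 0 1)) k"
    "\<And>h. h \<in> Teich \<Longrightarrow> compactification (k h) = proj (l_star h)"
    using Teich_ball by blast
  have sub: "subtopology (top_of_set (cball 0 1)) (ball 0 1) = top_of_set (ball (0 :: real ^ 3) 1)"
    by (simp add: subtopology_subtopology Int_absorb1)
  have "embedding_map (top_of_set (ball 0 1)) (top_of_set (cball 0 1)) (id :: real ^ 3 \<Rightarrow> real ^ 3)"
    unfolding embedding_map_def sub[symmetric] by (simp add: subtopology_subtopology Int_absorb1 Int_absorb2 ball_subset_cball)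
  moreover have "embedding_map Teich_topology (top_of_set (ball 0 1)) k"
    using k(1) surjective_embedding_map by blast
  ultimately have "embedding_map Teich_topology projective_space (compactification \<circ> (id \<circ> k))"
    using embedding_compactification by (intro embedding_map_compose)
  then show ?thesis
    by (rule embedding_map_eq) (simp add: topspace_Teich_topology k(2))
qed

lemma i_star_tropical:
  assumes "X \<in> MF"
  obtains x where "x \<noteq> 0" "i_star X = tropical_lengths x"
proof -
  have "i_star X \<in> tropical_lengths ` (- {0})"
    unfolding i_star_image_tropical[symmetric] using assms by (rule imageI)
  then obtain x where "x \<noteq> 0" "i_star X = tropical_lengths x"
    by blast
  then show ?thesis by (rule that)
qed

text \<open>Proportional vectors in the image of \<open>i_star\<close> have a positive factor, as they are nonnegative, and
  \<open>i_star\<close> is homogeneous and injective.\<close>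

lemma i_star_scaling:
  assumes "X \<in> MF" "Y \<in> MF"
  shows "proj (i_star X) = proj (i_star Y) \<longleftrightarrow> (X, Y) \<in> scaling_equiv"
proof
  obtain x where x: "x \<noteq> 0" "i_star X = tropical_lengths x"
    using i_star_tropical[OF assms(1)] .
  obtain y where y: "y \<noteq> 0" "i_star Y = tropical_lengths y"
    using i_star_tropical[OF assms(2)] .
  assume "proj (i_star X) = proj (i_star Y)"
  then have "proj (tropical_lengths y) = proj (tropical_lengths x)"
    using x y by simp
  then obtain c where "c > 0" "y = c *\<^sub>R x"
    using proj_tropical_lengths_eq[OF _ y(1)] by blast
  then have "i_star Y = c *\<^sub>R i_star X"
    by (simp add: x y tropical_lengths_scale)
  then show "(X, Y) \<in> scaling_equiv"
    using assms \<open>c > 0\<close> by (auto simp: scaling_equiv_iff)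
next
  assume "(X, Y) \<in> scaling_equiv"
  then obtain c where "c > 0" "i_star Y = c *\<^sub>R i_star X"
    unfolding scaling_equiv_iff by blast
  then show "proj (i_star X) = proj (i_star Y)"
    by simp
qed

lemma PMF_to_proj_class:
  assumes "X \<in> MF"
  shows "PMF_to_proj (scaling_equiv `` {X}) = proj (i_star X)"
proof -
  have "(\<lambda>X. proj (i_star X)) ` scaling_equiv `` {X} = {proj (i_star X)}"
  proof (intro equalityI subsetI)
    fix L assume "L \<in> (\<lambda>X. proj (i_star X)) ` scaling_equiv `` {X}"
    then obtain Y where Y: "(X, Y) \<in> scaling_equiv" "L = proj (i_star Y)" by blast
    then have "Y \<in> MF"
      by (simp add: scaling_equiv_iff)
    then show "L \<in> {proj (i_star X)}"
      using i_star_scaling[OF assms] Y by blast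
  next
    fix L assume "L \<in> {proj (i_star X)}"
    moreover have "(X, X) \<in> scaling_equiv"
      using i_star_scaling[OF assms assms] by blast
    ultimately show "L \<in> (\<lambda>X. proj (i_star X)) ` scaling_equiv `` {X}" by blast
  qed
  then show ?thesis
    by (simp add: PMF_to_proj_def)
qed

lemma PMF_eq: "PMF = (\<lambda>X. scaling_equiv `` {X}) ` MF"
  by (auto simp: PMF_def quotient_def)

lemma PMF_to_proj_image: "PMF_to_proj ` PMF = (proj \<circ> i_star) ` MF"
  unfolding PMF_eq image_image by (rule image_cong[OF refl]) (simp add: PMF_to_proj_class)

lemma scaling_class_eq_iff:
  assumes "X \<in> MF" "Y \<in> MF"
  shows "scaling_equiv `` {X} = scaling_equiv `` {Y} \<longleftrightarrow> proj (i_star X) = proj (i_star Y)"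
proof
  assume "scaling_equiv `` {X} = scaling_equiv `` {Y}"
  then show "proj (i_star X) = proj (i_star Y)"
    using PMF_to_proj_class assms by metis
next
  assume eq: "proj (i_star X) = proj (i_star Y)"
  have "scaling_equiv `` {X} = {Z \<in> MF. proj (i_star X) = proj (i_star Z)}" if "X \<in> MF" for X
    using i_star_scaling[OF that] scaling_equiv_iff by blast
  then show "scaling_equiv `` {X} = scaling_equiv `` {Y}"
    using assms eq by simp
qed

text \<open>Every projective class is represented by a point of the unit sphere.\<close>

lemma compact_PMF: "compact_space PMF_topology"
proof -
  define j where "j y = the_inv_into MF i_star (tropical_lengths y)" for y
  have j: "j y \<in> MF" "i_star (j y) = tropical_lengths y" if "y \<noteq> 0" for y
  proof -
    have "tropical_lengths y \<in> i_star ` MF"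
      using that i_star_image_tropical by blast
    then show "j y \<in> MF" "i_star (j y) = tropical_lengths y"
      unfolding j_def using the_inv_into_into[OF inj_on_i_star] f_the_inv_into_f[OF inj_on_i_star] by blast+
  qed
  have "continuous_on (sphere 0 1) (i_star \<circ> j)"
  proof (rule continuous_on_eq[OF continuous_on_tropical_lengths])
    fix y :: "real ^ 3" assume "y \<in> sphere 0 1"
    then have "y \<noteq> 0" by auto
    then show "tropical_lengths y = (i_star \<circ> j) y"
      by (simp add: j(2))
  qed
  then have "continuous_map (top_of_set (sphere 0 1)) MF_topology j"
    unfolding MF_topology_def
  proof (intro continuous_map_pullback')
    have "y \<noteq> 0" if "y \<in> sphere 0 1" for y :: "real ^ 3"
      using that by auto
    then show "topspace (top_of_set (sphere 0 1)) \<subseteq> j -` MF"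
      using j(1) by auto
  qed simp
  then have c: "continuous_map (top_of_set (sphere 0 1)) PMF_topology ((\<lambda>X. scaling_equiv `` {X}) \<circ> j)"
    unfolding PMF_topology_def by (rule continuous_map_compose[OF _ continuous_map_quotient_projection])
  have "PMF \<subseteq> ((\<lambda>X. scaling_equiv `` {X}) \<circ> j) ` sphere 0 1"
  proof
    fix P assume "P \<in> PMF"
    then obtain X where X: "X \<in> MF" "P = scaling_equiv `` {X}"
      unfolding PMF_eq by blast
    then have "proj (i_star X) \<in> compactification ` sphere 0 1"
      unfolding compactification_sphere using imageI[of X MF "proj \<circ> i_star"] by simp
    then obtain u where u: "norm u = 1" "proj (i_star X) = proj (tropical_lengths u)"
      by (auto simp: compactification_boundary)
    then have "u \<noteq> 0" by auto
    then have "P = scaling_equiv `` {j u}"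
      using scaling_class_eq_iff[OF X(1) j(1)[OF \<open>u \<noteq> 0\<close>]] u(2) j(2)[OF \<open>u \<noteq> 0\<close>] X(2) by simp
    then show "P \<in> ((\<lambda>X. scaling_equiv `` {X}) \<circ> j) ` sphere 0 1"
      using u(1) imageI[of u "sphere 0 1" "(\<lambda>X. scaling_equiv `` {X}) \<circ> j"] by simp
  qed
  moreover have "compactin PMF_topology (((\<lambda>X. scaling_equiv `` {X}) \<circ> j) ` sphere 0 1)"
    by (rule image_compactin[OF _ c]) (simp add: compactin_subtopology)
  moreover have "((\<lambda>X. scaling_equiv `` {X}) \<circ> j) ` sphere 0 1 \<subseteq> PMF"
  proof (rule image_subsetI)
    fix y :: "real ^ 3" assume "y \<in> sphere 0 1"
    then have "y \<noteq> 0" by auto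
    then show "((\<lambda>X. scaling_equiv `` {X}) \<circ> j) y \<in> PMF"
      unfolding PMF_eq comp_def by (intro imageI j(1))
  qed
  ultimately show ?thesis
    unfolding compact_space_def topspace_PMF_topology by (simp add: subset_antisym)
qed

lemma embedding_PMF: "embedding_map PMF_topology projective_space PMF_to_proj"
proof (rule injective_closed_imp_embedding_map)
  have "continuous_map MF_topology euclidean i_star"
    using continuous_map_pullback[of euclidean euclidean id MF i_star] by (simp add: MF_topology_def)
  moreover have "i_star X \<noteq> 0" if "X \<in> MF" for X
    using i_star_tropical[OF that] tropical_lengths_nonzero by metis
  ultimately have "continuous_map MF_topology (top_of_set (- {0})) i_star"
    by (auto simp: continuous_map_in_subtopology topspace_MF_topology)
  then have "continuous_map MF_topology projective_space (proj \<circ> i_star)"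
    by (rule continuous_map_compose[OF _ continuous_map_proj])
  then have "continuous_map MF_topology projective_space (PMF_to_proj \<circ> (\<lambda>X. scaling_equiv `` {X}))"
    by (rule continuous_map_eq) (simp add: PMF_to_proj_class topspace_MF_topology)
  then show c: "continuous_map PMF_topology projective_space PMF_to_proj"
    unfolding PMF_topology_def by (rule continuous_map_from_quotient)
  show "closed_map PMF_topology projective_space PMF_to_proj"
    by (rule continuous_imp_closed_map[OF c compact_PMF Hausdorff_projective_space])
  show "inj_on PMF_to_proj (topspace PMF_topology)"
    unfolding topspace_PMF_topology
  proof (rule inj_onI)
    fix P Q assume "P \<in> PMF" "Q \<in> PMF" and eq: "PMF_to_proj P = PMF_to_proj Q"
    then obtain X Y where "X \<in> MF" "P = scaling_equiv `` {X}" "Y \<in> MF" "Q = scaling_equiv `` {Y}"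
      unfolding PMF_eq by blast
    then show "P = Q"
      using eq by (simp add: PMF_to_proj_class scaling_class_eq_iff)
  qed
qed

theorem theorem3p8:
  shows "Teich_topology homeomorphic_space top_of_set (ball 0 1 :: (real ^ 3) set)
    \<and> embedding_map Teich_topology projective_space (proj \<circ> l_star)
    \<and> embedding_map PMF_topology projective_space PMF_to_proj
    \<and> PMF_to_proj ` PMF = (proj \<circ> i_star) ` MF
    \<and> (\<exists>f :: (real ^ side) set \<Rightarrow> real ^ 3.
          homeomorphic_map (subtopology projective_space Teich_closure) (top_of_set (cball 0 1)) f
        \<and> f ` (proj \<circ> l_star) ` Teich = ball 0 1
        \<and> f ` (proj \<circ> i_star) ` MF = sphere 0 1)"
proof (intro conjI embedding_Teich embedding_PMF PMF_to_proj_image)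
  show "Teich_topology homeomorphic_space top_of_set (ball 0 1 :: (real ^ 3) set)"
    using Teich_ball homeomorphic_map_imp_homeomorphic_space by metis
  have "compactification ` cball 0 1 = Teich_closure"
    unfolding Teich_closure_def compactification_ball[symmetric] compactification_sphere[symmetric]
    image_Un[symmetric] by (rule arg_cong[where f = "image compactification"]) auto
  then have "homeomorphic_map (top_of_set (cball 0 1)) (subtopology projective_space Teich_closure) compactification"
    using embedding_compactification by (simp add: embedding_map_def)
  then obtain f where f: "homeomorphic_maps (top_of_set (cball 0 1))
      (subtopology projective_space Teich_closure) compactification f"
    unfolding homeomorphic_map_maps by blast
  then have inv: "f (compactification y) = y" if "y \<in> cball 0 1" for y
    using that by (simp add: homeomorphic_maps_def)
  have "f ` compactification ` S = S" if "S \<subseteq> cball 0 1" for S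
    using that inv by (force simp: image_image)
  then have "f ` (proj \<circ> l_star) ` Teich = ball 0 1" "f ` (proj \<circ> i_star) ` MF = sphere 0 1"
    unfolding compactification_ball[symmetric] compactification_sphere[symmetric]
    by (simp_all add: ball_subset_cball sphere_cball)
  moreover have "homeomorphic_map (subtopology projective_space Teich_closure) (top_of_set (cball 0 1)) f"
    using f homeomorphic_maps_sym homeomorphic_map_maps by blast
  ultimately show "\<exists>f :: (real ^ side) set \<Rightarrow> real ^ 3.
          homeomorphic_map (subtopology projective_space Teich_closure) (top_of_set (cball 0 1)) f
        \<and> f ` (proj \<circ> l_star) ` Teich = ball 0 1
        \<and> f ` (proj \<circ> i_star) ` MF = sphere 0 1"
    by blast
qed

end
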